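(* Let $\Lambda=(\pmb a;\lambda)$ and $\Omega=(\pmb b;\mu)$ be $m$-partitions and let the number of variables $N$ satisfy $N\ge m+\ell(\lambda)$ and $N\ge m+\ell(\mu)$. Let $$\tilde P_\Lambda(x;q,t)=\frac{P_\Lambda(x;q,t)}{u_\emptyset(P_\Lambda(x;q,t))}$$ be the normalized $m$-symmetric Macdonald polynomials in $N$ variables, where $u_\emptyset(f)=f(1,t,\dots,t^{N-1})$. Then the following symmetry holds: $$u_\Omega(\tilde P_\Lambda)=u_\Lambda(\tilde P_\Omega).$$
   Context: An $m$-partition is a pair $\Lambda=(\pmb a;\lambda)$ with $\pmb a=(a_1,\dots,a_m)\in\mathbb Z_{\ge0}^m$ and $\lambda$ a partition. Evaluations. To $\Lambda$ associate the composition $\gamma_\Lambda=(a_1,\dots,a_m,\lambda_1,\dots,\lambda_\ell,0^{N-m-\ell})$, $\ell=\ell(\lambda)$, and let $w$ be the minimal length permutation in $S_N$ such that $w\gamma_\Lambda$ is weakly decreasing, so that $w\gamma_\Lambda=\Lambda^{(0)}$ where $\Lambda^{(0)}$ is the partition obtained by sorting all the parts of $\pmb a$ and $\lambda$ (padded with zeros), i.e. $(\gamma_\Lambda)_i=\Lambda^{(0)}_{w(i)}$. For a polynomial $f(x_1,\dots,x_N)$ symmetric in $x_{m+1},\dots,x_N$, $$u_\Lambda\bigl(f(x_1,\dots,x_N)\bigr)=f\left(q^{-\Lambda^{(0)}_{w(1)}}t^{w(1)-1},\dots,q^{-\Lambda^{(0)}_{w(N)}}t^{w(N)-1}\right).$$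 Non-symmetric Macdonald polynomials. In $N$ variables let $K_{i,j}$ exchange $x_i$ and $x_j$, let $\tau_i$ replace $x_i$ by $qx_i$, and put $T_i=t+\frac{tx_i-x_{i+1}}{x_i-x_{i+1}}(K_{i,i+1}-1)$ for $1\le i\le N-1$, $\omega=K_{N-1,N}\cdots K_{1,2}\tau_1$, $Y_i=t^{-N+i}T_i\cdots T_{N-1}\,\omega\,T_1^{-1}\cdots T_{i-1}^{-1}$. For $\eta\in\mathbb Z_{\ge0}^N$, $E_\eta(x;q,t)$ is the unique polynomial over $\mathbb Q(q,t)$ of the form $x^\eta+\sum_{\nu\prec\eta}b_{\eta\nu}(q,t)x^\nu$ with $Y_iE_\eta=q^{\eta_i}t^{1-r_\eta(i)}E_\eta$ for $i=1,\dots,N$, where $r_\eta(i)=\#\{j:\eta_j>\eta_i\}+\#\{j\le i:\eta_j=\eta_i\}$. Here $\nu\prec\eta$ iff $\nu^+<\eta^+$ in dominance order, or $\nu^+=\eta^+$ and $w_\eta<w_\nu$ in Bruhat order, where $\eta^+$ is the decreasing rearrangement of $\eta$ and $w_\eta$ is the minimal length permutation with $\eta=w_\eta\eta^+$. $m$-symmetric Macdonald polynomials. For $N\ge m+\ell(\lambda)$ let $\eta_{\Lambda,N}=(a_1,\dots,a_m,\lambda_{N-m},\dots,\lambda_1)$ (with $\lambda_i=0$ for $i>\ell(\lambda)$) and $$P_\Lambda(x_1,\dots,x_N;q,t)=\frac1{u_{\Lambda,N}(t)}\sum_{\sigma}T_\sigma E_{\eta_{\Lambda,N}}(x_1,\dots,x_N;q,t),$$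 the sum being over permutations $\sigma$ of $\{m+1,\dots,N\}$, $T_\sigma=T_{i_1}\cdots T_{i_r}$ for a reduced decomposition $\sigma=s_{i_1}\cdots s_{i_r}$, and $u_{\Lambda,N}(t)=\bigl(\prod_{i\ge0}[n_\lambda(i)]_{t^{-1}}!\bigr)t^{(N-m)(N-m-1)/2}$ with $n_\lambda(i)$ the number of entries of $(\lambda_1,\dots,\lambda_{N-m})$ equal to $i$ and $[k]_p!=\prod_{j=1}^k\frac{1-p^j}{1-p}$. *)

theory Defs
  imports
    "HOL-Library.Poly_Mapping"
    "HOL-Computational_Algebra.Polynomial"
    "HOL-Computational_Algebra.Fraction_Field"
    "HOL-Combinatorics.Permutations"
begin

section \<open>The field of rational functions in q and t, and polynomials over it\<close>

text \<open>The coefficient field is the fraction field of \<open>\<rat>[q][t]\<close>. A polynomial maps exponents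
  (finitely supported functions from variable indices to \<open>nat\<close>) to coefficients; the
  variables used below are indexed from 1 to \<open>N\<close>.\<close>

type_synonym qt_field = "rat poly poly fract"
type_synonym qt_mpoly = "(nat \<Rightarrow>\<^sub>0 nat) \<Rightarrow>\<^sub>0 qt_field"

definition qq :: qt_field where
  "qq = Fract [:[:0, 1:]:] 1"

definition tt :: qt_field where
  "tt = Fract [:0, 1:] 1"

definition Const :: "qt_field \<Rightarrow> qt_mpoly" where
  "Const c = Poly_Mapping.single 0 c"

definition Var :: "nat \<Rightarrow> qt_mpoly" where
  "Var i = Poly_Mapping.single (Poly_Mapping.single i 1) 1"

definition evaluate :: "(nat \<Rightarrow> qt_field) \<Rightarrow> qt_mpoly \<Rightarrow> qt_field" where
  "evaluate x f = (\<Sum>e\<in>Poly_Mapping.keys f. Poly_Mapping.lookup f e *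
     (\<Prod>i\<in>Poly_Mapping.keys e. x i ^ Poly_Mapping.lookup e i))"

definition substitute :: "(nat \<Rightarrow> qt_mpoly) \<Rightarrow> qt_mpoly \<Rightarrow> qt_mpoly" where
  "substitute g f = (\<Sum>e\<in>Poly_Mapping.keys f. Const (Poly_Mapping.lookup f e) *
     (\<Prod>i\<in>Poly_Mapping.keys e. g i ^ Poly_Mapping.lookup e i))"


section \<open>Permutations\<close>

text \<open>Length and reduced decompositions in the Coxeter group \<open>S\<^sub>N\<close>, realised as the
  permutations of \<open>{1..N}\<close> with generators \<open>s\<^sub>i = (i, i+1)\<close>, \<open>1 \<le> i < N\<close>.\<close>

definition word_perm :: "nat list \<Rightarrow> nat \<Rightarrow> nat" where
  "word_perm is = foldr (\<lambda>i w. transpose i (Suc i) \<circ> w) is id"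

definition perm_length :: "nat \<Rightarrow> (nat \<Rightarrow> nat) \<Rightarrow> nat" where
  "perm_length N w = (LEAST r. \<exists>is. set is \<subseteq> {1..<N} \<and> word_perm is = w \<and> length is = r)"

definition is_reduced_word :: "nat \<Rightarrow> nat list \<Rightarrow> (nat \<Rightarrow> nat) \<Rightarrow> bool" where
  "is_reduced_word N is w \<longleftrightarrow>
     set is \<subseteq> {1..<N} \<and> word_perm is = w \<and> length is = perm_length N w"

definition bruhat_less :: "nat \<Rightarrow> (nat \<Rightarrow> nat) \<Rightarrow> (nat \<Rightarrow> nat) \<Rightarrow> bool" where
  "bruhat_less N = (\<lambda>u v. u permutes {1..N} \<and>
     (\<exists>i\<in>{1..N}. \<exists>j\<in>{1..N}. v = u \<circ> transpose i j) \<and> perm_length N u < perm_length N v)\<^sup>+\<^sup>+"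


section \<open>Compositions\<close>

text \<open>A composition with \<open>N\<close> parts is a list of length \<open>N\<close>; \<open>part\<close> accesses its entries with
  indices starting at 1.\<close>

definition part :: "nat list \<Rightarrow> nat \<Rightarrow> nat" where
  "part \<eta> i = \<eta> ! (i - 1)"

definition decreasing :: "nat list \<Rightarrow> nat list" where
  "decreasing \<eta> = rev (sort \<eta>)"

definition monomial :: "nat list \<Rightarrow> qt_mpoly" where
  "monomial \<eta> = (\<Prod>i\<in>{1..length \<eta>}. Var i ^ part \<eta> i)"

definition dominance_less :: "nat list \<Rightarrow> nat list \<Rightarrow> bool" where
  "dominance_less \<nu> \<eta> \<longleftrightarrow> sum_list \<nu> = sum_list \<eta> \<and>
     (\<forall>k. sum_list (take k \<nu>) \<le> sum_list (take k \<eta>)) \<and> \<nu> \<noteq> \<eta>"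

text \<open>The minimal length \<open>w\<close> with \<open>\<eta> = w \<eta>\<^sup>+\<close>, for the left action
  \<open>(w \<nu>)\<^bsub>w(i)\<^esub> = \<nu>\<^sub>i\<close>.\<close>

definition min_perm :: "nat list \<Rightarrow> nat \<Rightarrow> nat" where
  "min_perm \<eta> = (ARG_MIN (perm_length (length \<eta>)) w. w permutes {1..length \<eta>} \<and>
     (\<forall>i\<in>{1..length \<eta>}. part \<eta> (w i) = part (decreasing \<eta>) i))"

definition comp_less :: "nat list \<Rightarrow> nat list \<Rightarrow> bool" where
  "comp_less \<nu> \<eta> \<longleftrightarrow> length \<nu> = length \<eta> \<and>
     (dominance_less (decreasing \<nu>) (decreasing \<eta>) \<or>
      decreasing \<nu> = decreasing \<eta> \<and> bruhat_less (length \<eta>) (min_perm \<eta>) (min_perm \<nu>))"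

definition rank :: "nat list \<Rightarrow> nat \<Rightarrow> nat" where
  "rank \<eta> i = card {j \<in> {1..length \<eta>}. part \<eta> j > part \<eta> i} +
              card {j \<in> {1..i}. part \<eta> j = part \<eta> i}"


section \<open>Non-symmetric Macdonald polynomials\<close>

definition K_op :: "nat \<Rightarrow> nat \<Rightarrow> qt_mpoly \<Rightarrow> qt_mpoly" where
  "K_op i j = substitute (\<lambda>k. Var (transpose i j k))"

definition tau_op :: "nat \<Rightarrow> qt_mpoly \<Rightarrow> qt_mpoly" where
  "tau_op i = substitute (Var(i := Const qq * Var i))"

text \<open>The polynomial \<open>(K\<^bsub>i,i+1\<^esub> f - f) / (x\<^sub>i - x\<^bsub>i+1\<^esub>)\<close>; the division is always exact.\<close>

definition divided_difference :: "nat \<Rightarrow> qt_mpoly \<Rightarrow> qt_mpoly" where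
  "divided_difference i f = (THE g. (Var i - Var (Suc i)) * g = K_op i (Suc i) f - f)"

definition T_op :: "nat \<Rightarrow> qt_mpoly \<Rightarrow> qt_mpoly" where
  "T_op i f = Const tt * f + (Const tt * Var i - Var (Suc i)) * divided_difference i f"

definition omega_op :: "nat \<Rightarrow> qt_mpoly \<Rightarrow> qt_mpoly" where
  "omega_op N f = foldr (\<lambda>j. K_op j (Suc j)) (rev [1..<N]) (tau_op 1 f)"

definition Y_op :: "nat \<Rightarrow> nat \<Rightarrow> qt_mpoly \<Rightarrow> qt_mpoly" where
  "Y_op N i f = Const (tt powi (int i - int N)) *
     foldr T_op [i..<N] (omega_op N (foldr (\<lambda>j. inv (T_op j)) [1..<i] f))"

definition is_nonsym_macdonald :: "nat list \<Rightarrow> qt_mpoly \<Rightarrow> bool" where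
  "is_nonsym_macdonald \<eta> f \<longleftrightarrow>
     (\<exists>b. f = monomial \<eta> + (\<Sum>\<nu> | comp_less \<nu> \<eta>. Const (b \<nu>) * monomial \<nu>)) \<and>
     (\<forall>i\<in>{1..length \<eta>}.
        Y_op (length \<eta>) i f = Const (qq ^ part \<eta> i * tt powi (1 - int (rank \<eta> i))) * f)"

definition nonsym_macdonald :: "nat list \<Rightarrow> qt_mpoly" where
  "nonsym_macdonald \<eta> = (THE f. is_nonsym_macdonald \<eta> f)"


section \<open>m-partitions and m-symmetric Macdonald polynomials\<close>

type_synonym m_partition = "nat list \<times> nat list"

text \<open>In \<open>(a, lam)\<close> the list \<open>lam\<close> consists of the nonzero parts of the partition only, so its
  number of parts is \<open>length lam\<close>.\<close>

definition is_m_partition :: "nat \<Rightarrow> m_partition \<Rightarrow> bool" where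
  "is_m_partition m \<Lambda> \<longleftrightarrow>
     length (fst \<Lambda>) = m \<and> sorted_wrt (\<ge>) (snd \<Lambda>) \<and> 0 \<notin> set (snd \<Lambda>)"

definition pad :: "nat \<Rightarrow> nat list \<Rightarrow> nat list" where
  "pad n lam = lam @ replicate (n - length lam) 0"

definition T_perm :: "nat \<Rightarrow> (nat \<Rightarrow> nat) \<Rightarrow> qt_mpoly \<Rightarrow> qt_mpoly" where
  "T_perm N w = foldr T_op (SOME is. is_reduced_word N is w)"

definition p_factorial :: "qt_field \<Rightarrow> nat \<Rightarrow> qt_field" where
  "p_factorial p k = (\<Prod>j=1..k. (1 - p ^ j) / (1 - p))"

text \<open>The product runs over the \<open>i\<close> that occur in the padded partition; the remaining factors
  are \<open>[0]! = 1\<close>.\<close>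

definition u_norm :: "nat \<Rightarrow> m_partition \<Rightarrow> qt_field" where
  "u_norm N \<Lambda> = (case \<Lambda> of (a, lam) \<Rightarrow> let n = N - length a in
     (\<Prod>i\<in>set (pad n lam). p_factorial (inverse tt) (count_list (pad n lam) i)) *
     tt ^ (n * (n - 1) div 2))"

definition m_macdonald :: "nat \<Rightarrow> m_partition \<Rightarrow> qt_mpoly" where
  "m_macdonald N \<Lambda> = (case \<Lambda> of (a, lam) \<Rightarrow>
     Const (1 / u_norm N \<Lambda>) *
     (\<Sum>\<sigma> | \<sigma> permutes {length a + 1..N}.
        T_perm N \<sigma> (nonsym_macdonald (a @ rev (pad (N - length a) lam)))))"


section \<open>Evaluations\<close>

definition gamma :: "nat \<Rightarrow> m_partition \<Rightarrow> nat list" where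
  "gamma N \<Lambda> = (case \<Lambda> of (a, lam) \<Rightarrow> a @ pad (N - length a) lam)"

text \<open>The minimal length \<open>w\<close> such that \<open>w \<gamma>\<close> is weakly decreasing.\<close>

definition sort_perm :: "nat list \<Rightarrow> nat \<Rightarrow> nat" where
  "sort_perm \<eta> = (ARG_MIN (perm_length (length \<eta>)) w. w permutes {1..length \<eta>} \<and>
     (\<forall>i\<in>{1..length \<eta>}. part \<eta> i = part (decreasing \<eta>) (w i)))"

definition u_eval :: "nat \<Rightarrow> m_partition \<Rightarrow> qt_mpoly \<Rightarrow> qt_field" where
  "u_eval N \<Lambda> f = (let \<gamma> = gamma N \<Lambda>; w = sort_perm \<gamma> in
     evaluate (\<lambda>i. qq powi (- int (part (decreasing \<gamma>) (w i))) * tt powi (int (w i) - 1)) f)"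

definition u_empty :: "qt_mpoly \<Rightarrow> qt_field" where
  "u_empty f = evaluate (\<lambda>i. tt powi (int i - 1)) f"

definition normalized_m_macdonald :: "nat \<Rightarrow> m_partition \<Rightarrow> qt_mpoly" where
  "normalized_m_macdonald N \<Lambda> =
     Const (1 / u_empty (m_macdonald N \<Lambda>)) * m_macdonald N \<Lambda>"

end

theory Submission
  imports Defs
begin

text \<open>The non-symmetric polynomials are built recursively from \<open>1\<close> by the intertwiners
  \<open>\<Phi> = x\<^sub>N \<omega>\<close> and \<open>T\<^sub>i + c\<close>. Along this recursion they stay triangular for an order on
  compositions generated by elementary moves, which unlike dominance combined with the Bruhat
  order is preserved by \<open>\<Phi>\<close>, and their values at \<open>(1, t, \<dots>, t\<^bsup>N-1\<^esup>)\<close> stay nonzero.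

  Write \<open>F\<^sub>\<eta>\<close> for the polynomial normalized at this point and \<open>\<eta>\<^sup>*\<close> for the inverse of the
  spectral vector of \<open>\<eta>\<close>. The operator \<open>T\<^sub>i\<close> acts on the basis \<open>F\<^sub>\<eta>\<close> by the same formula by
  which it acts on the values \<open>f(\<gamma>\<^sup>*)\<close>, and \<open>F\<^bsub>\<Phi>\<eta>\<^esub>\<close> as well as evaluation at \<open>(\<Phi>\<eta>)\<^sup>*\<close> can
  be expressed by words in the \<open>T\<^sub>i\<^sup>-\<^sup>1\<close> that are reverse to each other. Hence the identity
  \<open>F\<^sub>\<eta>(\<gamma>\<^sup>*) = F\<^sub>\<gamma>(\<eta>\<^sup>*)\<close> propagates along the recursion.

  A normalized \<open>m\<close>-symmetric polynomial is a combination of the \<open>F\<^sub>\<eta>\<close> with \<open>\<eta>\<close> in one orbit of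
  the permutations of the last \<open>N - m\<close> positions, with coefficients of sum 1, and its values at
  \<open>\<gamma>\<^sup>*\<close> are constant on such orbits. Summing the identity over both orbits gives the claim.\<close>

text \<open>The joint spectrum of the \<open>Y_op\<close> is simple: \<open>qq\<close> and
  \<open>tt\<close> are independent, so a composition is determined by its spectral vector. Hence a
  joint eigenvector in \<open>N\<close> variables is a multiple of a known polynomial, and the value
  at \<open>(1, t, ..., t^(N-1))\<close> identifies the multiple. This value is accessible because
  at that point each \<open>T_op i\<close> acts as the scalar \<open>tt\<close>. Simplicity also
  settles equal adjacent parts, where no intertwiner is available: an eigenvector with the two
  spectral values exchanged cannot exist.

  The reversed words of the shift step are two eigenvalue equations. Up to factors, the one of
  \<open>Y_op N 1\<close> writes \<omega> F_\<eta> as \<open>T_{N-1}^{-1} ... T_1^{-1}\<close>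
  applied to F_\<eta>, and the one of \<open>Y_op N N\<close> writes F_\<gamma> as \<omega>
  \<open>T_1^{-1} ... T_{N-1}^{-1}\<close> applied to F_\<gamma>, where \<omega> moves the
  evaluation point of \<Phi>\<eta> to that of \<eta>.

  Two links to the given definitions remain: the elementary moves must imply the prescribed order,
  and \<open>T_perm\<close> must not depend on the reduced word it chooses.\<close>

section \<open>Polynomials over the coefficient field\<close>

lemma mpoly_single_induct:
  fixes f :: "'a \<Rightarrow>\<^sub>0 'b::comm_monoid_add"
  assumes "P 0" and "\<And>f e c. P f \<Longrightarrow> P (f + Poly_Mapping.single e c)"
  shows "P f"
proof (induction f rule: update_induct)
  case const
  then show ?case by (rule assms(1))
next
  case (update f a b)
  have "Poly_Mapping.update a b f = f + Poly_Mapping.single a b"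
    using update(1) by (intro poly_mapping_eqI)
      (auto simp: lookup_update lookup_add lookup_single in_keys_iff when_def)
  then show ?case using assms(2) update by simp
qed

definition power_product :: "(nat \<Rightarrow> 'a::comm_monoid_mult) \<Rightarrow> (nat \<Rightarrow>\<^sub>0 nat) \<Rightarrow> 'a" where
  "power_product x e = (\<Prod>i\<in>Poly_Mapping.keys e. x i ^ Poly_Mapping.lookup e i)"

lemma power_product_superset:
  assumes "finite A" "Poly_Mapping.keys e \<subseteq> A"
  shows "power_product x e = (\<Prod>i\<in>A. x i ^ Poly_Mapping.lookup e i)"
  unfolding power_product_def
  by (rule prod.mono_neutral_left) (use assms in \<open>auto simp: in_keys_iff\<close>)

lemma power_product_add: "power_product x (d + e) = power_product x d * power_product x e"
proof -
  let ?A = "Poly_Mapping.keys d \<union> Poly_Mapping.keys e"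
  have "Poly_Mapping.keys (d + e) \<subseteq> ?A" by (rule keys_add)
  then show ?thesis
    by (simp add: power_product_superset[of ?A] lookup_add power_add prod.distrib)
qed

lemma power_product_zero [simp]: "power_product x 0 = 1"
  by (simp add: power_product_def)

lemma power_product_single [simp]: "power_product x (Poly_Mapping.single i n) = x i ^ n"
  by (cases "n = 0") (auto simp: power_product_def)

text \<open>\<open>evaluate\<close> and \<open>substitute\<close> both extend a ring homomorphism of
  the coefficients, the identity and \<open>Const\<close> respectively, so their homomorphism laws
  are proved once.\<close>

locale coefficient_hom =
  fixes \<phi> :: "qt_field \<Rightarrow> 'a::comm_ring_1"
  assumes phi_add: "\<phi> (a + b) = \<phi> a + \<phi> b" and phi_mult: "\<phi> (a * b) = \<phi> a * \<phi> b"
    and phi_one: "\<phi> 1 = 1"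
begin

definition hom :: "(nat \<Rightarrow> 'a) \<Rightarrow> qt_mpoly \<Rightarrow> 'a" where
  "hom x f = (\<Sum>e\<in>Poly_Mapping.keys f. \<phi> (Poly_Mapping.lookup f e) * power_product x e)"

lemma phi_zero: "\<phi> 0 = 0"
  using phi_add[of 0 0] by simp

lemma hom_zero: "hom x 0 = 0" by (simp add: hom_def)

lemma hom_add: "hom x (f + g) = hom x f + hom x g"
  unfolding hom_def
  by (rule setsum_keys_plus_distrib) (auto simp: phi_zero phi_add algebra_simps)

lemma hom_single: "hom x (Poly_Mapping.single e c) = \<phi> c * power_product x e"
  by (cases "c = 0") (auto simp: hom_def phi_zero)

lemma hom_mult: "hom x (f * g) = hom x f * hom x g"
proof (induction f rule: mpoly_single_induct)
  case 1
  then show ?case by (simp add: hom_zero)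
next
  case (2 f e c)
  have "hom x (Poly_Mapping.single e c * g) = hom x (Poly_Mapping.single e c) * hom x g"
    by (induction g rule: mpoly_single_induct)
      (auto simp: hom_zero hom_add distrib_left mult_single hom_single phi_mult power_product_add
        mult_ac)
  then show ?case using 2 by (simp add: hom_add distrib_right)
qed

end

lemma Const_add: "Const (a + b) = Const a + Const b" by (simp add: Const_def single_add)
lemma Const_mult: "Const (a * b) = Const a * Const b" by (simp add: Const_def mult_single)
lemma Const_zero [simp]: "Const 0 = 0" by (simp add: Const_def)
lemma Const_one [simp]: "Const 1 = 1" by (simp add: Const_def)
lemma Const_minus: "Const (- a) = - Const a" by (simp add: Const_def single_uminus)
lemma Const_diff: "Const (a - b) = Const a - Const b" by (simp add: Const_def single_diff)
lemma Const_eq_iff: "Const a = Const b \<longleftrightarrow> a = b"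
  by (metis Const_def lookup_single_eq)

interpretation evaluation: coefficient_hom "\<lambda>c. c" by unfold_locales auto
interpretation substitution: coefficient_hom Const
  by unfold_locales (auto simp: Const_add Const_mult)

lemma evaluate_hom: "evaluate x = evaluation.hom x"
  by (rule ext) (simp add: evaluate_def evaluation.hom_def power_product_def)
lemma substitute_hom: "substitute x = substitution.hom x"
  by (rule ext) (simp add: substitute_def substitution.hom_def power_product_def)

lemma evaluate_zero [simp]: "evaluate x 0 = 0"
  and evaluate_add: "evaluate x (f + g) = evaluate x f + evaluate x g"
  and evaluate_mult: "evaluate x (f * g) = evaluate x f * evaluate x g"
  and evaluate_Const [simp]: "evaluate x (Const c) = c"
  and evaluate_Var [simp]: "evaluate x (Var i) = x i"
  by (simp_all add: evaluate_hom evaluation.hom_zero evaluation.hom_add evaluation.hom_mult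
      Const_def Var_def evaluation.hom_single)

lemma substitute_zero [simp]: "substitute x 0 = 0"
  and substitute_add: "substitute x (f + g) = substitute x f + substitute x g"
  and substitute_mult: "substitute x (f * g) = substitute x f * substitute x g"
  and substitute_Const [simp]: "substitute x (Const c) = Const c"
  and substitute_Var [simp]: "substitute x (Var i) = x i"
  by (simp_all add: substitute_hom substitution.hom_zero substitution.hom_add
      substitution.hom_mult Const_def Var_def substitution.hom_single)

lemma evaluate_one [simp]: "evaluate x 1 = 1" using evaluate_Const[of x 1] by simp
lemma substitute_one [simp]: "substitute x 1 = 1" using substitute_Const[of x 1] by simp

lemma evaluate_minus: "evaluate x (- f) = - evaluate x f"
  using evaluate_add[of x f "- f"] by (simp add: eq_neg_iff_add_eq_0 add.commute)
lemma evaluate_diff: "evaluate x (f - g) = evaluate x f - evaluate x g"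
  using evaluate_add[of x f "- g"] by (simp add: evaluate_minus)
lemma substitute_minus: "substitute x (- f) = - substitute x f"
  using substitute_add[of x f "- f"] by (simp add: eq_neg_iff_add_eq_0 add.commute)
lemma substitute_diff: "substitute x (f - g) = substitute x f - substitute x g"
  using substitute_add[of x f "- g"] by (simp add: substitute_minus)
lemma evaluate_sum: "evaluate x (sum f A) = (\<Sum>a\<in>A. evaluate x (f a))"
  by (induction A rule: infinite_finite_induct) (auto simp: evaluate_add)
lemma evaluate_power: "evaluate x (f ^ n) = evaluate x f ^ n"
  by (induction n) (auto simp: evaluate_mult)
lemma substitute_power: "substitute x (f ^ n) = substitute x f ^ n"
  by (induction n) (auto simp: substitute_mult)
lemma substitute_prod: "substitute x (prod f A) = (\<Prod>a\<in>A. substitute x (f a))"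
  by (induction A rule: infinite_finite_induct) (auto simp: substitute_mult)
lemma evaluate_prod: "evaluate x (prod f A) = (\<Prod>a\<in>A. evaluate x (f a))"
  by (induction A rule: infinite_finite_induct) (auto simp: evaluate_mult)

lemma single_eq_power_product: "Poly_Mapping.single e c = Const c * power_product Var e"
proof -
  have "Poly_Mapping.single e 1 = power_product Var e"
  proof (induction e rule: mpoly_single_induct)
    case (2 f i n)
    have "Poly_Mapping.single (Poly_Mapping.single i n) 1 = Var i ^ n"
    proof (induction n)
      case (Suc n)
      have "Poly_Mapping.single i (Suc n) = Poly_Mapping.single i 1 + Poly_Mapping.single i n"
        by (simp flip: single_add)
      then have "Poly_Mapping.single (Poly_Mapping.single i (Suc n)) 1 =
          Var i * Poly_Mapping.single (Poly_Mapping.single i n) 1"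
        by (simp add: Var_def mult_single)
      then show ?case using Suc by simp
    qed auto
    moreover have "Poly_Mapping.single (f + Poly_Mapping.single i n) 1 =
        Poly_Mapping.single f 1 * Poly_Mapping.single (Poly_Mapping.single i n) (1::qt_field)"
      by (simp add: mult_single)
    ultimately show ?case using 2 by (simp add: power_product_add)
  qed auto
  moreover have "Poly_Mapping.single e c = Const c * Poly_Mapping.single e 1"
    by (simp add: Const_def mult_single)
  ultimately show ?thesis by simp
qed

lemma mpoly_induct [case_names Const Var add mult]:
  assumes "\<And>c. P (Const c)" "\<And>i. P (Var i)"
    and "\<And>f g. P f \<Longrightarrow> P g \<Longrightarrow> P (f + g)" "\<And>f g. P f \<Longrightarrow> P g \<Longrightarrow> P (f * g)"
  shows "P (f :: qt_mpoly)"
proof (induction f rule: mpoly_single_induct)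
  case 1
  show ?case using assms(1)[of 0] by simp
next
  case (2 f e c)
  have one: "P 1" using assms(1)[of 1] by simp
  have pow: "P (Var i ^ n)" for i n
    by (induction n) (auto intro: assms one)
  have "P (power_product Var e)"
    unfolding power_product_def
  proof (rule finite_induct[OF finite_keys[of e]])
    show "P (\<Prod>i\<in>{}. Var i ^ Poly_Mapping.lookup e i)" using one by simp
  qed (auto intro: assms pow)
  then show ?case by (auto simp: single_eq_power_product intro: assms 2)
qed

lemma substitute_substitute:
  "substitute x (substitute y f) = substitute (\<lambda>i. substitute x (y i)) f"
  by (induction f rule: mpoly_induct) (auto simp: substitute_add substitute_mult)

lemma evaluate_substitute:
  "evaluate x (substitute y f) = evaluate (\<lambda>i. evaluate x (y i)) f"
  by (induction f rule: mpoly_induct)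
    (auto simp: substitute_add substitute_mult evaluate_add evaluate_mult)

lemma substitute_Var_id [simp]: "substitute Var f = f"
  by (induction f rule: mpoly_induct) (auto simp: substitute_add substitute_mult)

lemma Var_eq_iff [simp]: "Var i = Var j \<longleftrightarrow> i = j"
  by (metis (mono_tags, lifting) Var_def inj_single lookup_single_eq lookup_single_not_eq one_neq_zero)

section \<open>Linear operators on polynomials\<close>

definition linear_op :: "(qt_mpoly \<Rightarrow> qt_mpoly) \<Rightarrow> bool" where
  "linear_op F \<longleftrightarrow> (\<forall>f g. F (f + g) = F f + F g) \<and> (\<forall>c f. F (Const c * f) = Const c * F f)"

lemma linear_op_add: "linear_op F \<Longrightarrow> F (f + g) = F f + F g"
  and linear_op_scale: "linear_op F \<Longrightarrow> F (Const c * f) = Const c * F f"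
  by (auto simp: linear_op_def)

lemma linear_op_zero: "linear_op F \<Longrightarrow> F 0 = 0"
  using linear_op_scale[of F 0 0] by simp
lemma linear_op_minus: "linear_op F \<Longrightarrow> F (- f) = - F f"
  using linear_op_scale[of F "-1" f] by (simp add: Const_minus)
lemma linear_op_diff: "linear_op F \<Longrightarrow> F (f - g) = F f - F g"
  using linear_op_add[of F f "- g"] by (simp add: linear_op_minus)
lemma linear_op_sum: "linear_op F \<Longrightarrow> F (sum f A) = (\<Sum>a\<in>A. F (f a))"
  by (induction A rule: infinite_finite_induct) (auto simp: linear_op_zero linear_op_add)
lemma linear_op_comp: "linear_op F \<Longrightarrow> linear_op G \<Longrightarrow> linear_op (\<lambda>f. F (G f))"
  by (auto simp: linear_op_def)
lemma linear_op_substitute: "linear_op (substitute x)"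
  by (auto simp: linear_op_def substitute_add substitute_mult)
lemma linear_op_foldr: "(\<And>i. i \<in> set is \<Longrightarrow> linear_op (F i)) \<Longrightarrow> linear_op (foldr F is)"
  by (induction "is") (auto simp: linear_op_def)

section \<open>Transpositions of variables, divided differences and Hecke operators\<close>

abbreviation K :: "nat \<Rightarrow> qt_mpoly \<Rightarrow> qt_mpoly" where "K i \<equiv> K_op i (Suc i)"

lemma K_simps [simp]:
  "K_op i j (Const c) = Const c" "K_op i j (Var k) = Var (transpose i j k)"
  "K_op i j 0 = 0" "K_op i j 1 = 1"
  by (simp_all add: K_op_def)

lemma K_add: "K_op i j (f + g) = K_op i j f + K_op i j g"
  and K_mult: "K_op i j (f * g) = K_op i j f * K_op i j g"
  and K_diff: "K_op i j (f - g) = K_op i j f - K_op i j g"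
  by (simp_all add: K_op_def substitute_add substitute_mult substitute_diff)

lemma K_K [simp]: "K_op i j (K_op i j f) = f"
  by (simp add: K_op_def substitute_substitute)

lemma Var_diff_nonzero: "i \<noteq> j \<Longrightarrow> Var i - Var j \<noteq> 0"
  by simp

text \<open>Divisibility passes to products by the Leibniz rule
  \<open>K (f * g) - f * g = (K f - f) * g + K f * (K g - g)\<close>.\<close>

lemma divided_difference_exists: "\<exists>g. (Var i - Var (Suc i)) * g = K i f - f"
proof (induction f rule: mpoly_induct)
  case (Const c)
  show ?case by (rule exI[of _ 0]) simp
next
  case (Var k)
  have "(Var i - Var (Suc i)) * (if k = i then - 1 else if k = Suc i then 1 else 0) =
      K i (Var k) - Var k"
    by (auto simp: transpose_def)
  then show ?case by blast
next
  case (add f g)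
  then obtain a b where "(Var i - Var (Suc i)) * a = K i f - f"
    "(Var i - Var (Suc i)) * b = K i g - g" by blast
  then have "(Var i - Var (Suc i)) * (a + b) = K i (f + g) - (f + g)"
    by (simp add: K_add distrib_left)
  then show ?case by blast
next
  case (mult f g)
  then obtain a b where "(Var i - Var (Suc i)) * a = K i f - f"
    "(Var i - Var (Suc i)) * b = K i g - g" by blast
  then have "(Var i - Var (Suc i)) * (a * g + K i f * b) = K i (f * g) - f * g"
    by (simp add: K_mult) algebra
  then show ?case by blast
qed

lemma divided_difference_eq: "(Var i - Var (Suc i)) * divided_difference i f = K i f - f"
proof -
  obtain g where g: "(Var i - Var (Suc i)) * g = K i f - f"
    using divided_difference_exists by blast
  show ?thesis unfolding divided_difference_def
  proof (rule theI[of _ g])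
    fix h assume "(Var i - Var (Suc i)) * h = K i f - f"
    then show "h = g" using g Var_diff_nonzero[of i "Suc i"] by (metis mult_cancel_left n_not_Suc_n)
  qed (rule g)
qed

lemma T_op_eq: "(Var i - Var (Suc i)) * T_op i f =
    (Const tt * Var i - Var (Suc i)) * K i f + (1 - Const tt) * Var (Suc i) * f"
  using divided_difference_eq[of i f] unfolding T_op_def by algebra

text \<open>Polynomials form an integral domain, so \<open>Var i - Var (Suc i)\<close> cancels. Most
  values of \<open>T_op\<close> below are found by guessing them and checking this equation.\<close>

lemma T_op_unique:
  assumes "(Var i - Var (Suc i)) * g =
    (Const tt * Var i - Var (Suc i)) * K i f + (1 - Const tt) * Var (Suc i) * f"
  shows "T_op i f = g"
  using assms T_op_eq[of i f] Var_diff_nonzero[of i "Suc i"]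
  by (metis mult_cancel_left n_not_Suc_n)

lemma linear_op_T: "linear_op (T_op i)"
proof -
  have "T_op i (f + g) = T_op i f + T_op i g" for f g
    by (rule T_op_unique) (simp only: distrib_left T_op_eq K_add, simp add: algebra_simps)
  moreover have "T_op i (Const c * f) = Const c * T_op i f" for c f
  proof (rule T_op_unique)
    have "(Var i - Var (Suc i)) * (Const c * T_op i f) = Const c * ((Var i - Var (Suc i)) * T_op i f)"
      by (simp add: mult_ac)
    also have "\<dots> = (Const tt * Var i - Var (Suc i)) * K i (Const c * f) +
        (1 - Const tt) * Var (Suc i) * (Const c * f)"
      unfolding T_op_eq by (simp add: K_mult algebra_simps)
    finally show "(Var i - Var (Suc i)) * (Const c * T_op i f) = \<dots>" .
  qed
  ultimately show ?thesis by (simp add: linear_op_def)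
qed

lemma tt_nonzero [simp]: "tt \<noteq> 0"
  by (simp add: tt_def Zero_fract_def eq_fract)

lemma qq_nonzero [simp]: "qq \<noteq> 0"
  by (simp add: qq_def Zero_fract_def eq_fract)

lemma T_op_quadratic: "T_op i (T_op i f) = (Const tt - 1) * T_op i f + Const tt * f"
proof (rule T_op_unique)
  let ?x = "Var i" and ?y = "Var (Suc i)" and ?t = "Const tt" and ?h = "T_op i f"
  have 1: "(?x - ?y) * ?h = (?t * ?x - ?y) * K i f + (1 - ?t) * ?y * f"
    by (rule T_op_eq)
  \<comment> \<open>Applying \<open>K i\<close> to the defining equation gives the second relation,
    by which \<open>K i ?h\<close> can be eliminated after one more multiplication by
    \<open>?x - ?y\<close>.\<close>
  have 2: "(?y - ?x) * K i ?h = (?t * ?y - ?x) * f + (1 - ?t) * ?x * K i f"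
    using arg_cong[OF 1, of "K i"] by (simp add: K_add K_mult K_diff)
  have "(?x - ?y) * ((?x - ?y) * ((?t - 1) * ?h + ?t * f)) =
    (?x - ?y) * ((?t * ?x - ?y) * K i ?h + (1 - ?t) * ?y * ?h)"
    using 1 2 by algebra
  then show "(?x - ?y) * ((?t - 1) * ?h + ?t * f) =
    (?t * ?x - ?y) * K i ?h + (1 - ?t) * ?y * ?h"
    using Var_diff_nonzero[of i "Suc i"] by (metis mult_cancel_left n_not_Suc_n)
qed

text \<open>The quadratic relation reads \<open>T (T + 1 - t) = t\<close>, which exhibits the
  inverse.\<close>

definition T_inv :: "nat \<Rightarrow> qt_mpoly \<Rightarrow> qt_mpoly" where
  "T_inv i f = Const (inverse tt) * (T_op i f + (1 - Const tt) * f)"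

lemma Const_inverse_tt [simp]: "Const (inverse tt) * Const tt = 1" "Const tt * Const (inverse tt) = 1"
  "Const (inverse tt) * (Const tt * f) = f" "Const tt * (Const (inverse tt) * f) = f"
  by (simp_all flip: Const_mult mult.assoc)

lemma Const_one_minus: "1 - Const c = Const (1 - c)" "Const c - 1 = Const (c - 1)"
  by (simp_all add: Const_diff)

lemma T_op_T_inv [simp]: "T_op i (T_inv i f) = f"
  unfolding T_inv_def Const_one_minus linear_op_scale[OF linear_op_T] linear_op_add[OF linear_op_T]
    T_op_quadratic by (simp add: Const_diff algebra_simps)

lemma T_inv_T_op [simp]: "T_inv i (T_op i f) = f"
  unfolding T_inv_def T_op_quadratic by (simp add: algebra_simps)

lemma inv_T_op: "inv (T_op i) = T_inv i"
  by (rule inv_equality) auto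

lemma linear_op_T_inv: "linear_op (T_inv i)"
  unfolding linear_op_def T_inv_def
  using linear_op_T[of i] by (auto simp: linear_op_def algebra_simps)

lemma T_inv_commute: "(\<And>f. T_op i (F f) = F (T_op j f)) \<Longrightarrow> T_inv i (F f) = F (T_inv j f)"
  by (metis T_inv_T_op T_op_T_inv)

section \<open>Braid relations and the cyclic shift\<close>

text \<open>The braid relation for operators of the form \<open>A * K + B\<close>, expanded in the
  six permuted copies of a polynomial \<open>f\<close>: \<open>a\<close> stands for
  \<open>f\<close>, \<open>b\<close> and \<open>c\<close> for its images under the two simple
  transpositions, \<open>d\<close> and \<open>e\<close> for those under their products,
  \<open>g\<close> for that under the longest element.\<close>

lemma braid_field:
  fixes x y z t a b c d e g :: "'a::field"
  defines "A \<equiv> \<lambda>u v. (t * u - v) / (u - v)" and "B \<equiv> \<lambda>u v. (1 - t) * v / (u - v)"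
  assumes "x \<noteq> y" "y \<noteq> z" "x \<noteq> z"
  shows "A x y * (A x z * (A y z * g + B y z * d) + B x z * (A y x * a + B y x * b)) +
      B x y * (A y z * (A x z * e + B x z * c) + B y z * (A x y * b + B x y * a)) =
    A y z * (A x z * (A x y * g + B x y * e) + B x z * (A z y * a + B z y * c)) +
      B y z * (A x y * (A x z * d + B x z * b) + B x y * (A y z * c + B y z * a))"
proof -
  \<comment> \<open>In these coordinates every denominator is \<open>u\<close>, \<open>v\<close> or
    \<open>u + v\<close> up to sign.\<close>
  define u v where "u = x - y" and "v = y - z"
  have xy: "x = z + u + v" "y = z + v" by (simp_all add: u_def v_def)
  have nz: "u \<noteq> 0" "v \<noteq> 0" "u + v \<noteq> 0" "- u - v \<noteq> 0" using assms(3-) by (auto simp: u_def v_def)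
  \<comment> \<open>The coefficients of \<open>d\<close>, \<open>e\<close> and \<open>g\<close>
    agree at once. Left to check are those of \<open>b\<close> and \<open>c\<close>, from which
    \<open>A x y\<close> and \<open>A y z\<close> cancel, and that of \<open>a\<close>.\<close>
  have b: "B x z * B y x + B y z * B x y = B y z * B x z"
    unfolding B_def xy using nz by (simp add: divide_simps) (simp add: algebra_simps)
  have c: "B x y * B x z = B x z * B z y + B y z * B x y"
    unfolding B_def xy using nz by (simp add: divide_simps) (simp add: algebra_simps)
  have a: "A x y * B x z * A y x + B x y * B y z * B x y = A y z * B x z * A z y + B y z * B x y * B y z"
    unfolding A_def B_def xy using nz by (simp add: divide_simps) (simp add: algebra_simps)
  show ?thesis
    using a b c by algebra
qed

lemma eq_sum_of_fractions:
  fixes d :: "'a::field"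
  assumes "d \<noteq> 0" "d * l = p * a + q * b"
  shows "l = p / d * a + q / d * b"
  using assms by (simp add: nonzero_eq_divide_eq[of d] add_divide_distrib[symmetric] mult.commute)

text \<open>In the fraction field of the polynomial ring \<open>T_op i\<close> is literally a
  combination of \<open>K i\<close> and the identity, so iterated applications expand by
  rewriting.\<close>

definition to_fract :: "qt_mpoly \<Rightarrow> qt_mpoly fract" where "to_fract f = Fract f 1"

lemma to_fract_simps:
  "to_fract (f + g) = to_fract f + to_fract g" "to_fract (f * g) = to_fract f * to_fract g"
  "to_fract (f - g) = to_fract f - to_fract g" "to_fract 1 = 1"
  by (simp_all add: to_fract_def One_fract_def)

lemma to_fract_eq_iff [simp]: "to_fract f = to_fract g \<longleftrightarrow> f = g"
  by (simp add: to_fract_def eq_fract)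

lemma to_fract_T_op:
  fixes i defines "x \<equiv> to_fract (Var i)" and "y \<equiv> to_fract (Var (Suc i))" and "t \<equiv> to_fract (Const tt)"
  shows "to_fract (T_op i f) =
    (t * x - y) / (x - y) * to_fract (K i f) + (1 - t) * y / (x - y) * to_fract f"
proof -
  have "x - y \<noteq> 0" by (simp add: x_def y_def)
  moreover have "(x - y) * to_fract (T_op i f) = (t * x - y) * to_fract (K i f) + (1 - t) * y * to_fract f"
    using arg_cong[OF T_op_eq[of i f], of to_fract]
    by (simp add: to_fract_simps x_def y_def t_def)
  ultimately show ?thesis by (rule eq_sum_of_fractions)
qed

lemma K_T_op:
  "(K_op k l (Var i) - K_op k l (Var (Suc i))) * K_op k l (T_op i f) =
    (Const tt * K_op k l (Var i) - K_op k l (Var (Suc i))) * K_op k l (K i f) +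
    (1 - Const tt) * K_op k l (Var (Suc i)) * K_op k l f"
  using arg_cong[OF T_op_eq[of i f], of "K_op k l"] by (simp add: K_add K_mult K_diff)

lemma to_fract_K_T_op:
  fixes i k l
  defines "x \<equiv> to_fract (Var (transpose k l i))" and "y \<equiv> to_fract (Var (transpose k l (Suc i)))"
    and "t \<equiv> to_fract (Const tt)"
  shows "to_fract (K_op k l (T_op i f)) =
    (t * x - y) / (x - y) * to_fract (K_op k l (K i f)) + (1 - t) * y / (x - y) * to_fract (K_op k l f)"
proof -
  have "x - y \<noteq> 0"
    by (simp add: x_def y_def) (metis n_not_Suc_n transpose_eq_imp_eq)
  moreover have "(x - y) * to_fract (K_op k l (T_op i f)) =
      (t * x - y) * to_fract (K_op k l (K i f)) + (1 - t) * y * to_fract (K_op k l f)"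
    using arg_cong[OF K_T_op[of k l i f], of to_fract]
    by (simp add: to_fract_simps x_def y_def t_def)
  ultimately show ?thesis by (rule eq_sum_of_fractions)
qed

lemma K_braid: "K i (K (Suc i) (K i f)) = K (Suc i) (K i (K (Suc i) f))"
  unfolding K_op_def substitute_substitute
  by (rule arg_cong2[of _ _ f f substitute]) (auto simp: transpose_def fun_eq_iff)

lemma T_op_mult:
  assumes "K i g = g"
  shows "T_op i (g * f) = g * T_op i f"
proof (rule T_op_unique)
  have "(Var i - Var (Suc i)) * (g * T_op i f) = g * ((Var i - Var (Suc i)) * T_op i f)"
    by (simp add: mult_ac)
  then show "(Var i - Var (Suc i)) * (g * T_op i f) =
    (Const tt * Var i - Var (Suc i)) * K i (g * f) + (1 - Const tt) * Var (Suc i) * (g * f)"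
    unfolding T_op_eq by (simp add: K_mult assms algebra_simps)
qed

lemma T_op_Var_mult: "k \<noteq> i \<Longrightarrow> k \<noteq> Suc i \<Longrightarrow> T_op i (Var k * f) = Var k * T_op i f"
  by (rule T_op_mult) simp

text \<open>The equation defining \<open>T_op\<close> is homogeneous in its two variables, so a
  common factor \<open>c\<close> cancels. It is 1 for distant transpositions and for the cyclic
  shift, and \<open>qq\<close> for the square of the shift, where the pair wraps around.\<close>

lemma T_op_substitute:
  assumes "g i = Const c * Var j" "g (Suc i) = Const c * Var (Suc j)" "c \<noteq> 0"
    and "\<And>k. K j (g k) = g (transpose i (Suc i) k)"
  shows "T_op j (substitute g f) = substitute g (T_op i f)"
proof (rule T_op_unique)
  have K: "K j (substitute g f) = substitute g (K i f)"
    by (simp add: K_op_def substitute_substitute assms(4)[unfolded K_op_def])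
  have "Const c * ((Var j - Var (Suc j)) * substitute g (T_op i f)) =
    Const c * ((Const tt * Var j - Var (Suc j)) * K j (substitute g f) +
      (1 - Const tt) * Var (Suc j) * substitute g f)"
    using arg_cong[OF T_op_eq[of i f], of "substitute g"]
    by (simp add: substitute_mult substitute_diff substitute_add assms(1,2) K algebra_simps)
  moreover have "Const c \<noteq> 0" using assms(3) Const_eq_iff[of c 0] by simp
  ultimately show "(Var j - Var (Suc j)) * substitute g (T_op i f) =
    (Const tt * Var j - Var (Suc j)) * K j (substitute g f) +
      (1 - Const tt) * Var (Suc j) * substitute g f"
    by simp
qed

lemma T_op_K: "i + 2 \<le> j \<or> j + 2 \<le> i \<Longrightarrow> T_op i (K j f) = K j (T_op i f)"
  unfolding K_op_def by (rule T_op_substitute[where c = 1]) (auto simp: transpose_def)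

lemma T_op_comm:
  assumes "i + 2 \<le> j \<or> j + 2 \<le> i"
  shows "T_op i (T_op j f) = T_op j (T_op i f)"
proof (rule sym, rule T_op_unique)
  have j: "transpose i (Suc i) j = j" "transpose i (Suc i) (Suc j) = Suc j"
    using assms by (auto simp: transpose_def)
  have "(Var j - Var (Suc j)) * T_op i (T_op j f) = T_op i ((Var j - Var (Suc j)) * T_op j f)"
    by (subst T_op_mult) (simp_all add: K_diff j)
  also have "\<dots> = T_op i ((Const tt * Var j - Var (Suc j)) * K j f) + T_op i ((1 - Const tt) * Var (Suc j) * f)"
    by (simp add: T_op_eq linear_op_add[OF linear_op_T])
  also have "T_op i ((Const tt * Var j - Var (Suc j)) * K j f) = (Const tt * Var j - Var (Suc j)) * T_op i (K j f)"
    by (rule T_op_mult) (simp add: K_diff K_mult j)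
  also have "T_op i ((1 - Const tt) * Var (Suc j) * f) = (1 - Const tt) * Var (Suc j) * T_op i f"
    by (rule T_op_mult) (simp add: K_diff K_mult j)
  finally show "(Var j - Var (Suc j)) * T_op i (T_op j f) =
    (Const tt * Var j - Var (Suc j)) * K j (T_op i f) + (1 - Const tt) * Var (Suc j) * T_op i f"
    using assms by (simp add: T_op_K)
qed

lemma T_op_braid: "T_op i (T_op (Suc i) (T_op i f)) = T_op (Suc i) (T_op i (T_op (Suc i) f))"
proof -
  let ?j = "Suc i"
  have tr: "transpose i ?j (Suc ?j) = Suc ?j" "transpose ?j (Suc ?j) i = i"
    by (auto simp: transpose_def)
  note Kij = to_fract_K_T_op[of i ?j ?j, unfolded tr transpose_apply_second]
    and Kii = to_fract_K_T_op[of i ?j i, unfolded transpose_apply_first transpose_apply_second]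
    and Kji = to_fract_K_T_op[of ?j "Suc ?j" i, unfolded tr transpose_apply_first]
    and Kjj = to_fract_K_T_op[of ?j "Suc ?j" ?j, unfolded transpose_apply_first transpose_apply_second]
  \<comment> \<open>\<open>to_fract_K_T_op\<close> covers one transposition; here and in
    \<open>K_KT'\<close> the equation is carried through two.\<close>
  have K_KT: "to_fract (K i (K ?j (T_op i f))) =
     (to_fract (Const tt) * to_fract (Var ?j) - to_fract (Var (Suc ?j))) / (to_fract (Var ?j) - to_fract (Var (Suc ?j))) *
       to_fract (K i (K ?j (K i f))) +
     (1 - to_fract (Const tt)) * to_fract (Var (Suc ?j)) / (to_fract (Var ?j) - to_fract (Var (Suc ?j))) *
       to_fract (K i (K ?j f))"
    (is "?l = _ / ?D * _ + _")
  proof -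
    have "?D \<noteq> 0" by simp
    moreover have "?D * ?l = (to_fract (Const tt) * to_fract (Var ?j) - to_fract (Var (Suc ?j))) *
       to_fract (K i (K ?j (K i f))) +
     (1 - to_fract (Const tt)) * to_fract (Var (Suc ?j)) * to_fract (K i (K ?j f))"
      using arg_cong[OF arg_cong[OF K_T_op[of ?j "Suc ?j" i f], of "K i"], of to_fract]
      by (simp add: to_fract_simps K_add K_mult K_diff transpose_def)
    ultimately show ?thesis by (rule eq_sum_of_fractions)
  qed
  have K_KT': "to_fract (K ?j (K i (T_op ?j f))) =
     (to_fract (Const tt) * to_fract (Var i) - to_fract (Var ?j)) / (to_fract (Var i) - to_fract (Var ?j)) *
       to_fract (K ?j (K i (K ?j f))) +
     (1 - to_fract (Const tt)) * to_fract (Var ?j) / (to_fract (Var i) - to_fract (Var ?j)) *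
       to_fract (K ?j (K i f))"
    (is "?l = _ / ?D * _ + _")
  proof -
    have "?D \<noteq> 0" by simp
    moreover have "?D * ?l = (to_fract (Const tt) * to_fract (Var i) - to_fract (Var ?j)) *
       to_fract (K ?j (K i (K ?j f))) +
     (1 - to_fract (Const tt)) * to_fract (Var ?j) * to_fract (K ?j (K i f))"
      using arg_cong[OF arg_cong[OF K_T_op[of i "Suc i" ?j f], of "K ?j"], of to_fract]
      by (simp add: to_fract_simps K_add K_mult K_diff transpose_def)
    ultimately show ?thesis by (rule eq_sum_of_fractions)
  qed
  have "to_fract (T_op i (T_op ?j (T_op i f))) = to_fract (T_op ?j (T_op i (T_op ?j f)))"
    unfolding to_fract_T_op[of i "T_op ?j (T_op i f)"] to_fract_T_op[of ?j "T_op i f"]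
      to_fract_T_op[of i f] to_fract_T_op[of ?j "T_op i (T_op ?j f)"]
      to_fract_T_op[of i "T_op ?j f"] to_fract_T_op[of ?j f] Kij Kii Kji Kjj K_KT K_KT' K_K
      K_braid[symmetric]
    by (rule braid_field) auto
  then show ?thesis by simp
qed

text \<open>This is the affine Hecke relation \<open>T_i x_i T_i = t x_{i+1}\<close>, the source of
  all commutations of variables with Hecke operators below.\<close>

lemma T_op_Var_self: "T_op i (Var i * f) = Const tt * (Var (Suc i) * T_inv i f)"
proof (rule T_op_unique)
  have "(Var i - Var (Suc i)) * (Const tt * (Var (Suc i) * T_inv i f)) =
    Var (Suc i) * ((Var i - Var (Suc i)) * T_op i f + (Var i - Var (Suc i)) * (1 - Const tt) * f)"
    by (simp add: T_inv_def algebra_simps)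
  also have "\<dots> = (Const tt * Var i - Var (Suc i)) * K i (Var i * f) + (1 - Const tt) * Var (Suc i) * (Var i * f)"
    unfolding T_op_eq by (simp add: K_mult algebra_simps)
  finally show "(Var i - Var (Suc i)) * (Const tt * (Var (Suc i) * T_inv i f)) = \<dots>" .
qed

lemma T_inv_Var_Suc: "T_inv i (Var (Suc i) * f) = Const (inverse tt) * (Var i * T_op i f)"
proof -
  have "T_op i (Const (inverse tt) * (Var i * T_op i f)) = Var (Suc i) * f"
    by (simp add: linear_op_scale[OF linear_op_T] T_op_Var_self)
  then show ?thesis by (metis T_inv_T_op)
qed

lemma T_inv_Var_mult: "k \<noteq> i \<Longrightarrow> k \<noteq> Suc i \<Longrightarrow> T_inv i (Var k * f) = Var k * T_inv i f"
  by (rule T_inv_commute[of i "(*) (Var k)" i]) (simp add: T_op_Var_mult)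

lemma T_op_T_inv_comm: "i + 2 \<le> j \<or> j + 2 \<le> i \<Longrightarrow> T_op i (T_inv j f) = T_inv j (T_op i f)"
  by (metis T_inv_commute T_op_comm)

lemma T_op_T_inv_braid:
  "T_op (Suc i) (T_inv i (T_inv (Suc i) f)) = T_inv i (T_inv (Suc i) (T_op i f))"
  by (metis T_inv_T_op T_op_T_inv T_op_braid)

section \<open>The cyclic shift\<close>

definition cyclic_var :: "nat \<Rightarrow> nat \<Rightarrow> qt_mpoly" where
  "cyclic_var N k = (if k = 1 then Const qq * Var N else if 2 \<le> k \<and> k \<le> N then Var (k - 1) else Var k)"

text \<open>Each further swap moves the image of \<open>Var 1\<close> one place to the right. As a
  single substitution the shift falls under \<open>T_op_substitute\<close>.\<close>

lemma omega_op_eq: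
  assumes "N \<ge> 1"
  shows "omega_op N f = substitute (cyclic_var N) f"
  using assms
proof (induction N rule: dec_induct)
  case base
  have "Var(1 := Const qq * Var 1) = cyclic_var 1" by (rule ext) (auto simp: cyclic_var_def)
  then show ?case by (simp add: omega_op_def tau_op_def)
next
  case (step n)
  have "omega_op (Suc n) f = K n (omega_op n f)"
    using step(1) by (simp add: omega_op_def)
  also have "\<dots> = substitute (cyclic_var (Suc n)) f"
    unfolding step(3) K_op_def substitute_substitute
    by (intro arg_cong2[of _ _ _ _ substitute] refl ext)
      (use step(1) in \<open>auto simp: cyclic_var_def substitute_mult transpose_def\<close>)
  finally show ?case .
qed

lemma linear_op_omega: "N \<ge> 1 \<Longrightarrow> linear_op (omega_op N)"
  using linear_op_substitute[of "cyclic_var N"] by (simp add: linear_op_def omega_op_eq)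

lemma T_op_omega:
  assumes "1 \<le> i" "i + 2 \<le> N"
  shows "T_op i (omega_op N f) = omega_op N (T_op (Suc i) f)"
  using assms unfolding omega_op_eq[OF order.trans[OF assms(1) add_leD1[OF assms(2)]]]
  by (intro T_op_substitute[where c = 1]) (auto simp: cyclic_var_def transpose_def K_mult)

lemma omega_omega:
  assumes "N \<ge> 2"
  shows "omega_op N (omega_op N f) = substitute (\<lambda>k. if k = 1 then Const qq * Var (N - 1)
    else if k = 2 then Const qq * Var N else if 3 \<le> k \<and> k \<le> N then Var (k - 2) else Var k) f"
proof -
  have "N \<ge> 1" using assms by simp
  show ?thesis unfolding omega_op_eq[OF \<open>N \<ge> 1\<close>] substitute_substitute
    by (intro arg_cong2[of _ _ _ _ substitute] refl ext)
      (use assms in \<open>auto simp: cyclic_var_def substitute_mult numeral_2_eq_2\<close>)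
qed

text \<open>A single shift tears the variables 1 and 2 apart; after two shifts they are adjacent
  again, at \<open>N - 1\<close> and \<open>N\<close>, with the common factor
  \<open>qq\<close>.\<close>

lemma T_op_omega_omega:
  assumes "N \<ge> 2"
  shows "T_op (N - 1) (omega_op N (omega_op N f)) = omega_op N (omega_op N (T_op 1 f))"
  using assms unfolding omega_omega[OF assms]
  by (intro T_op_substitute[where c = qq]) (auto simp: transpose_def K_mult numeral_2_eq_2)

section \<open>Cherednik operators\<close>

abbreviation T_up :: "nat \<Rightarrow> nat \<Rightarrow> qt_mpoly \<Rightarrow> qt_mpoly" where
  "T_up a b \<equiv> foldr T_op [a..<b]"
abbreviation T_down :: "nat \<Rightarrow> qt_mpoly \<Rightarrow> qt_mpoly" where
  "T_down b \<equiv> foldr T_inv [1..<b]"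

lemma linear_op_T_up: "linear_op (T_up a b)" and linear_op_T_down: "linear_op (T_down b)"
  by (auto intro: linear_op_foldr linear_op_T linear_op_T_inv)

lemma Y_op_eq: "Y_op N i f = Const (tt powi (int i - int N)) * T_up i N (omega_op N (T_down i f))"
  unfolding Y_op_def by (simp add: inv_T_op)

lemma linear_op_Y:
  assumes "N \<ge> 1"
  shows "linear_op (Y_op N i)"
proof -
  have "linear_op (\<lambda>f. T_up i N (omega_op N (T_down i f)))"
    by (rule linear_op_comp[OF linear_op_T_up linear_op_comp[OF linear_op_omega[OF assms] linear_op_T_down]])
  from linear_op_add[OF this] linear_op_scale[OF this] show ?thesis
    by (simp add: linear_op_def Y_op_eq distrib_left mult.left_commute)
qed

lemma foldr_commute: "(\<And>i f. i \<in> set is \<Longrightarrow> F (G i f) = G i (F f)) \<Longrightarrow> F (foldr G is f) = foldr G is (F f)"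
  by (induction "is") auto

lemma upt_split: "a \<le> i \<Longrightarrow> i + 1 < b \<Longrightarrow> [a..<b] = [a..<i] @ [i, Suc i] @ [i + 2..<b]"
  using upt_add_eq_append[of a i "b - i"] by (simp add: upt_conv_Cons)

text \<open>The letter passes the distant ones on its way right, the braid relation lowers its index
  by one, and then it commutes with the remaining letters.\<close>

lemma T_op_T_up:
  assumes "a \<le> i" "i + 1 < b"
  shows "T_op (Suc i) (T_up a b f) = T_up a b (T_op i f)"
proof -
  have "T_op (Suc i) (T_up a b f) = T_up a i (T_op (Suc i) (T_op i (T_op (Suc i) (T_up (i + 2) b f))))"
    unfolding upt_split[OF assms] by (simp, rule foldr_commute) (auto intro: T_op_comm)
  also have "\<dots> = T_up a i (T_op i (T_op (Suc i) (T_up (i + 2) b (T_op i f))))"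
    unfolding T_op_braid[symmetric]
    by (rule arg_cong[where f = "\<lambda>x. T_up a i (T_op i (T_op (Suc i) x))"], rule foldr_commute)
      (auto intro: T_op_comm)
  finally show ?thesis unfolding upt_split[OF assms] by simp
qed

lemma T_op_T_down:
  assumes "1 \<le> i" "i + 1 < b"
  shows "T_op (Suc i) (T_down b f) = T_down b (T_op i f)"
proof -
  have "T_op (Suc i) (T_down b f) = T_down i (T_op (Suc i) (T_inv i (T_inv (Suc i) (foldr T_inv [i + 2..<b] f))))"
    unfolding upt_split[OF assms] by (simp, rule foldr_commute) (auto intro: T_op_T_inv_comm)
  also have "\<dots> = T_down i (T_inv i (T_inv (Suc i) (foldr T_inv [i + 2..<b] (T_op i f))))"
    unfolding T_op_T_inv_braid
    by (rule arg_cong[where f = "\<lambda>x. T_down i (T_inv i (T_inv (Suc i) x))"], rule foldr_commute)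
      (auto intro: T_op_T_inv_comm)
  finally show ?thesis unfolding upt_split[OF assms] by simp
qed

text \<open>In its defining word \<open>Y_op N i\<close> has one more \<open>T_op i\<close> on the
  left and one fewer \<open>T_inv i\<close> on the right than \<open>Y_op N (Suc i)\<close>; the
  factor \<open>tt\<close> is the difference of the prefactors.\<close>

lemma T_Y_T:
  assumes "1 \<le> i" "i < N"
  shows "T_op i (Y_op N (Suc i) (T_op i f)) = Const tt * Y_op N i f"
proof -
  have "T_up i N g = T_op i (T_up (Suc i) N g)" for g
    using assms by (simp add: upt_conv_Cons)
  moreover have "T_down (Suc i) (T_op i f) = T_down i f" using assms by simp
  moreover have "tt powi (int (Suc i) - int N) = tt * tt powi (int i - int N)"
    using power_int_add[of tt 1 "int i - int N"] by (simp add: algebra_simps)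
  ultimately show ?thesis
    by (simp add: Y_op_eq linear_op_scale[OF linear_op_T] Const_mult mult.assoc)
qed

text \<open>Passing the shift raises the index of \<open>T_op\<close> by one, which one of the two
  words compensates: for \<open>j < i\<close> the word \<open>T_up\<close> lowers it beforehand, for
  \<open>j > i + 1\<close> the word \<open>T_down\<close> lowers it afterwards.\<close>

lemma T_Y_comm:
  assumes "1 \<le> i" "i < N" "1 \<le> j" "j \<le> N" "j \<noteq> i" "j \<noteq> Suc i"
  shows "T_op i (Y_op N j f) = Y_op N j (T_op i f)"
proof -
  have "T_op i (T_up j N (omega_op N (T_down j f))) = T_up j N (omega_op N (T_down j (T_op i f)))"
  proof (cases "j < i")
    case True
    then obtain k where k: "i = Suc k" "j \<le> k" by (cases i) auto
    have "T_op i (T_up j N (omega_op N (T_down j f))) = T_up j N (T_op k (omega_op N (T_down j f)))"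
      using k assms by (simp add: T_op_T_up)
    also have "T_op k (omega_op N (T_down j f)) = omega_op N (T_op i (T_down j f))"
      using k assms by (simp add: T_op_omega)
    also have "T_op i (T_down j f) = T_down j (T_op i f)"
      using k by (intro foldr_commute) (auto intro!: T_op_T_inv_comm)
    finally show ?thesis .
  next
    case False
    then have j: "i + 2 \<le> j" using assms by simp
    have "T_op i (T_up j N (omega_op N (T_down j f))) = T_up j N (T_op i (omega_op N (T_down j f)))"
      using j by (intro foldr_commute) (auto intro!: T_op_comm)
    also have "T_op i (omega_op N (T_down j f)) = omega_op N (T_op (Suc i) (T_down j f))"
      using j assms by (simp add: T_op_omega)
    also have "T_op (Suc i) (T_down j f) = T_down j (T_op i f)"
      using j assms by (intro T_op_T_down) auto
    finally show ?thesis .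
  qed
  then show ?thesis by (simp add: Y_op_eq linear_op_scale[OF linear_op_T])
qed

section \<open>The raising operator\<close>

definition Phi :: "nat \<Rightarrow> qt_mpoly \<Rightarrow> qt_mpoly" where
  "Phi N f = Var N * omega_op N f"

lemma linear_op_Phi: "N \<ge> 1 \<Longrightarrow> linear_op (Phi N)"
  using linear_op_omega[of N] by (auto simp: linear_op_def Phi_def algebra_simps)

lemma T_inv_omega:
  assumes "1 \<le> i" "i + 2 \<le> N"
  shows "T_inv i (omega_op N f) = omega_op N (T_inv (Suc i) f)"
  by (rule T_inv_commute) (use assms in \<open>simp add: T_op_omega\<close>)

lemma T_inv_omega_omega:
  assumes "N \<ge> 2"
  shows "T_inv (N - 1) (omega_op N (omega_op N f)) = omega_op N (omega_op N (T_inv 1 f))"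
  by (rule T_inv_commute[where F = "\<lambda>f. omega_op N (omega_op N f)"]) (rule T_op_omega_omega[OF assms])

lemma T_down_shift: "i \<le> N - 1 \<Longrightarrow> T_down i (omega_op N f) = omega_op N (foldr T_inv [2..<Suc i] f)"
proof (induction i arbitrary: f)
  case (Suc i)
  show ?case
  proof (cases "i = 0")
    case False
    have "T_down (Suc i) (omega_op N f) = T_down i (omega_op N (T_inv (Suc i) f))"
      using False Suc.prems by (simp add: T_inv_omega)
    also have "\<dots> = omega_op N (foldr T_inv [2..<Suc i] (T_inv (Suc i) f))"
      using Suc by simp
    finally show ?thesis using False by simp
  qed simp
qed simp

lemma T_up_shift: "b \<le> N - 1 \<Longrightarrow> 1 \<le> a \<Longrightarrow> a \<le> b \<Longrightarrow> T_up a b (omega_op N f) = omega_op N (T_up (Suc a) (Suc b) f)"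
proof (induction b arbitrary: f)
  case (Suc b)
  show ?case
  proof (cases "a = Suc b")
    case False
    have "T_up a (Suc b) (omega_op N f) = T_up a b (omega_op N (T_op (Suc b) f))"
      using False Suc.prems by (simp add: T_op_omega)
    also have "\<dots> = omega_op N (T_up (Suc a) (Suc b) (T_op (Suc b) f))"
      using Suc False by simp
    finally show ?thesis using False Suc.prems by simp
  qed simp
qed simp

lemma omega_mult: "N \<ge> 1 \<Longrightarrow> omega_op N (f * g) = omega_op N f * omega_op N g"
  by (simp add: omega_op_eq substitute_mult)

lemma omega_Var: "N \<ge> 1 \<Longrightarrow> omega_op N (Var k) = cyclic_var N k"
  by (simp add: omega_op_eq)

lemma T_up_Var: "(\<And>k. a \<le> k \<Longrightarrow> k < b \<Longrightarrow> j \<noteq> k \<and> j \<noteq> Suc k) \<Longrightarrow> T_up a b (Var j * f) = Var j * T_up a b f"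
  by (rule foldr_commute[symmetric]) (auto simp: T_op_Var_mult)

lemma T_down_Var: "(\<And>k. 1 \<le> k \<Longrightarrow> k < b \<Longrightarrow> j \<noteq> k \<and> j \<noteq> Suc k) \<Longrightarrow> T_down b (Var j * f) = Var j * T_down b f"
  by (rule foldr_commute[symmetric]) (auto simp: T_inv_Var_mult)

text \<open>\<open>Var N\<close> passes \<open>T_down i\<close>, becomes \<open>Var (N - 1)\<close>
  under the shift and is turned back into \<open>Var N\<close> by the last letter of
  \<open>T_up\<close>, which thereby becomes \<open>T_inv (N - 1)\<close>. Carried through the two
  shifts this is \<open>T_inv 1\<close>, the letter by which \<open>T_down (Suc i)\<close> exceeds
  the shifted word.\<close>

lemma Y_Phi:
  assumes "1 \<le> i" "i < N"
  shows "Y_op N i (Phi N f) = Phi N (Y_op N (Suc i) f)"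
proof -
  have N: "N \<ge> 2" "N \<ge> 1" and i: "i \<le> N - 1" using assms by auto
  define h where "h = omega_op N (omega_op N (foldr T_inv [2..<Suc i] f))"
  have split: "[i..<N] = [i..<N - 1] @ [N - 1]"
    using upt_Suc_append[of i "N - 1"] i N by simp
  have "T_down i (Phi N f) = Var N * omega_op N (foldr T_inv [2..<Suc i] f)"
  proof -
    have "T_down i (Var N * omega_op N f) = Var N * T_down i (omega_op N f)"
      by (rule T_down_Var) (use assms in auto)
    then show ?thesis unfolding Phi_def T_down_shift[OF i] .
  qed
  moreover have "cyclic_var N N = Var (N - 1)" using N by (simp add: cyclic_var_def)
  ultimately have "omega_op N (T_down i (Phi N f)) = Var (N - 1) * h"
    by (simp only: omega_mult[OF N(2)] omega_Var[OF N(2)] h_def)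
  moreover have "T_op (N - 1) (Var (N - 1) * h) = Const tt * (Var N * T_inv (N - 1) h)"
    using T_op_Var_self[of "N - 1" h] N by simp
  moreover have "T_up i (N - 1) (Const tt * (Var N * T_inv (N - 1) h)) =
      Const tt * (Var N * T_up i (N - 1) (T_inv (N - 1) h))"
  proof -
    have "T_up i (N - 1) (Var N * T_inv (N - 1) h) = Var N * T_up i (N - 1) (T_inv (N - 1) h)"
      by (rule T_up_Var) (use N in linarith)
    then show ?thesis by (simp only: linear_op_scale[OF linear_op_T_up])
  qed
  moreover have "T_inv (N - 1) h = omega_op N (omega_op N (T_down (Suc i) f))"
  proof -
    have "[1..<Suc i] = 1 # [2..<Suc i]"
      using assms(1) upt_conv_Cons[of 1 "Suc i"] by (simp add: numeral_2_eq_2)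
    then show ?thesis unfolding h_def T_inv_omega_omega[OF N(1)] by simp
  qed
  moreover have "T_up i (N - 1) (omega_op N (omega_op N (T_down (Suc i) f))) =
      omega_op N (T_up (Suc i) N (omega_op N (T_down (Suc i) f)))"
    using T_up_shift[of "N - 1" N i] i N assms by simp
  ultimately have "T_up i N (omega_op N (T_down i (Phi N f))) =
     Const tt * (Var N * omega_op N (T_up (Suc i) N (omega_op N (T_down (Suc i) f))))"
    by (simp add: split)
  moreover have "tt powi (int (Suc i) - int N) = tt powi (int i - int N) * tt"
    using power_int_add[of tt 1 "int i - int N"] by (simp add: algebra_simps)
  ultimately show ?thesis
    using N by (simp add: Y_op_eq Phi_def linear_op_scale[OF linear_op_omega] Const_mult mult_ac)
qed

text \<open>Every \<open>T_inv\<close> met by the variable lowers its index by one and turns into a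
  \<open>T_op\<close>, at the price of a factor \<open>inverse tt\<close>.\<close>

lemma T_down_Var_last:
  "b \<ge> 1 \<Longrightarrow> T_down b (Var b * f) = Const (tt powi (1 - int b)) * (Var 1 * T_up 1 b f)"
proof (induction b arbitrary: f rule: dec_induct)
  case (step n)
  have "T_down (Suc n) (Var (Suc n) * f) = Const (inverse tt) * T_down n (Var n * T_op n f)"
    using step(1) by (simp add: T_inv_Var_Suc linear_op_scale[OF linear_op_T_down[unfolded One_nat_def]])
  also have "\<dots> = Const (inverse tt * tt powi (1 - int n)) * (Var 1 * T_up 1 n (T_op n f))"
    unfolding step(3) by (simp add: Const_mult mult.assoc)
  also have "inverse tt * tt powi (1 - int n) = tt powi (1 - int (Suc n))"
    using power_int_add[of tt "-1" "1 - int n"] by (simp add: power_int_minus)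
  finally show ?case using step(1) by simp
qed simp

text \<open>\<open>T_down N\<close> turns \<open>Var N\<close> into \<open>Var 1\<close> and itself
  into the \<open>T_up\<close> of \<open>Y_op N 1\<close>; the shift then sends \<open>Var 1\<close>
  to \<open>qq\<close> times \<open>Var N\<close>.\<close>

lemma Y_Phi_last:
  assumes "N \<ge> 1"
  shows "Y_op N N (Phi N f) = Const qq * Phi N (Y_op N 1 f)"
proof -
  have "T_down N (Phi N f) = Const (tt powi (1 - int N)) * (Var 1 * T_up 1 N (omega_op N f))"
    unfolding Phi_def by (rule T_down_Var_last[OF assms])
  then show ?thesis using assms
    by (simp add: Y_op_eq Phi_def linear_op_scale[OF linear_op_omega] omega_mult omega_Var
      cyclic_var_def mult_ac)
qed

section \<open>Compositions and a refinement of the order\<close>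

interpretation mpoly: vector_space "\<lambda>c f. Const c * (f :: qt_mpoly)"
  by unfold_locales (simp_all add: Const_add Const_mult algebra_simps)

lemma linear_op_span:
  assumes "linear_op F" "\<And>b. b \<in> B \<Longrightarrow> F b \<in> mpoly.span C" "f \<in> mpoly.span B"
  shows "F f \<in> mpoly.span C"
  using assms(3)
proof (induction f rule: mpoly.span_induct_alt)
  case base
  show ?case by (simp add: linear_op_zero[OF assms(1)] mpoly.span_zero)
next
  case (step c b f)
  then show ?case
    by (simp add: linear_op_add[OF assms(1)] linear_op_scale[OF assms(1)] mpoly.span_add
        mpoly.span_scale assms(2))
qed

lemma part_map [simp]: "1 \<le> k \<Longrightarrow> k \<le> n \<Longrightarrow> part (map g [1..<Suc n]) k = g k"
  by (simp add: part_def nth_append del: upt_Suc)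

lemma composition_eqI:
  assumes "length \<eta> = length \<nu>" "\<And>k. 1 \<le> k \<Longrightarrow> k \<le> length \<eta> \<Longrightarrow> part \<eta> k = part \<nu> k"
  shows "\<eta> = \<nu>"
proof (rule nth_equalityI)
  fix i assume "i < length \<eta>"
  then show "\<eta> ! i = \<nu> ! i" using assms(2)[of "Suc i"] by (simp add: part_def)
qed (rule assms(1))

definition swap_parts :: "nat \<Rightarrow> nat list \<Rightarrow> nat list" where
  "swap_parts i \<eta> = map (\<lambda>k. part \<eta> (transpose i (Suc i) k)) [1..<Suc (length \<eta>)]"

lemma swap_parts_eq_update:
  assumes "1 \<le> i" "i < length \<eta>"
  shows "swap_parts i \<eta> = \<eta>[i - 1 := \<eta> ! i, i := \<eta> ! (i - 1)]"
proof (rule nth_equalityI)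
  fix j assume "j < length (swap_parts i \<eta>)"
  then have "swap_parts i \<eta> ! j = part \<eta> (transpose i (Suc i) (Suc j))" and j: "j < length \<eta>"
    by (simp_all add: swap_parts_def del: upt_Suc)
  moreover obtain k where "i = Suc k" using assms by (cases i) auto
  ultimately show "swap_parts i \<eta> ! j = \<eta>[i - 1 := \<eta> ! i, i := \<eta> ! (i - 1)] ! j"
    using assms by (simp add: part_def transpose_def nth_list_update) (intro impI, hypsubst, simp)
qed (simp add: swap_parts_def del: upt_Suc)

lemma mset_swap_parts:
  assumes "1 \<le> i" "i < length \<eta>"
  shows "mset (swap_parts i \<eta>) = mset \<eta>"
  using mset_swap[of "i - 1" \<eta> i] assms unfolding swap_parts_eq_update[OF assms]
  by (simp add: list_update_swap)

text \<open>The action of \<open>Phi\<close> on exponents, see \<open>Phi_monomial\<close>.\<close>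

definition shift_parts :: "nat list \<Rightarrow> nat list" where
  "shift_parts \<eta> = tl \<eta> @ [Suc (hd \<eta>)]"

lemma length_swap_parts [simp]: "length (swap_parts i \<eta>) = length \<eta>"
  by (simp add: swap_parts_def del: upt_Suc)

lemma part_swap_parts: "1 \<le> k \<Longrightarrow> k \<le> length \<eta> \<Longrightarrow> part (swap_parts i \<eta>) k = part \<eta> (transpose i (Suc i) k)"
  unfolding swap_parts_def by (rule part_map)

lemma transpose_bounds: "1 \<le> i \<Longrightarrow> i < n \<Longrightarrow> 1 \<le> k \<Longrightarrow> k \<le> n \<Longrightarrow>
    1 \<le> transpose i (Suc i) k \<and> transpose i (Suc i) k \<le> n"
  by (auto simp: transpose_def)

lemma part_swap [simp]:
  assumes "1 \<le> i" "i < length \<eta>"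
  shows "part (swap_parts i \<eta>) i = part \<eta> (Suc i)" "part (swap_parts i \<eta>) (Suc i) = part \<eta> i"
  using assms by (simp_all add: part_swap_parts)

lemma swap_swap [simp]:
  assumes "1 \<le> i" "i < length \<eta>"
  shows "swap_parts i (swap_parts i \<eta>) = \<eta>"
  using assms transpose_bounds[OF assms] by (intro composition_eqI) (auto simp: part_swap_parts)

lemma swap_parts_equal:
  assumes "1 \<le> i" "i < length \<eta>" "part \<eta> i = part \<eta> (Suc i)"
  shows "swap_parts i \<eta> = \<eta>"
  using assms by (intro composition_eqI) (auto simp: part_swap_parts transpose_def)

lemma length_shift_parts [simp]: "\<eta> \<noteq> [] \<Longrightarrow> length (shift_parts \<eta>) = length \<eta>"
  by (cases \<eta>) (simp_all add: shift_parts_def)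

lemma part_shift_parts:
  assumes "1 \<le> k" "k < length \<eta>"
  shows "part (shift_parts \<eta>) k = part \<eta> (Suc k)"
  using assms by (cases \<eta>) (auto simp: shift_parts_def part_def nth_append)

lemma part_shift_last:
  assumes "\<eta> \<noteq> []"
  shows "part (shift_parts \<eta>) (length \<eta>) = Suc (part \<eta> 1)"
  using assms by (cases \<eta>) (auto simp: shift_parts_def part_def nth_append)

text \<open>A composition with positive last part is the shift of one with smaller sum. Otherwise a
  positive part is carried to the end by adjacent swaps over zeros; read backwards, each of these
  swaps an ascent, as the rule \<open>swap\<close> requires.\<close>

lemma composition_induct [consumes 2, case_names zero shift swap]:
  assumes N: "N \<ge> 1" "length \<eta> = N"
    and zero: "P (replicate N 0)"
    and shift: "\<And>\<eta>. length \<eta> = N \<Longrightarrow> P \<eta> \<Longrightarrow> P (shift_parts \<eta>)"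
    and swap: "\<And>\<eta> i. length \<eta> = N \<Longrightarrow> 1 \<le> i \<Longrightarrow> i < N \<Longrightarrow> part \<eta> i < part \<eta> (Suc i) \<Longrightarrow> P \<eta> \<Longrightarrow>
      P (swap_parts i \<eta>)"
  shows "P \<eta>"
  using N(2)
proof (induction "sum_list \<eta>" arbitrary: \<eta> rule: less_induct)
  case less
  \<comment> \<open>\<open>d\<close> is the distance of some positive part from the last
    position.\<close>
  have *: "sum_list \<nu> = sum_list \<eta> \<Longrightarrow> length \<nu> = N \<Longrightarrow> d < N \<Longrightarrow> 0 < part \<nu> (N - d) \<Longrightarrow> P \<nu>" for \<nu> d
  proof (induction d arbitrary: \<nu>)
    case 0
    have ne: "\<nu> \<noteq> []" using 0 N by auto
    have l: "last \<nu> = part \<nu> N" using 0 ne by (simp add: part_def last_conv_nth)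
    define \<mu> where "\<mu> = (last \<nu> - 1) # butlast \<nu>"
    have s: "shift_parts \<mu> = \<nu>"
      using append_butlast_last_id[OF ne] 0 l by (auto simp: \<mu>_def shift_parts_def)
    have "sum_list (butlast \<nu> @ [last \<nu>]) = sum_list \<eta>"
      unfolding append_butlast_last_id[OF ne] by (rule 0(1))
    then have "sum_list \<mu> < sum_list \<eta>" using 0 l by (simp add: \<mu>_def)
    moreover have "length \<mu> = N" using 0 N by (simp add: \<mu>_def)
    ultimately show ?case using less(1) shift s by metis
  next
    case (Suc d)
    define k where "k = N - Suc d"
    have k: "1 \<le> k" "k < N" "Suc k = N - d" "k < length \<nu>" using Suc.prems by (auto simp: k_def)
    have pos: "0 < part \<nu> k" using Suc.prems(4) by (simp add: k_def)
    show ?case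
    proof (cases "part \<nu> (Suc k) > 0")
      case True
      then show ?thesis using Suc.IH[of \<nu>] Suc.prems unfolding k(3) by simp
    next
      case False
      have "mset (swap_parts k \<nu>) = mset \<nu>"
        using k Suc.prems by (intro mset_swap_parts) auto
      then have "sum_list (swap_parts k \<nu>) = sum_list \<eta>"
        using Suc.prems(1) by (metis sum_mset_sum_list)
      moreover have "0 < part (swap_parts k \<nu>) (N - d)"
        unfolding k(3)[symmetric] part_swap(2)[OF k(1,4)] by (rule pos)
      ultimately have "P (swap_parts k \<nu>)"
        using Suc.prems by (intro Suc.IH) auto
      moreover have "part (swap_parts k \<nu>) k < part (swap_parts k \<nu>) (Suc k)"
        unfolding part_swap[OF k(1,4)] using pos False by simp
      moreover have "length (swap_parts k \<nu>) = N" using Suc.prems(2) by simp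
      ultimately have "P (swap_parts k (swap_parts k \<nu>))"
        using swap k(1,2) by blast
      then show ?thesis unfolding swap_swap[OF k(1,4)] .
    qed
  qed
  show ?case
  proof (cases "\<exists>k. 1 \<le> k \<and> k \<le> N \<and> part \<eta> k > 0")
    case True
    then obtain k where "1 \<le> k" "k \<le> N" "part \<eta> k > 0" by blast
    then show ?thesis using *[of \<eta> "N - k"] less(2) by simp
  next
    case False
    then have "\<eta> = replicate N 0"
      using less(2) by (intro composition_eqI) (auto simp: part_def)
    then show ?thesis using zero by simp
  qed
qed

text \<open>The case \<open>max \<dots> < max \<dots>\<close> lowers the dominance order, the other one the Bruhat
  order. \<open>\<Phi>\<close> can turn an instance of the former that involves position 1 into one of the latter
  and conversely, so only both together are invariant under \<open>\<Phi>\<close>.\<close>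

definition step_below :: "nat list \<Rightarrow> nat list \<Rightarrow> bool" where
  "step_below \<nu> \<eta> \<longleftrightarrow> length \<nu> = length \<eta> \<and> (\<exists>i j. 1 \<le> i \<and> i < j \<and> j \<le> length \<eta> \<and>
     (\<forall>k. 1 \<le> k \<longrightarrow> k \<le> length \<eta> \<longrightarrow> k \<noteq> i \<longrightarrow> k \<noteq> j \<longrightarrow> part \<nu> k = part \<eta> k) \<and>
     part \<nu> i + part \<nu> j = part \<eta> i + part \<eta> j \<and>
     (max (part \<nu> i) (part \<nu> j) < max (part \<eta> i) (part \<eta> j) \<or>
      part \<nu> i = part \<eta> j \<and> part \<nu> j = part \<eta> i \<and> part \<eta> j < part \<eta> i))"

abbreviation below :: "nat list \<Rightarrow> nat list \<Rightarrow> bool" where "below \<equiv> step_below\<^sup>+\<^sup>+"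
abbreviation below_eq :: "nat list \<Rightarrow> nat list \<Rightarrow> bool" where "below_eq \<equiv> step_below\<^sup>*\<^sup>*"

lemma step_belowI:
  assumes "length \<nu> = length \<eta>" "1 \<le> i" "i < j" "j \<le> length \<eta>"
    and "\<And>k. 1 \<le> k \<Longrightarrow> k \<le> length \<eta> \<Longrightarrow> k \<noteq> i \<Longrightarrow> k \<noteq> j \<Longrightarrow> part \<nu> k = part \<eta> k"
    and "part \<nu> i + part \<nu> j = part \<eta> i + part \<eta> j"
    and "max (part \<nu> i) (part \<nu> j) < max (part \<eta> i) (part \<eta> j) \<or>
      part \<nu> i = part \<eta> j \<and> part \<nu> j = part \<eta> i \<and> part \<eta> j < part \<eta> i"
  shows "step_below \<nu> \<eta>"
  unfolding step_below_def using assms by blast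

lemma length_step_below: "step_below \<nu> \<eta> \<Longrightarrow> length \<nu> = length \<eta>"
  by (simp add: step_below_def)

lemma length_below: "below \<nu> \<eta> \<Longrightarrow> length \<nu> = length \<eta>"
  by (induction rule: tranclp_induct) (auto dest: length_step_below)

lemma length_below_eq: "below_eq \<nu> \<eta> \<Longrightarrow> length \<nu> = length \<eta>"
  by (induction rule: rtranclp_induct) (auto dest: length_step_below)

text \<open>The pair \<open>(a, b)\<close> at positions 1 and \<open>j\<close> becomes
  \<open>(b, Suc a)\<close> at \<open>j - 1\<close> and the last position. A swap turns into a drop
  of the maximum; a drop turns into a swap exactly when \<open>Suc c = b\<close>.\<close>

lemma shift_pair_cases:
  fixes a b c d :: nat
  assumes "c + d = a + b" "max c d < max a b \<or> c = b \<and> d = a \<and> b < a"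
  shows "max d (Suc c) < max b (Suc a) \<or> d = Suc a \<and> Suc c = b \<and> Suc a < b"
  using assms by (auto simp: max_def split: if_splits)

lemma step_below_shift:
  assumes "step_below \<nu> \<eta>" "\<eta> \<noteq> []"
  shows "step_below (shift_parts \<nu>) (shift_parts \<eta>)"
proof -
  let ?N = "length \<eta>"
  from assms(1) obtain i j where len: "length \<nu> = ?N" and ij: "1 \<le> i" "i < j" "j \<le> ?N"
    and same: "\<And>k. 1 \<le> k \<Longrightarrow> k \<le> ?N \<Longrightarrow> k \<noteq> i \<Longrightarrow> k \<noteq> j \<Longrightarrow> part \<nu> k = part \<eta> k"
    and sum: "part \<nu> i + part \<nu> j = part \<eta> i + part \<eta> j"
    and cases: "max (part \<nu> i) (part \<nu> j) < max (part \<eta> i) (part \<eta> j) \<or>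
      part \<nu> i = part \<eta> j \<and> part \<nu> j = part \<eta> i \<and> part \<eta> j < part \<eta> i"
    by (auto simp: step_below_def)
  have ne: "\<nu> \<noteq> []" using len assms(2) by auto
  have pn: "part (shift_parts \<nu>) k = (if k = ?N then Suc (part \<nu> 1) else part \<nu> (Suc k))"
    "part (shift_parts \<eta>) k = (if k = ?N then Suc (part \<eta> 1) else part \<eta> (Suc k))"
    if "1 \<le> k" "k \<le> ?N" for k
    using that part_shift_last[OF ne] part_shift_last[OF assms(2)] len
    by (auto simp: part_shift_parts)
  show ?thesis
  proof (cases "i = 1")
    case False
    show ?thesis
    proof (rule step_belowI[of _ _ "i - 1" "j - 1"])
      show "part (shift_parts \<nu>) k = part (shift_parts \<eta>) k"
        if "1 \<le> k" "k \<le> length (shift_parts \<eta>)" "k \<noteq> i - 1" "k \<noteq> j - 1" for k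
        using that False ij same[of 1] same[of "Suc k"] assms(2) by (auto simp: pn)
    qed (use False ij sum cases len assms(2) ne in \<open>auto simp: pn\<close>)
  next
    case True
    show ?thesis
    proof (rule step_belowI[of _ _ "j - 1" ?N])
      show "part (shift_parts \<nu>) k = part (shift_parts \<eta>) k"
        if "1 \<le> k" "k \<le> length (shift_parts \<eta>)" "k \<noteq> j - 1" "k \<noteq> ?N" for k
        using that True ij same[of "Suc k"] assms(2) by (auto simp: pn)
      show "max (part (shift_parts \<nu>) (j - 1)) (part (shift_parts \<nu>) ?N)
          < max (part (shift_parts \<eta>) (j - 1)) (part (shift_parts \<eta>) ?N) \<or>
        part (shift_parts \<nu>) (j - 1) = part (shift_parts \<eta>) ?N \<and>
        part (shift_parts \<nu>) ?N = part (shift_parts \<eta>) (j - 1) \<and>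
        part (shift_parts \<eta>) ?N < part (shift_parts \<eta>) (j - 1)"
        using True ij shift_pair_cases[OF sum cases] assms(2) by (auto simp: pn)
    qed (use True ij sum len assms(2) ne in \<open>auto simp: pn\<close>)
  qed
qed

lemma below_shift:
  assumes "below \<nu> \<eta>" "\<eta> \<noteq> []"
  shows "below (shift_parts \<nu>) (shift_parts \<eta>)"
  using assms
proof (induction rule: tranclp_induct)
  case (base \<eta>)
  then show ?case by (simp add: step_below_shift tranclp.r_into_trancl)
next
  case (step \<kappa> \<eta>)
  then have "\<kappa> \<noteq> []" using length_step_below by fastforce
  then show ?case using step step_below_shift by (meson tranclp.trancl_into_trancl)
qed

text \<open>The transposition preserves the order of the two positions of the step unless they are
  \<open>i\<close> and \<open>Suc i\<close>. In that case a drop of the maximum survives, while a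
  swap is undone; this is the second alternative.\<close>

lemma step_below_swap:
  assumes "step_below \<mu> \<nu>" "1 \<le> i" "i < length \<nu>"
  shows "step_below (swap_parts i \<mu>) (swap_parts i \<nu>) \<or>
    \<mu> = swap_parts i \<nu> \<and> part \<nu> (Suc i) < part \<nu> i"
proof -
  let ?N = "length \<nu>" and ?s = "transpose i (Suc i)"
  from assms(1) obtain p r where len: "length \<mu> = ?N" and pr: "1 \<le> p" "p < r" "r \<le> ?N"
    and same: "\<And>k. 1 \<le> k \<Longrightarrow> k \<le> ?N \<Longrightarrow> k \<noteq> p \<Longrightarrow> k \<noteq> r \<Longrightarrow> part \<mu> k = part \<nu> k"
    and sum: "part \<mu> p + part \<mu> r = part \<nu> p + part \<nu> r"
    and cases: "max (part \<mu> p) (part \<mu> r) < max (part \<nu> p) (part \<nu> r) \<or>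
      part \<mu> p = part \<nu> r \<and> part \<mu> r = part \<nu> p \<and> part \<nu> r < part \<nu> p"
    by (auto simp: step_below_def)
  have s: "1 \<le> k \<Longrightarrow> k \<le> ?N \<Longrightarrow> 1 \<le> ?s k \<and> ?s k \<le> ?N" for k
    using transpose_bounds[OF assms(2,3)] .
  have pn: "part (swap_parts i \<mu>) k = part \<mu> (?s k)" "part (swap_parts i \<nu>) k = part \<nu> (?s k)"
    if "1 \<le> k" "k \<le> ?N" for k
    using that len by (simp_all add: part_swap_parts)
  have same': "part (swap_parts i \<mu>) k = part (swap_parts i \<nu>) k"
    if "1 \<le> k" "k \<le> ?N" "k \<noteq> ?s p" "k \<noteq> ?s r" for k
  proof -
    have "?s k \<noteq> p" "?s k \<noteq> r" using that(3,4) by (metis transpose_involutory)+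
    then show ?thesis using that(1,2) s[of k] same[of "?s k"] by (simp add: pn)
  qed
  show ?thesis
  proof (cases "p = i \<and> r = Suc i")
    case False
    then have lt: "?s p < ?s r" using pr by (auto simp: transpose_def split: if_splits)
    have "step_below (swap_parts i \<mu>) (swap_parts i \<nu>)"
      by (rule step_belowI[of _ _ "?s p" "?s r"])
        (use len lt s[of p] s[of r] pr sum cases same' in \<open>simp_all add: pn\<close>)
    then show ?thesis ..
  next
    case True
    show ?thesis
    proof (cases "max (part \<mu> p) (part \<mu> r) < max (part \<nu> p) (part \<nu> r)")
      case lt: True
      have "step_below (swap_parts i \<mu>) (swap_parts i \<nu>)"
        by (rule step_belowI[of _ _ p r])
          (use len True pr sum lt same' assms in \<open>simp_all add: pn max.commute add.commute\<close>)
      then show ?thesis ..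
    next
      case False
      then have "\<mu> = swap_parts i \<nu>"
        using cases len True same by (intro composition_eqI) (auto simp: pn transpose_def)
      then show ?thesis using False cases True by auto
    qed
  qed
qed

lemma step_below_swap_self:
  assumes "1 \<le> i" "i < length \<eta>" "part \<eta> i < part \<eta> (Suc i)"
  shows "step_below \<eta> (swap_parts i \<eta>)"
  by (rule step_belowI[of _ _ i "Suc i"]) (use assms in \<open>simp_all add: part_swap_parts\<close>)

text \<open>The larger of \<nu> and \<open>swap_parts i \<nu>\<close>. By the second alternative of
  \<open>step_below_swap\<close> the map \<open>swap_parts i\<close> is not monotone, but this one
  is.\<close>

definition swap_max :: "nat \<Rightarrow> nat list \<Rightarrow> nat list" where
  "swap_max i \<nu> = (if part \<nu> i < part \<nu> (Suc i) then swap_parts i \<nu> else \<nu>)"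

lemma below_eq_swap_max:
  assumes "1 \<le> i" "i < length \<nu>"
  shows "below_eq \<nu> (swap_max i \<nu>)" "below_eq (swap_parts i \<nu>) (swap_max i \<nu>)"
  using step_below_swap_self[OF assms] step_below_swap_self[of i "swap_parts i \<nu>"]
    swap_parts_equal[OF assms] assms
  by (auto simp: swap_max_def not_less le_less)

lemma below_eq_swap_max_mono:
  assumes "below_eq \<mu> \<nu>" "1 \<le> i" "i < length \<nu>"
  shows "below_eq (swap_max i \<mu>) (swap_max i \<nu>)"
  using assms
proof (induction rule: rtranclp_induct)
  case (step \<kappa> \<nu>)
  have len: "length \<kappa> = length \<nu>" using step by (simp add: length_step_below)
  have "below_eq (swap_parts i \<kappa>) (swap_max i \<nu>)"
    using step_below_swap[OF step(2)] below_eq_swap_max[of i \<nu>] step len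
    by (metis converse_rtranclp_into_rtranclp swap_swap)
  moreover have "below_eq \<kappa> (swap_max i \<nu>)"
    using step below_eq_swap_max[of i \<nu>] by (meson converse_rtranclp_into_rtranclp)
  ultimately have "below_eq (swap_max i \<kappa>) (swap_max i \<nu>)"
    unfolding swap_max_def[of i \<kappa>] by simp
  moreover have "below_eq (swap_max i \<mu>) (swap_max i \<kappa>)"
    by (rule step.IH) (use step.prems len in auto)
  ultimately show ?case by (rule rtranclp_trans[rotated])
qed simp

lemma below_swap_max:
  assumes "below \<nu> \<eta>" "1 \<le> i" "i < length \<eta>" "part \<eta> i < part \<eta> (Suc i)"
  shows "below (swap_max i \<nu>) (swap_parts i \<eta>)"
proof -
  obtain \<kappa> where \<kappa>: "below_eq \<nu> \<kappa>" "step_below \<kappa> \<eta>"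
    using assms(1) by (cases rule: tranclp.cases) (auto dest: tranclp_into_rtranclp)
  have len: "length \<kappa> = length \<eta>" using \<kappa> by (simp add: length_step_below)
  \<comment> \<open>The ascent of \<eta> at \<open>i\<close> excludes the second alternative of
    \<open>step_below_swap\<close>.\<close>
  have "step_below (swap_parts i \<kappa>) (swap_parts i \<eta>)"
    using step_below_swap[OF \<kappa>(2) assms(2,3)] assms(4) by auto
  moreover have "below \<kappa> (swap_parts i \<eta>)"
    using \<kappa>(2) step_below_swap_self[OF assms(2,3,4)]
    by (meson tranclp.r_into_trancl tranclp.trancl_into_trancl)
  ultimately have "below (swap_max i \<kappa>) (swap_parts i \<eta>)"
    by (auto simp: swap_max_def)
  moreover have "below_eq (swap_max i \<nu>) (swap_max i \<kappa>)"
    by (rule below_eq_swap_max_mono[OF \<kappa>(1)]) (use assms len in auto)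
  ultimately show ?thesis by (rule rtranclp_tranclp_tranclp[rotated])
qed

section \<open>Triangularity of the Hecke operators\<close>

definition rest_monomial :: "nat \<Rightarrow> nat list \<Rightarrow> qt_mpoly" where
  "rest_monomial i \<nu> = (\<Prod>k\<in>{1..length \<nu>} - {i, Suc i}. Var k ^ part \<nu> k)"

lemma monomial_split:
  assumes "1 \<le> i" "i < length \<nu>"
  shows "monomial \<nu> = rest_monomial i \<nu> * (Var i ^ part \<nu> i * Var (Suc i) ^ part \<nu> (Suc i))"
proof -
  have "{1..length \<nu>} = insert i (insert (Suc i) ({1..length \<nu>} - {i, Suc i}))" using assms by auto
  then have "monomial \<nu> = (\<Prod>k\<in>insert i (insert (Suc i) ({1..length \<nu>} - {i, Suc i})). Var k ^ part \<nu> k)"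
    by (simp add: monomial_def)
  also have "\<dots> = Var i ^ part \<nu> i * (Var (Suc i) ^ part \<nu> (Suc i) * rest_monomial i \<nu>)"
    by (simp add: rest_monomial_def)
  finally show ?thesis by (simp add: mult_ac)
qed

lemma K_power: "K_op i j (f ^ n) = K_op i j f ^ n"
  by (simp add: K_op_def substitute_power)

lemma K_rest_monomial: "K i (rest_monomial i \<nu>) = rest_monomial i \<nu>"
  unfolding rest_monomial_def K_op_def
  by (simp add: substitute_prod substitute_power)

lemma mult_scaled_sum:
  fixes a c :: "'a::comm_ring_1"
  shows "a * (c * sum f A) = c * (\<Sum>k\<in>A. a * f k)"
  by (simp add: sum_distrib_left mult.left_commute)

definition set_pair :: "nat \<Rightarrow> nat list \<Rightarrow> nat \<Rightarrow> nat \<Rightarrow> nat list" where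
  "set_pair i \<nu> c d = map (\<lambda>k. if k = i then c else if k = Suc i then d else part \<nu> k) [1..<Suc (length \<nu>)]"

lemma length_set_pair [simp]: "length (set_pair i \<nu> c d) = length \<nu>"
  by (simp add: set_pair_def del: upt_Suc)

lemma part_set_pair: "1 \<le> k \<Longrightarrow> k \<le> length \<nu> \<Longrightarrow>
    part (set_pair i \<nu> c d) k = (if k = i then c else if k = Suc i then d else part \<nu> k)"
  unfolding set_pair_def by (rule part_map)

lemma monomial_set_pair:
  assumes "1 \<le> i" "i < length \<nu>"
  shows "monomial (set_pair i \<nu> c d) = rest_monomial i \<nu> * (Var i ^ c * Var (Suc i) ^ d)"
proof -
  have "rest_monomial i (set_pair i \<nu> c d) = rest_monomial i \<nu>"
    unfolding rest_monomial_def by (rule prod.cong) (auto simp: part_set_pair)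
  then show ?thesis using monomial_split[of i "set_pair i \<nu> c d"] assms by (simp add: part_set_pair)
qed

lemma set_pair_self: "1 \<le> i \<Longrightarrow> i < length \<nu> \<Longrightarrow> set_pair i \<nu> (part \<nu> i) (part \<nu> (Suc i)) = \<nu>"
  by (rule composition_eqI) (auto simp: part_set_pair)

lemma set_pair_swap: "1 \<le> i \<Longrightarrow> i < length \<nu> \<Longrightarrow> set_pair i \<nu> (part \<nu> (Suc i)) (part \<nu> i) = swap_parts i \<nu>"
  by (rule composition_eqI) (auto simp: part_set_pair part_swap_parts transpose_def)

lemma T_op_one: "T_op i 1 = Const tt"
  by (rule T_op_unique) (simp add: algebra_simps)

lemma T_op_Var_mult_self: "T_op i (Var i * f) = Var (Suc i) * (T_op i f + (1 - Const tt) * f)"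
  unfolding T_op_Var_self T_inv_def by (simp add: mult.left_commute[of "Const tt"])

lemma T_op_Var_mult_Suc: "T_op i (Var (Suc i) * f) = Var i * T_op i f + (Const tt - 1) * (Var (Suc i) * f)"
proof -
  have "T_op i g = Const tt * T_inv i g + (Const tt - 1) * g" for g
    by (simp add: T_inv_def algebra_simps)
  from this[of "Var (Suc i) * f"] show ?thesis by (simp add: T_inv_Var_Suc)
qed

lemma T_op_Var_power:
  "T_op i (Var i ^ Suc n) =
    Var (Suc i) ^ Suc n + (1 - Const tt) * (\<Sum>k\<in>{1..n}. Var i ^ k * Var (Suc i) ^ (Suc n - k))"
proof (induction n)
  case 0
  show ?case using T_op_Var_mult_self[of i 1] by (simp add: T_op_one)
next
  case (Suc n)
  have sum: "(\<Sum>k\<in>{1..Suc n}. Var i ^ k * Var (Suc i) ^ (Suc (Suc n) - k)) =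
    Var (Suc i) * ((\<Sum>k\<in>{1..n}. Var i ^ k * Var (Suc i) ^ (Suc n - k)) + Var i ^ Suc n)"
  proof -
    have "(\<Sum>k\<in>{1..n}. Var i ^ k * Var (Suc i) ^ (Suc (Suc n) - k)) =
        Var (Suc i) * (\<Sum>k\<in>{1..n}. Var i ^ k * Var (Suc i) ^ (Suc n - k))"
      unfolding sum_distrib_left by (rule sum.cong) (auto simp: Suc_diff_le mult_ac)
    then show ?thesis by (simp add: algebra_simps)
  qed
  show ?case
    unfolding power_Suc[of "Var i" "Suc n"] T_op_Var_mult_self Suc sum by (simp add: algebra_simps)
qed

text \<open>Unlike in \<open>T_op_Var_power\<close>, the sum contains the original power, at
  \<open>k = 0\<close>. This is why in \<open>T_op_monomial\<close> the remainder is bounded by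
  \<nu> at an ascent and by the swapped composition otherwise.\<close>

lemma T_op_Var_Suc_power:
  "T_op i (Var (Suc i) ^ n) =
    Const tt * Var i ^ n + (Const tt - 1) * (\<Sum>k<n. Var i ^ k * Var (Suc i) ^ (n - k))"
proof (induction n)
  case 0
  show ?case by (simp add: T_op_one)
next
  case (Suc n)
  have sum: "(\<Sum>k<Suc n. Var i ^ k * Var (Suc i) ^ (Suc n - k)) =
      Var (Suc i) ^ Suc n + Var i * (\<Sum>k<n. Var i ^ k * Var (Suc i) ^ (n - k))"
    unfolding sum.lessThan_Suc_shift sum_distrib_left by (simp add: mult_ac)
  show ?case
    unfolding power_Suc[of "Var (Suc i)" n] T_op_Var_mult_Suc Suc
    unfolding power_Suc[symmetric] sum by (simp add: algebra_simps)
qed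

lemma step_below_set_pair:
  assumes "1 \<le> i" "i < length \<nu>" "c + d = part \<nu> i + part \<nu> (Suc i)"
    "max c d < max (part \<nu> i) (part \<nu> (Suc i))"
  shows "step_below (set_pair i \<nu> c d) \<nu>"
  by (rule step_belowI[of _ _ i "Suc i"]) (use assms in \<open>auto simp: part_set_pair\<close>)

definition below_span :: "nat list \<Rightarrow> qt_mpoly set" where
  "below_span \<eta> = mpoly.span (monomial ` {\<nu>. below_eq \<nu> \<eta>})"

definition strict_span :: "nat list \<Rightarrow> qt_mpoly set" where
  "strict_span \<eta> = mpoly.span (monomial ` {\<nu>. below \<nu> \<eta>})"

lemma below_span_base: "below_eq \<nu> \<eta> \<Longrightarrow> monomial \<nu> \<in> below_span \<eta>"
  unfolding below_span_def by (rule mpoly.span_base) simp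

lemma strict_span_subset: "strict_span \<eta> \<subseteq> below_span \<eta>"
  unfolding strict_span_def below_span_def
  by (rule mpoly.span_mono) (auto dest: tranclp_into_rtranclp)

lemma below_span_subset_strict: "below \<nu> \<eta> \<Longrightarrow> below_span \<nu> \<subseteq> strict_span \<eta>"
  unfolding strict_span_def below_span_def
  by (rule mpoly.span_mono) (auto dest: rtranclp_tranclp_tranclp)

text \<open>The common power of the two variables and the remaining ones are
  \<open>K i\<close>-invariant and factor out, which leaves a pure power. Only at an ascent does a
  term above \<nu> occur, and there it is split off as the leading term.\<close>

lemma T_op_monomial:
  assumes "1 \<le> i" "i < length \<nu>"
  shows "T_op i (monomial \<nu>) -
    (if part \<nu> i < part \<nu> (Suc i) then Const tt * monomial (swap_parts i \<nu>) else 0) \<in>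
    below_span (if part \<nu> i < part \<nu> (Suc i) then \<nu> else swap_parts i \<nu>)"
proof -
  let ?x = "Var i" and ?y = "Var (Suc i)"
  define a where "a = part \<nu> i"
  define b where "b = part \<nu> (Suc i)"
  define R where "R = rest_monomial i \<nu>"
  have mono: "monomial (set_pair i \<nu> c d) = R * (?x ^ c * ?y ^ d)" for c d
    using monomial_set_pair[OF assms] by (simp add: R_def)
  have Tm: "T_op i (R * (?x * ?y) ^ k * f) = R * (?x * ?y) ^ k * T_op i f" for k f
    by (rule T_op_mult) (simp add: K_mult K_power K_rest_monomial R_def mult.commute)
  have R_pow: "R * (?x * ?y) ^ k * (?x ^ c * ?y ^ d) = R * (?x ^ (k + c) * ?y ^ (k + d))" for k c d
    by (simp add: power_add power_mult_distrib mult_ac)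
  have \<nu>: "monomial \<nu> = R * (?x ^ a * ?y ^ b)"
    using mono[of a b] set_pair_self[OF assms] by (simp add: a_def b_def)
  have sw: "monomial (swap_parts i \<nu>) = R * (?x ^ b * ?y ^ a)"
    using mono[of b a] set_pair_swap[OF assms] by (simp add: a_def b_def)
  consider "a < b" | "a = b" | "b < a" by linarith
  then show ?thesis
  proof cases
    case 1
    define n where "n = b - a"
    have b: "b = a + n" and n: "n > 0" using 1 by (auto simp: n_def)
    have "T_op i (monomial \<nu>) = R * (?x * ?y) ^ a * T_op i (?y ^ n)"
      unfolding \<nu> b Tm[symmetric] by (simp add: power_add power_mult_distrib mult_ac)
    also have "\<dots> = Const tt * (R * (?x * ?y) ^ a * (?x ^ n * ?y ^ 0)) +
        (Const tt - 1) * (\<Sum>k<n. R * (?x * ?y) ^ a * (?x ^ k * ?y ^ (n - k)))"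
      unfolding T_op_Var_Suc_power distrib_left mult_scaled_sum by (simp add: mult.left_commute)
    also have "\<dots> = Const tt * monomial (swap_parts i \<nu>) +
        (Const tt - 1) * (\<Sum>k<n. R * (?x ^ (a + k) * ?y ^ (a + (n - k))))"
      unfolding sw b R_pow by simp
    finally have "T_op i (monomial \<nu>) - Const tt * monomial (swap_parts i \<nu>) =
      Const (tt - 1) * (\<Sum>k<n. monomial (set_pair i \<nu> (a + k) (a + (n - k))))"
      unfolding mono by (simp add: Const_diff)
    moreover have "monomial (set_pair i \<nu> (a + k) (a + (n - k))) \<in> below_span \<nu>" if "k < n" for k
    proof (cases "k = 0")
      case True
      then show ?thesis using set_pair_self[OF assms] by (simp add: a_def[symmetric] b_def[symmetric] b[symmetric] below_span_base)
    next
      case False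
      then have "step_below (set_pair i \<nu> (a + k) (a + (n - k))) \<nu>"
        using that b by (intro step_below_set_pair assms) (auto simp: a_def[symmetric] b_def[symmetric])
      then show ?thesis by (intro below_span_base r_into_rtranclp)
    qed
    ultimately show ?thesis using 1
      by (auto simp: a_def[symmetric] b_def[symmetric] below_span_def intro!: mpoly.span_scale mpoly.span_sum)
  next
    case 2
    have "T_op i (monomial \<nu>) = R * (?x * ?y) ^ a * T_op i 1"
      unfolding \<nu> 2[symmetric] Tm[symmetric] by (simp add: power_mult_distrib)
    then have "T_op i (monomial \<nu>) = Const tt * monomial (swap_parts i \<nu>)"
      unfolding T_op_one sw 2[symmetric] by (simp add: power_mult_distrib mult_ac)
    moreover have "Const tt * monomial (swap_parts i \<nu>) \<in> below_span (swap_parts i \<nu>)"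
      unfolding below_span_def by (intro mpoly.span_scale mpoly.span_base) auto
    ultimately show ?thesis using 2 by (simp add: a_def[symmetric] b_def[symmetric])
  next
    case 3
    define n where "n = a - b - 1"
    have a: "a = b + Suc n" using 3 by (auto simp: n_def)
    have "T_op i (monomial \<nu>) = R * (?x * ?y) ^ b * T_op i (?x ^ Suc n)"
      unfolding \<nu> a Tm[symmetric] by (simp add: power_add power_mult_distrib mult_ac)
    also have "\<dots> = R * (?x * ?y) ^ b * (?x ^ 0 * ?y ^ Suc n) +
        (1 - Const tt) * (\<Sum>k\<in>{1..n}. R * (?x * ?y) ^ b * (?x ^ k * ?y ^ (Suc n - k)))"
      unfolding T_op_Var_power distrib_left mult_scaled_sum by simp
    also have "\<dots> = monomial (swap_parts i \<nu>) +
        (1 - Const tt) * (\<Sum>k\<in>{1..n}. R * (?x ^ (b + k) * ?y ^ (b + (Suc n - k))))"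
      unfolding sw a R_pow by simp
    finally have "T_op i (monomial \<nu>) = monomial (swap_parts i \<nu>) +
      Const (1 - tt) * (\<Sum>k\<in>{1..n}. monomial (set_pair i \<nu> (b + k) (b + (Suc n - k))))"
      unfolding mono by (simp add: Const_diff)
    moreover have "monomial (set_pair i \<nu> (b + k) (b + (Suc n - k))) \<in> below_span (swap_parts i \<nu>)"
      if "k \<in> {1..n}" for k
    proof -
      have "set_pair i \<nu> (b + k) (b + (Suc n - k)) = set_pair i (swap_parts i \<nu>) (b + k) (b + (Suc n - k))"
        by (rule composition_eqI) (auto simp: part_set_pair part_swap_parts transpose_def)
      moreover have "step_below \<dots> (swap_parts i \<nu>)"
        using that a assms by (intro step_below_set_pair) (auto simp: a_def[symmetric] b_def[symmetric])
      ultimately show ?thesis by (metis below_span_base r_into_rtranclp)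
    qed
    moreover have "monomial (swap_parts i \<nu>) \<in> below_span (swap_parts i \<nu>)"
      by (simp add: below_span_base)
    ultimately show ?thesis using 3
      by (auto simp: a_def[symmetric] b_def[symmetric] below_span_def intro!: mpoly.span_add mpoly.span_scale mpoly.span_sum)
  qed
qed

section \<open>Spectral vectors\<close>

definition rank_set :: "nat list \<Rightarrow> nat \<Rightarrow> nat set" where
  "rank_set \<eta> i = {j \<in> {1..length \<eta>}. part \<eta> j > part \<eta> i \<or> part \<eta> j = part \<eta> i \<and> j \<le> i}"

lemma finite_rank_set [simp]: "finite (rank_set \<eta> i)"
  by (simp add: rank_set_def)

lemma rank_eq_card:
  assumes "i \<le> length \<eta>"
  shows "rank \<eta> i = card (rank_set \<eta> i)"
proof -
  have "rank_set \<eta> i = {j \<in> {1..length \<eta>}. part \<eta> j > part \<eta> i} \<union> {j \<in> {1..i}. part \<eta> j = part \<eta> i}"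
    using assms by (auto simp: rank_set_def)
  then show ?thesis
    unfolding rank_def by (simp add: card_Un_disjoint disjoint_iff)
qed

lemma rank_transfer:
  assumes "length \<nu> = length \<eta>" "i \<le> length \<nu>" "j \<le> length \<eta>"
    and "bij_betw h {1..length \<nu>} {1..length \<eta>}"
    and "\<And>k. k \<in> {1..length \<nu>} \<Longrightarrow> k \<in> rank_set \<nu> i \<longleftrightarrow> h k \<in> rank_set \<eta> j"
  shows "rank \<nu> i = rank \<eta> j"
proof -
  have "bij_betw h (rank_set \<nu> i) (rank_set \<eta> j)"
  proof (rule bij_betw_subset[OF assms(4)])
    show "rank_set \<nu> i \<subseteq> {1..length \<nu>}" by (auto simp: rank_set_def)
    have "rank_set \<eta> j \<subseteq> h ` {1..length \<nu>}"
      using bij_betw_imp_surj_on[OF assms(4)] by (auto simp: rank_set_def)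
    moreover have "rank_set \<nu> i \<subseteq> {1..length \<nu>}" by (auto simp: rank_set_def)
    ultimately show "h ` rank_set \<nu> i = rank_set \<eta> j" using assms(5) by blast
  qed
  then show ?thesis using assms by (simp add: rank_eq_card bij_betw_same_card)
qed

text \<open>Ties are broken by position, and the transposition reverses the order of positions only
  for the pair \<open>i\<close>, \<open>Suc i\<close>, whose parts differ.\<close>

lemma rank_swap_parts:
  assumes "1 \<le> i" "i < length \<eta>" "part \<eta> i \<noteq> part \<eta> (Suc i)" "1 \<le> k" "k \<le> length \<eta>"
  shows "rank (swap_parts i \<eta>) k = rank \<eta> (transpose i (Suc i) k)"
proof (rule rank_transfer[where h = "transpose i (Suc i)"])
  show "bij_betw (transpose i (Suc i)) {1..length (swap_parts i \<eta>)} {1..length \<eta>}"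
    using permutes_imp_bij[OF permutes_swap_id[of i "{1..length \<eta>}" "Suc i"]] assms by simp
  show "j \<in> rank_set (swap_parts i \<eta>) k \<longleftrightarrow> transpose i (Suc i) j \<in> rank_set \<eta> (transpose i (Suc i) k)"
    if "j \<in> {1..length (swap_parts i \<eta>)}" for j
    using that assms by (auto simp: rank_set_def part_swap_parts transpose_def)
qed (use assms transpose_bounds[OF assms(1,2,4,5)] in auto)

lemma rank_Suc_equal:
  assumes "1 \<le> i" "i < length \<eta>" "part \<eta> i = part \<eta> (Suc i)"
  shows "rank \<eta> (Suc i) = Suc (rank \<eta> i)"
proof -
  have "rank_set \<eta> (Suc i) = insert (Suc i) (rank_set \<eta> i)" "Suc i \<notin> rank_set \<eta> i"
    using assms by (auto simp: rank_set_def le_Suc_eq)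
  then show ?thesis using assms by (simp add: rank_eq_card)
qed

text \<open>The first part precedes its equals and comes after all larger parts. Raised by one and
  put last it has the same rank: it exceeds its former equals and is the last among the parts of its
  new value.\<close>

lemma rank_shift_parts:
  assumes "1 \<le> k" "k \<le> length \<eta>"
  shows "rank (shift_parts \<eta>) k = rank \<eta> (if k = length \<eta> then 1 else Suc k)"
proof (rule rank_transfer[where h = "\<lambda>k. if k = length \<eta> then 1 else Suc k"])
  have ne: "\<eta> \<noteq> []" using assms by auto
  have pn: "part (shift_parts \<eta>) k = (if k = length \<eta> then Suc (part \<eta> 1) else part \<eta> (Suc k))"
    if "1 \<le> k" "k \<le> length \<eta>" for k
    using that part_shift_last[OF ne] by (auto simp: part_shift_parts)
  show "length (shift_parts \<eta>) = length \<eta>" "k \<le> length (shift_parts \<eta>)" using assms ne by auto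
  show "bij_betw (\<lambda>k. if k = length \<eta> then 1 else Suc k) {1..length (shift_parts \<eta>)} {1..length \<eta>}"
    using ne by (intro bij_betw_byWitness[where f' = "\<lambda>k. if k = 1 then length \<eta> else k - 1"])
      (auto simp: le_Suc_eq Suc_le_eq)
  show "j \<in> rank_set (shift_parts \<eta>) k \<longleftrightarrow> (if j = length \<eta> then 1 else Suc j) \<in>
      rank_set \<eta> (if k = length \<eta> then 1 else Suc k)"
    if "j \<in> {1..length (shift_parts \<eta>)}" for j
    using that assms ne by (auto simp: rank_set_def pn)
  show "(if k = length \<eta> then 1 else Suc k) \<le> length \<eta>" using assms by auto
qed

lemma rank_less:
  assumes "1 \<le> i" "i \<le> length \<eta>" "1 \<le> j" "j \<le> length \<eta>"
    "part \<eta> i > part \<eta> j \<or> part \<eta> i = part \<eta> j \<and> i < j"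
  shows "rank \<eta> i < rank \<eta> j"
proof -
  have "rank_set \<eta> i \<subset> rank_set \<eta> j"
  proof (rule psubsetI)
    show "rank_set \<eta> i \<noteq> rank_set \<eta> j"
    proof
      assume *: "rank_set \<eta> i = rank_set \<eta> j"
      have "j \<in> rank_set \<eta> j" using assms by (auto simp: rank_set_def)
      moreover have "j \<notin> rank_set \<eta> i" using assms by (auto simp: rank_set_def)
      ultimately show False using * by simp
    qed
  qed (use assms in \<open>auto simp: rank_set_def\<close>)
  then show ?thesis using assms by (simp add: rank_eq_card psubset_card_mono)
qed

lemma rank_bounds:
  assumes "1 \<le> i" "i \<le> length \<eta>"
  shows "1 \<le> rank \<eta> i" "rank \<eta> i \<le> length \<eta>"
proof -
  have "i \<in> rank_set \<eta> i" using assms by (simp add: rank_set_def)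
  then show "1 \<le> rank \<eta> i"
    using assms by (simp add: rank_eq_card Suc_le_eq card_gt_0_iff) blast
  have "rank_set \<eta> i \<subseteq> {1..length \<eta>}" by (auto simp: rank_set_def)
  from card_mono[OF _ this] show "rank \<eta> i \<le> length \<eta>" using assms by (simp add: rank_eq_card)
qed

definition spectral :: "nat list \<Rightarrow> nat \<Rightarrow> qt_field" where
  "spectral \<eta> i = qq ^ part \<eta> i * tt powi (1 - int (rank \<eta> i))"

lemma spectral_nonzero [simp]: "spectral \<eta> i \<noteq> 0"
  by (simp add: spectral_def)

lemma spectral_swap:
  assumes "1 \<le> i" "i < length \<eta>" "part \<eta> i \<noteq> part \<eta> (Suc i)" "1 \<le> k" "k \<le> length \<eta>"
  shows "spectral (swap_parts i \<eta>) k = spectral \<eta> (transpose i (Suc i) k)"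
  using assms by (simp add: spectral_def rank_swap_parts part_swap_parts)

lemma spectral_Suc_equal:
  assumes "1 \<le> i" "i < length \<eta>" "part \<eta> i = part \<eta> (Suc i)"
  shows "spectral \<eta> i = tt * spectral \<eta> (Suc i)"
proof -
  have "tt powi (1 - int (rank \<eta> i)) = tt * tt powi (1 - int (Suc (rank \<eta> i)))"
    using power_int_add[of tt 1 "1 - int (Suc (rank \<eta> i))"] by simp
  then show ?thesis using assms rank_Suc_equal[OF assms] by (simp add: spectral_def)
qed

lemma spectral_shift:
  assumes "1 \<le> k" "k < length \<eta>"
  shows "spectral (shift_parts \<eta>) k = spectral \<eta> (Suc k)"
  using assms by (simp add: spectral_def rank_shift_parts part_shift_parts)

lemma spectral_shift_last:
  assumes "\<eta> \<noteq> []"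
  shows "spectral (shift_parts \<eta>) (length \<eta>) = qq * spectral \<eta> 1"
  using assms rank_shift_parts[of "length \<eta>" \<eta>] part_shift_last[OF assms]
  by (simp add: spectral_def Suc_le_eq)

lemma qq_power_tt_power: "qq ^ a * tt ^ k = Fract (monom (monom 1 a) k) 1"
proof -
  have 1: "qq ^ a = Fract [:monom 1 a:] 1"
  proof (induction a)
    case (Suc a)
    then show ?case by (simp add: qq_def monom_Suc monom_0 flip: One_fract_def)
  qed (simp add: One_fract_def one_pCons)
  have 2: "tt ^ k = Fract (monom 1 k) 1"
    by (induction k) (simp_all add: tt_def One_fract_def monom_Suc)
  show ?thesis unfolding 1 2 by (simp add: smult_monom)
qed

lemma qq_tt_powi_eq:
  assumes "qq ^ a * tt powi k = qq ^ b * tt powi l"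
  shows "a = b" "k = l"
proof -
  \<comment> \<open>Multiplication by \<open>tt ^ m\<close> makes both exponents of
    \<open>tt\<close> nonnegative, so that degrees of polynomials can be compared.\<close>
  define m where "m = nat (\<bar>k\<bar> + \<bar>l\<bar>)"
  have pow: "tt powi j * tt ^ m = tt ^ nat (j + int m)" if "0 \<le> j + int m" for j
    using that power_int_add[of tt j "int m"] by (simp flip: power_int_of_nat)
  have k: "tt powi k * tt ^ m = tt ^ nat (k + int m)"
    by (rule pow) (simp add: m_def)
  have l: "tt powi l * tt ^ m = tt ^ nat (l + int m)"
    by (rule pow) (simp add: m_def)
  have "qq ^ a * tt ^ nat (k + int m) = qq ^ b * tt ^ nat (l + int m)"
    unfolding k[symmetric] l[symmetric] mult.assoc[symmetric] assms ..
  then have *: "monom (monom 1 a) (nat (k + int m)) = monom (monom (1::rat) b) (nat (l + int m))"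
    unfolding qq_power_tt_power by (simp add: eq_fract)
  then have "degree (monom (monom (1::rat) a) (nat (k + int m))) = degree (monom (monom (1::rat) b) (nat (l + int m)))"
    by simp
  then have n: "nat (k + int m) = nat (l + int m)" by (simp add: degree_monom_eq)
  then show "k = l" by (simp add: m_def)
  from * n have "monom 1 a = monom (1::rat) b" by simp
  then have "degree (monom (1::rat) a) = degree (monom (1::rat) b)" by simp
  then show "a = b" by (simp add: degree_monom_eq)
qed

text \<open>Simplicity of the joint spectrum: the power of \<open>qq\<close> in an entry already
  determines the part.\<close>

lemma spectral_inj:
  assumes "length \<eta> = length \<nu>" "\<And>i. 1 \<le> i \<Longrightarrow> i \<le> length \<eta> \<Longrightarrow> spectral \<eta> i = spectral \<nu> i"
  shows "\<eta> = \<nu>"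
  using assms(1)
proof (rule composition_eqI)
  fix i assume "1 \<le> i" "i \<le> length \<eta>"
  then have "spectral \<eta> i = spectral \<nu> i" by (rule assms(2))
  then show "part \<eta> i = part \<nu> i" unfolding spectral_def by (rule qq_tt_powi_eq)
qed

lemma spectral_neq:
  assumes "1 \<le> i" "i < length \<eta>"
  shows "spectral \<eta> i \<noteq> spectral \<eta> (Suc i)"
proof
  assume "spectral \<eta> i = spectral \<eta> (Suc i)"
  then have "part \<eta> i = part \<eta> (Suc i)" "rank \<eta> i = rank \<eta> (Suc i)"
    unfolding spectral_def by (auto dest: qq_tt_powi_eq)
  then show False using rank_Suc_equal[OF assms] by simp
qed

text \<open>Used in contrapositive form: at different parts the numerator
  \<open>spectral \<eta> i - tt * spectral \<eta> (Suc i)\<close> of \<open>u_empty_swap\<close> and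
  \<open>coeff_swap\<close> is nonzero.\<close>

lemma spectral_eq_tt_mult:
  assumes "spectral \<eta> i = tt * spectral \<eta> j"
  shows "part \<eta> i = part \<eta> j"
proof -
  have "tt * tt powi (1 - int (rank \<eta> j)) = tt powi (2 - int (rank \<eta> j))"
    using power_int_add[of tt 1 "1 - int (rank \<eta> j)"] by simp
  then have "qq ^ part \<eta> i * tt powi (1 - int (rank \<eta> i)) = qq ^ part \<eta> j * tt powi (2 - int (rank \<eta> j))"
    using assms by (simp add: spectral_def mult.left_commute)
  then show ?thesis by (rule qq_tt_powi_eq)
qed

definition Y_eigen :: "nat list \<Rightarrow> qt_mpoly \<Rightarrow> bool" where
  "Y_eigen \<eta> f \<longleftrightarrow> (\<forall>i. 1 \<le> i \<longrightarrow> i \<le> length \<eta> \<longrightarrow>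
     Y_op (length \<eta>) i f = Const (spectral \<eta> i) * f)"

lemma Y_eigenD: "Y_eigen \<eta> f \<Longrightarrow> length \<eta> = N \<Longrightarrow> 1 \<le> i \<Longrightarrow> i \<le> N \<Longrightarrow> Y_op N i f = Const (spectral \<eta> i) * f"
  by (auto simp: Y_eigen_def)

lemma Y_eigen_scale: "\<eta> \<noteq> [] \<Longrightarrow> Y_eigen \<eta> f \<Longrightarrow> Y_eigen \<eta> (Const c * f)"
  by (auto simp: Y_eigen_def linear_op_scale[OF linear_op_Y] Suc_le_eq mult.left_commute)

lemma tt_T_inv: "Const tt * T_inv i f = T_op i f + (1 - Const tt) * f"
  by (simp add: T_inv_def)

lemma Y_T_eigen:
  assumes "Y_eigen \<eta> f" "length \<eta> = N" "1 \<le> i" "i < N"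
  shows "Y_op N (Suc i) (T_op i f) = Const (spectral \<eta> i) * (T_op i f + (1 - Const tt) * f)"
    and "Y_op N i (T_op i f) =
      Const (spectral \<eta> (Suc i)) * T_op i f + Const ((tt - 1) * spectral \<eta> i) * f"
    and "1 \<le> j \<Longrightarrow> j \<le> N \<Longrightarrow> j \<noteq> i \<Longrightarrow> j \<noteq> Suc i \<Longrightarrow> Y_op N j (T_op i f) = Const (spectral \<eta> j) * T_op i f"
proof -
  let ?y = "spectral \<eta> i" and ?z = "spectral \<eta> (Suc i)"
  have N: "N \<ge> 1" using assms by simp
  note lY = linear_op_Y[OF N]
  have "T_op i (Y_op N (Suc i) (T_op i f)) = Const tt * (Const ?y * f)"
    using T_Y_T[OF assms(3,4)] Y_eigenD[OF assms(1,2), of i] assms by simp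
  then have "Y_op N (Suc i) (T_op i f) = T_inv i (Const tt * (Const ?y * f))"
    by (metis T_inv_T_op)
  also have "\<dots> = Const tt * (Const ?y * T_inv i f)"
    by (simp only: linear_op_scale[OF linear_op_T_inv])
  also have "\<dots> = Const ?y * (T_op i f + (1 - Const tt) * f)"
    unfolding tt_T_inv[symmetric] by (rule mult.left_commute)
  finally show 1: "Y_op N (Suc i) (T_op i f) = Const ?y * (T_op i f + (1 - Const tt) * f)" .
  have Tf: "T_op i (T_op i f + (1 - Const tt) * f) = Const tt * f"
    unfolding linear_op_add[OF linear_op_T] Const_one_minus linear_op_scale[OF linear_op_T] T_op_quadratic
    by (simp add: Const_diff algebra_simps)
  define u where "u = T_op i f + (1 - Const tt) * f"
  have Yf: "Y_op N (Suc i) f = Const ?z * f"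
    using Y_eigenD[OF assms(1,2), of "Suc i"] assms by simp
  \<comment> \<open>\<open>T_Y_T\<close> is applied to \<open>T_op i f\<close>; the quadratic
    relation removes the square of \<open>T_op i\<close>, leaving arguments on which
    \<open>Y_op N (Suc i)\<close> is known.\<close>
  have "Const tt * Y_op N i (T_op i f) = T_op i (Y_op N (Suc i) (Const (tt - 1) * T_op i f + Const tt * f))"
    using T_Y_T[OF assms(3,4), of "T_op i f"] by (simp add: T_op_quadratic Const_one_minus)
  also have "\<dots> = T_op i (Const (tt - 1) * (Const ?y * u) + Const tt * (Const ?z * f))"
    unfolding linear_op_add[OF lY] linear_op_scale[OF lY] 1 Yf u_def ..
  also have "\<dots> = Const (tt - 1) * (Const ?y * (Const tt * f)) + Const tt * (Const ?z * T_op i f)"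
    unfolding linear_op_add[OF linear_op_T] linear_op_scale[OF linear_op_T] Tf[folded u_def] ..
  also have "\<dots> = Const tt * (Const ?z * T_op i f + Const ((tt - 1) * ?y) * f)"
    unfolding Const_mult by algebra
  finally show "Y_op N i (T_op i f) = Const ?z * T_op i f + Const ((tt - 1) * ?y) * f"
    using Const_inverse_tt(3) by metis
  show "Y_op N j (T_op i f) = Const (spectral \<eta> j) * T_op i f" if "1 \<le> j" "j \<le> N" "j \<noteq> i" "j \<noteq> Suc i"
    using T_Y_comm[OF assms(3,4) that, of f] Y_eigenD[OF assms(1,2) that(1,2)]
    by (simp add: linear_op_scale[OF linear_op_T])
qed

text \<open>With \<open>y\<close>, \<open>z\<close> the spectral values at \<open>i\<close> and
  \<open>Suc i\<close>, this is the solution of \<open>y (1 - t) + c z = c y\<close>, the condition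
  for \<open>T_op i f + c f\<close> to be an eigenvector of \<open>Y_op N (Suc i)\<close> with
  eigenvalue \<open>y\<close>.\<close>

definition swap_coeff :: "nat list \<Rightarrow> nat \<Rightarrow> qt_field" where
  "swap_coeff \<eta> i = spectral \<eta> i * (1 - tt) / (spectral \<eta> i - spectral \<eta> (Suc i))"

lemma Y_eigen_swap:
  assumes "Y_eigen \<eta> f" "1 \<le> i" "i < length \<eta>" "part \<eta> i \<noteq> part \<eta> (Suc i)"
  shows "Y_eigen (swap_parts i \<eta>) (T_op i f + Const (swap_coeff \<eta> i) * f)"
  unfolding Y_eigen_def length_swap_parts
proof (intro allI impI)
  fix k assume k: "1 \<le> k" "k \<le> length \<eta>"
  let ?N = "length \<eta>"
  define y where "y = spectral \<eta> i"
  define z where "z = spectral \<eta> (Suc i)"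
  define c where "c = swap_coeff \<eta> i"
  have "y - z \<noteq> 0" using spectral_neq[OF assms(2,3)] by (simp add: y_def z_def)
  then have c: "c * (y - z) = y * (1 - tt)" by (simp add: c_def swap_coeff_def y_def z_def)
  have N: "?N \<ge> 1" using assms by simp
  note lY = linear_op_add[OF linear_op_Y[OF N]] linear_op_scale[OF linear_op_Y[OF N]]
  note Y = Y_T_eigen[OF assms(1) refl assms(2,3)]
  note E = Y_eigenD[OF assms(1) refl]
  have Cc: "Const c * (Const y - Const z) = Const y * (1 - Const tt)"
    using arg_cong[OF c, of Const] by (simp add: Const_mult Const_diff)
  consider "k = i" | "k = Suc i" | "k \<noteq> i" "k \<noteq> Suc i" by blast
  then show "Y_op ?N k (T_op i f + Const (swap_coeff \<eta> i) * f) =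
      Const (spectral (swap_parts i \<eta>) k) * (T_op i f + Const (swap_coeff \<eta> i) * f)"
  proof cases
    case 1
    have "Const (z) * T_op i f + Const ((tt - 1) * y) * f + Const c * (Const y * f) =
        Const z * (T_op i f + Const c * f)"
      using Cc unfolding Const_mult Const_diff Const_one by algebra
    then show ?thesis using 1 k E[of i] assms
      unfolding spectral_swap[OF assms(2,3,4) k] lY by (simp add: Y(2) c_def y_def z_def)
  next
    case 2
    have "Const y * (T_op i f + (1 - Const tt) * f) + Const c * (Const z * f) =
        Const y * (T_op i f + Const c * f)"
      using Cc by algebra
    then show ?thesis using 2 k E[of "Suc i"] assms
      unfolding spectral_swap[OF assms(2,3,4) k] lY by (simp add: Y(1) c_def y_def z_def)
  next
    case 3
    then show ?thesis using k E[of k] assms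
      unfolding spectral_swap[OF assms(2,3,4) k] lY by (simp add: Y(3) algebra_simps)
  qed
qed

lemma Y_eigen_shift:
  assumes "Y_eigen \<eta> f" "\<eta> \<noteq> []"
  shows "Y_eigen (shift_parts \<eta>) (Phi (length \<eta>) f)"
  unfolding Y_eigen_def length_shift_parts[OF assms(2)]
proof (intro allI impI)
  fix k assume k: "1 \<le> k" "k \<le> length \<eta>"
  let ?N = "length \<eta>"
  have N: "?N \<ge> 1" using k by simp
  show "Y_op ?N k (Phi ?N f) = Const (spectral (shift_parts \<eta>) k) * Phi ?N f"
  proof (cases "k = ?N")
    case True
    have "Y_op ?N 1 f = Const (spectral \<eta> 1) * f"
      by (rule Y_eigenD[OF assms(1) refl _ N]) simp
    then show ?thesis
      unfolding True Y_Phi_last[OF N] spectral_shift_last[OF assms(2)] Const_mult mult.assoc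
      by (simp only: linear_op_scale[OF linear_op_Phi[OF N]])
  next
    case False
    then have k': "1 \<le> k" "k < ?N" using k by auto
    have "Y_op ?N (Suc k) f = Const (spectral \<eta> (Suc k)) * f"
      by (rule Y_eigenD[OF assms(1) refl]) (use k' in auto)
    then show ?thesis
      unfolding Y_Phi[OF k'] spectral_shift[OF k']
      by (simp only: linear_op_scale[OF linear_op_Phi[OF N]])
  qed
qed

lemma T_op_Const: "T_op i (Const c) = Const (tt * c)"
  using linear_op_scale[OF linear_op_T, of i c 1] by (simp add: T_op_one Const_mult mult.commute)

lemma T_inv_Const: "T_inv i (Const c) = Const (inverse tt * c)"
  by (simp add: T_inv_def T_op_Const Const_mult Const_diff algebra_simps)

lemma Y_eigen_one: "Y_eigen (replicate N 0) 1"
  unfolding Y_eigen_def length_replicate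
proof (intro allI impI)
  fix i assume i: "1 \<le> i" "i \<le> N"
  have up: "foldr T_op is (Const c) = Const (tt ^ length is * c)" for "is" c
    by (induction "is") (auto simp: T_op_Const mult.assoc)
  have down: "foldr T_inv is (Const c) = Const (inverse tt ^ length is * c)" for "is" c
    by (induction "is") (auto simp: T_inv_Const mult.assoc)
  have "rank_set (replicate N 0) i = {1..i}"
    using i by (auto simp: rank_set_def part_def)
  then have r: "rank (replicate N 0) i = i" using i by (simp add: rank_eq_card)
  have "Y_op N i (Const 1) = Const (tt powi (int i - int N) * (tt ^ (N - i) * inverse tt ^ (i - 1)))"
    using i unfolding Y_op_eq down omega_op_eq[OF order.trans[OF i]] substitute_Const up
    by (simp flip: Const_mult)
  also have "tt powi (int i - int N) * (tt ^ (N - i) * inverse tt ^ (i - 1)) = tt powi (1 - int i)"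
  proof -
    have "tt ^ (N - i) = tt powi (int N - int i)" using i by (simp flip: power_int_of_nat add: of_nat_diff)
    moreover have "inverse tt ^ (i - 1) = tt powi (1 - int i)"
    proof -
      have "tt ^ (i - 1) = tt powi (int i - 1)" using i by (simp flip: power_int_of_nat add: of_nat_diff)
      then show ?thesis using power_int_minus[of tt "int i - 1"] by (simp add: power_inverse)
    qed
    ultimately show ?thesis by (simp flip: mult.assoc power_int_add)
  qed
  finally show "Y_op N i 1 = Const (spectral (replicate N 0) i) * 1"
    using i by (simp add: spectral_def r part_def)
qed

section \<open>Existence of the non-symmetric polynomials\<close>

lemma u_empty_add: "u_empty (f + g) = u_empty f + u_empty g"
  and u_empty_scale: "u_empty (Const c * f) = c * u_empty f"
  and u_empty_one: "u_empty 1 = 1"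
  by (simp_all add: u_empty_def evaluate_add evaluate_mult)

lemma evaluate_T_op:
  "(x i - x (Suc i)) * evaluate x (T_op i f) =
    (tt * x i - x (Suc i)) * evaluate (\<lambda>k. x (transpose i (Suc i) k)) f + (1 - tt) * x (Suc i) * evaluate x f"
  using arg_cong[OF T_op_eq[of i f], of "evaluate x"]
  by (simp add: evaluate_mult evaluate_diff evaluate_add K_op_def evaluate_substitute)

lemma tt_powi_Suc: "tt powi (k + 1) = tt * tt powi k"
  by (simp add: power_int_add)

lemma tt_power_eq_iff: "tt powi k = tt powi l \<longleftrightarrow> k = l"
  using qq_tt_powi_eq(2)[of 0 k 0 l] by auto

lemma tt_neq_one: "tt \<noteq> 1"
  using tt_power_eq_iff[of 1 0] by simp

text \<open>At this point \<open>tt * x i = x (Suc i)\<close>, so the term of \<open>T_op i\<close>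
  that contains \<open>K i\<close> vanishes.\<close>

lemma u_empty_T_op:
  assumes "1 \<le> i"
  shows "u_empty (T_op i f) = tt * u_empty f"
proof -
  let ?x = "\<lambda>i. tt powi (int i - 1)"
  have s: "?x (Suc i) = tt * ?x i" using tt_powi_Suc[of "int i - 1"] by simp
  have "(?x i - ?x (Suc i)) * u_empty (T_op i f) = (1 - tt) * ?x (Suc i) * u_empty f"
    using evaluate_T_op[of ?x i f] s by (simp add: u_empty_def)
  then have "((1 - tt) * ?x i) * u_empty (T_op i f) = ((1 - tt) * ?x i) * (tt * u_empty f)"
    unfolding s by (simp add: algebra_simps)
  moreover have "(1 - tt) * ?x i \<noteq> 0" using tt_neq_one by simp
  ultimately show ?thesis using mult_left_cancel by blast
qed

lemma u_empty_foldr_T_op: "(\<And>i. i \<in> set is \<Longrightarrow> 1 \<le> i) \<Longrightarrow> u_empty (foldr T_op is f) = tt ^ length is * u_empty f"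
  by (induction "is") (simp_all add: u_empty_T_op)

text \<open>\<open>u_empty\<close> turns the Hecke operators in the eigenvalue equation of
  \<open>Y_op N 1\<close> into scalars, so that equation yields the value of the shifted
  polynomial.\<close>

lemma u_empty_Phi:
  assumes "Y_eigen \<eta> f" "\<eta> \<noteq> []"
  shows "u_empty (Phi (length \<eta>) f) = tt powi (int (length \<eta>) - 1) * (spectral \<eta> 1 * u_empty f)"
proof -
  let ?N = "length \<eta>"
  have N: "?N \<ge> 1" using assms(2) by (simp add: Suc_le_eq)
  have up: "u_empty (T_up 1 ?N g) = tt ^ (?N - 1) * u_empty g" for g
    using u_empty_foldr_T_op[of "[1..<?N]" g] by simp
  have "Const (tt powi (1 - int ?N)) * T_up 1 ?N (omega_op ?N f) = Const (spectral \<eta> 1) * f"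
    using Y_eigenD[OF assms(1) refl _ N] by (simp add: Y_op_eq)
  from arg_cong[OF this, of u_empty]
  have "tt powi (1 - int ?N) * (tt ^ (?N - 1) * u_empty (omega_op ?N f)) = spectral \<eta> 1 * u_empty f"
    unfolding u_empty_scale up .
  moreover have "tt powi (1 - int ?N) * tt ^ (?N - 1) = 1"
  proof -
    have "tt ^ (?N - 1) = tt powi (int ?N - 1)" using N by (simp flip: power_int_of_nat add: of_nat_diff)
    then show ?thesis by (simp flip: power_int_add)
  qed
  ultimately have "u_empty (omega_op ?N f) = spectral \<eta> 1 * u_empty f"
    by (simp flip: mult.assoc)
  then show ?thesis by (simp add: Phi_def u_empty_def evaluate_mult)
qed

definition macdonald_like :: "nat list \<Rightarrow> qt_mpoly \<Rightarrow> bool" where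
  "macdonald_like \<eta> f \<longleftrightarrow> Y_eigen \<eta> f \<and> f - monomial \<eta> \<in> strict_span \<eta> \<and> u_empty f \<noteq> 0"

lemma monomial_zero: "monomial (replicate N 0) = 1"
  unfolding monomial_def by (rule prod.neutral) (auto simp: part_def)

lemma Phi_monomial:
  assumes "\<nu> \<noteq> []"
  shows "Phi (length \<nu>) (monomial \<nu>) = Const (qq ^ part \<nu> 1) * monomial (shift_parts \<nu>)"
proof -
  let ?N = "length \<nu>"
  have N: "?N \<ge> 1" using assms by (simp add: Suc_le_eq)
  then obtain n where n: "?N = Suc n" by (cases ?N) auto
  have "omega_op ?N (monomial \<nu>) = (\<Prod>k\<in>{1..Suc n}. cyclic_var ?N k ^ part \<nu> k)"
    unfolding omega_op_eq[OF N] monomial_def substitute_prod substitute_power substitute_Var unfolding n ..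
  also have "\<dots> = cyclic_var ?N 1 ^ part \<nu> 1 * (\<Prod>k\<in>{Suc 1..Suc n}. cyclic_var ?N k ^ part \<nu> k)"
    by (subst prod.atLeast_Suc_atMost) auto
  also have "(\<Prod>k\<in>{Suc 1..Suc n}. cyclic_var ?N k ^ part \<nu> k) = (\<Prod>k\<in>{1..n}. Var k ^ part \<nu> (Suc k))"
    unfolding prod.shift_bounds_cl_Suc_ivl by (rule prod.cong) (auto simp: cyclic_var_def n)
  also have "\<dots> = (\<Prod>k\<in>{1..n}. Var k ^ part (shift_parts \<nu>) k)"
    by (rule prod.cong) (auto simp: part_shift_parts n)
  also have "cyclic_var ?N 1 = Const qq * Var (Suc n)" by (simp add: cyclic_var_def n)
  finally have "omega_op ?N (monomial \<nu>) = Const qq ^ part \<nu> 1 *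
      (Var (Suc n) ^ part \<nu> 1 * (\<Prod>k\<in>{1..n}. Var k ^ part (shift_parts \<nu>) k))"
    by (simp add: power_mult_distrib mult_ac)
  moreover have "monomial (shift_parts \<nu>) =
      (\<Prod>k\<in>{1..n}. Var k ^ part (shift_parts \<nu>) k) * Var (Suc n) ^ Suc (part \<nu> 1)"
    using assms part_shift_last[OF assms] by (simp add: monomial_def n)
  moreover have "Const qq ^ k = Const (qq ^ k)" for k
    by (induction k) (simp_all add: Const_mult)
  ultimately show ?thesis by (simp add: Phi_def n mult_ac)
qed

lemma macdonald_like_shift:
  assumes "macdonald_like \<eta> f" "\<eta> \<noteq> []"
  shows "macdonald_like (shift_parts \<eta>) (Const (inverse (qq ^ part \<eta> 1)) * Phi (length \<eta>) f)"
proof -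
  let ?c = "inverse (qq ^ part \<eta> 1)" and ?N = "length \<eta>"
  have N: "?N \<ge> 1" using assms(2) by (simp add: Suc_le_eq)
  have c: "Const ?c * (Const (qq ^ part \<eta> 1) * g) = g" for g
    by (simp flip: Const_mult mult.assoc)
  have E: "Y_eigen \<eta> f" and S: "f - monomial \<eta> \<in> strict_span \<eta>" and u: "u_empty f \<noteq> 0"
    using assms by (auto simp: macdonald_like_def)
  have ne: "shift_parts \<eta> \<noteq> []" by (simp add: shift_parts_def)
  have "Phi ?N (f - monomial \<eta>) \<in> strict_span (shift_parts \<eta>)"
    unfolding strict_span_def
  proof (rule linear_op_span[OF linear_op_Phi[OF N] _ S[unfolded strict_span_def]])
    fix b assume "b \<in> monomial ` {\<nu>. below \<nu> \<eta>}"
    then obtain \<nu> where \<nu>: "b = monomial \<nu>" "below \<nu> \<eta>" by blast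
    then have len: "length \<nu> = ?N" by (simp add: length_below)
    then have "\<nu> \<noteq> []" using assms(2) by auto
    then have "Phi ?N b = Const (qq ^ part \<nu> 1) * monomial (shift_parts \<nu>)"
      using Phi_monomial[of \<nu>] \<nu> len by simp
    moreover have "below (shift_parts \<nu>) (shift_parts \<eta>)" using below_shift[OF \<nu>(2) assms(2)] .
    ultimately show "Phi ?N b \<in> mpoly.span (monomial ` {\<nu>. below \<nu> (shift_parts \<eta>)})"
      by (simp add: mpoly.span_scale mpoly.span_base)
  qed
  then have "Const ?c * Phi ?N (f - monomial \<eta>) \<in> strict_span (shift_parts \<eta>)"
    unfolding strict_span_def by (rule mpoly.span_scale)
  then have "Const ?c * Phi ?N f - monomial (shift_parts \<eta>) \<in> strict_span (shift_parts \<eta>)"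
    unfolding linear_op_diff[OF linear_op_Phi[OF N]] Phi_monomial[OF assms(2)] right_diff_distrib c .
  moreover have "Y_eigen (shift_parts \<eta>) (Const ?c * Phi ?N f)"
    by (rule Y_eigen_scale[OF ne Y_eigen_shift[OF E assms(2)]])
  moreover have "u_empty (Const ?c * Phi ?N f) \<noteq> 0"
    using u by (simp add: u_empty_scale u_empty_Phi[OF E assms(2)])
  ultimately show ?thesis by (simp add: macdonald_like_def)
qed

lemma T_op_strict_span:
  assumes "f \<in> strict_span \<eta>" "1 \<le> i" "i < length \<eta>" "part \<eta> i < part \<eta> (Suc i)"
  shows "T_op i f \<in> strict_span (swap_parts i \<eta>)"
  unfolding strict_span_def
proof (rule linear_op_span[OF linear_op_T _ assms(1)[unfolded strict_span_def]])
  fix b assume "b \<in> monomial ` {\<nu>. below \<nu> \<eta>}"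
  then obtain \<nu> where b: "b = monomial \<nu>" and \<nu>: "below \<nu> \<eta>" by blast
  have i: "1 \<le> i" "i < length \<nu>" using assms length_below[OF \<nu>] by auto
  note m = below_swap_max[OF \<nu> assms(2-4)]
  let ?a = "if part \<nu> i < part \<nu> (Suc i) then Const tt * monomial (swap_parts i \<nu>) else 0"
  let ?\<kappa> = "if part \<nu> i < part \<nu> (Suc i) then \<nu> else swap_parts i \<nu>"
  have "below_eq ?\<kappa> (swap_max i \<nu>)"
    using below_eq_swap_max[OF i] by (simp add: swap_max_def split: if_splits)
  then have "below ?\<kappa> (swap_parts i \<eta>)" using m by (rule rtranclp_tranclp_tranclp)
  then have "T_op i b - ?a \<in> strict_span (swap_parts i \<eta>)"
    unfolding b by (intro subsetD[OF below_span_subset_strict T_op_monomial[OF i]])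
  moreover have "?a \<in> strict_span (swap_parts i \<eta>)"
  proof (cases "part \<nu> i < part \<nu> (Suc i)")
    case True
    then show ?thesis using m by (simp add: swap_max_def strict_span_def mpoly.span_scale mpoly.span_base)
  next
    case False
    then show ?thesis by (simp add: strict_span_def mpoly.span_zero)
  qed
  ultimately have "T_op i b - ?a + ?a \<in> strict_span (swap_parts i \<eta>)"
    unfolding strict_span_def by (rule mpoly.span_add)
  then show "T_op i b \<in> mpoly.span (monomial ` {\<nu>. below \<nu> (swap_parts i \<eta>)})"
    unfolding strict_span_def diff_add_cancel .
qed

lemma u_empty_swap:
  assumes "1 \<le> i" "i < length \<eta>"
  shows "u_empty (T_op i f + Const (swap_coeff \<eta> i) * f) * (spectral \<eta> i - spectral \<eta> (Suc i)) =
    (spectral \<eta> i - tt * spectral \<eta> (Suc i)) * u_empty f"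
proof -
  have ne: "spectral \<eta> i - spectral \<eta> (Suc i) \<noteq> 0" using spectral_neq[OF assms] by simp
  then have "swap_coeff \<eta> i * (spectral \<eta> i - spectral \<eta> (Suc i)) = spectral \<eta> i * (1 - tt)"
    by (simp add: swap_coeff_def)
  then show ?thesis
    using assms by (simp add: u_empty_add u_empty_scale u_empty_T_op) algebra
qed

text \<open>\<open>inverse tt\<close> cancels the leading coefficient in
  \<open>T_op_monomial\<close>. The value under \<open>u_empty\<close> stays nonzero because parts
  \<open>i\<close> and \<open>Suc i\<close> differ.\<close>

lemma macdonald_like_swap:
  assumes "macdonald_like \<eta> f" "1 \<le> i" "i < length \<eta>" "part \<eta> i < part \<eta> (Suc i)"
  shows "macdonald_like (swap_parts i \<eta>) (Const (inverse tt) * (T_op i f + Const (swap_coeff \<eta> i) * f))"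
proof -
  let ?c = "swap_coeff \<eta> i" and ?S = "strict_span (swap_parts i \<eta>)"
  have E: "Y_eigen \<eta> f" and S: "f - monomial \<eta> \<in> strict_span \<eta>" and u: "u_empty f \<noteq> 0"
    using assms by (auto simp: macdonald_like_def)
  have lt: "below \<eta> (swap_parts i \<eta>)" using step_below_swap_self[OF assms(2-4)] by auto
  have sub: "below_span \<eta> \<subseteq> ?S" by (rule below_span_subset_strict[OF lt])
  have ne: "swap_parts i \<eta> \<noteq> []" using assms by (metis length_swap_parts less_zeroE list.size(3))
  have 1: "T_op i (monomial \<eta>) - Const tt * monomial (swap_parts i \<eta>) \<in> ?S"
    using T_op_monomial[OF assms(2,3)] assms(4) sub by auto
  have 2: "T_op i (f - monomial \<eta>) \<in> ?S" by (rule T_op_strict_span[OF S assms(2-4)])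
  have "f - monomial \<eta> + monomial \<eta> \<in> below_span \<eta>"
    using subsetD[OF strict_span_subset S] below_span_base[of \<eta> \<eta>] unfolding below_span_def
    by (intro mpoly.span_add) auto
  then have 3: "f \<in> ?S" using sub by auto
  have "Const (inverse tt) * (T_op i f + Const ?c * f) - monomial (swap_parts i \<eta>) =
    Const (inverse tt) * ((T_op i (monomial \<eta>) - Const tt * monomial (swap_parts i \<eta>)) +
      T_op i (f - monomial \<eta>) + Const ?c * f)"
    by (simp add: linear_op_diff[OF linear_op_T] algebra_simps)
  also have "\<dots> \<in> ?S"
    using 1 2 3 unfolding strict_span_def by (intro mpoly.span_scale mpoly.span_add)
  finally have "Const (inverse tt) * (T_op i f + Const ?c * f) - monomial (swap_parts i \<eta>) \<in> ?S" .
  moreover have "Y_eigen (swap_parts i \<eta>) (Const (inverse tt) * (T_op i f + Const ?c * f))"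
    by (rule Y_eigen_scale[OF ne Y_eigen_swap]) (use assms E in auto)
  moreover have "u_empty (T_op i f + Const ?c * f) \<noteq> 0"
  proof -
    have "spectral \<eta> i \<noteq> tt * spectral \<eta> (Suc i)" using spectral_eq_tt_mult[of \<eta> i "Suc i"] assms by auto
    then have "(spectral \<eta> i - tt * spectral \<eta> (Suc i)) * u_empty f \<noteq> 0" using u by simp
    then show ?thesis unfolding u_empty_swap[OF assms(2,3), symmetric] by auto
  qed
  ultimately show ?thesis by (simp add: macdonald_like_def u_empty_scale)
qed

lemma macdonald_like_zero: "macdonald_like (replicate N 0) 1"
  by (simp add: macdonald_like_def Y_eigen_one monomial_zero strict_span_def mpoly.span_zero u_empty_one)

lemma macdonald_like_exists:
  assumes "N \<ge> 1" "length \<eta> = N"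
  shows "\<exists>f. macdonald_like \<eta> f"
  using assms
proof (induction \<eta> rule: composition_induct)
  case zero
  then show ?case using macdonald_like_zero by blast
next
  case (shift \<eta>)
  then have "\<eta> \<noteq> []" using assms(1) by auto
  then show ?case using shift macdonald_like_shift by blast
next
  case (swap \<eta> i)
  then show ?case using macdonald_like_swap by blast
qed

definition E_poly :: "nat list \<Rightarrow> qt_mpoly" where
  "E_poly \<eta> = (SOME f. macdonald_like \<eta> f)"

lemma macdonald_like_E_poly:
  assumes "\<eta> \<noteq> []"
  shows "macdonald_like \<eta> (E_poly \<eta>)"
proof -
  have "length \<eta> \<ge> 1" using assms by (simp add: Suc_le_eq)
  from macdonald_like_exists[OF this refl] show ?thesis
    unfolding E_poly_def by (rule someI_ex)
qed

lemma Y_eigen_E_poly: "\<eta> \<noteq> [] \<Longrightarrow> Y_eigen \<eta> (E_poly \<eta>)"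
  and u_empty_E_poly: "\<eta> \<noteq> [] \<Longrightarrow> u_empty (E_poly \<eta>) \<noteq> 0"
  and E_poly_triangular: "\<eta> \<noteq> [] \<Longrightarrow> E_poly \<eta> - monomial \<eta> \<in> strict_span \<eta>"
  using macdonald_like_E_poly by (auto simp: macdonald_like_def)

section \<open>Joint eigenvectors\<close>

lemma square_sum_less:
  fixes a b c d :: nat
  assumes "c + d = a + b" "max c d < max a b"
  shows "c ^ 2 + d ^ 2 < a ^ 2 + b ^ 2"
proof -
  have *: "c ^ 2 + d ^ 2 < a ^ 2 + b ^ 2"
    if "c + d = a + b" "max c d < a" "b \<le> a" for a b c d :: nat
  proof -
    define k where "k = a - c"
    have k: "a = c + k" "d = b + k" "k > 0" using that by (auto simp: k_def)
    have "b < c" using that k by simp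
    then have "b * k < c * k" using k by simp
    moreover have "c ^ 2 + (b + k) ^ 2 + 2 * (c * k) = (c + k) ^ 2 + b ^ 2 + 2 * (b * k)"
      by (simp add: power2_eq_square algebra_simps)
    ultimately show ?thesis unfolding k by linarith
  qed
  show ?thesis using *[of c d a b] *[of c d b a] assms
    by (cases "b \<le> a") (auto simp: max_def add.commute split: if_splits)
qed

lemma sum_two_terms:
  fixes g :: "nat \<Rightarrow> nat"
  assumes "1 \<le> i" "i < j" "j \<le> n"
  shows "(\<Sum>k\<in>{1..n}. g k) = g i + g j + (\<Sum>k\<in>{1..n} - {i, j}. g k)"
proof -
  have "{1..n} = insert i (insert j ({1..n} - {i, j}))" using assms by auto
  then have "(\<Sum>k\<in>{1..n}. g k) = (\<Sum>k\<in>insert i (insert j ({1..n} - {i, j})). g k)" by simp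
  also have "\<dots> = g i + (g j + (\<Sum>k\<in>{1..n} - {i, j}. g k))"
    using assms by (subst sum.insert) auto
  finally show ?thesis by simp
qed

text \<open>A drop of the maximum lowers \<open>square_sum\<close>; a swap preserves it and lowers
  \<open>weight_sum\<close>, which weights earlier positions more. The pair therefore proves
  \<open>below\<close> well-founded, and \<open>square_sum\<close> later certifies that a dominance
  relation is strict.\<close>

definition square_sum :: "nat list \<Rightarrow> nat" where
  "square_sum \<eta> = (\<Sum>k\<in>{1..length \<eta>}. part \<eta> k ^ 2)"

definition weight_sum :: "nat list \<Rightarrow> nat" where
  "weight_sum \<eta> = (\<Sum>k\<in>{1..length \<eta>}. (length \<eta> - k) * part \<eta> k)"

lemma step_below_cases:
  assumes "step_below \<nu> \<eta>"
  shows "square_sum \<nu> < square_sum \<eta> \<or> square_sum \<nu> = square_sum \<eta> \<and> weight_sum \<nu> < weight_sum \<eta>"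
proof -
  let ?N = "length \<eta>"
  from assms(1) obtain i j where len: "length \<nu> = ?N" and ij: "1 \<le> i" "i < j" "j \<le> ?N"
    and same: "\<And>k. 1 \<le> k \<Longrightarrow> k \<le> ?N \<Longrightarrow> k \<noteq> i \<Longrightarrow> k \<noteq> j \<Longrightarrow> part \<nu> k = part \<eta> k"
    and sum: "part \<nu> i + part \<nu> j = part \<eta> i + part \<eta> j"
    and cases: "max (part \<nu> i) (part \<nu> j) < max (part \<eta> i) (part \<eta> j) \<or>
      part \<nu> i = part \<eta> j \<and> part \<nu> j = part \<eta> i \<and> part \<eta> j < part \<eta> i"
    by (auto simp: step_below_def)
  have s: "(\<Sum>k\<in>{1..?N} - {i, j}. part \<nu> k ^ 2) = (\<Sum>k\<in>{1..?N} - {i, j}. part \<eta> k ^ 2)"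
    by (rule sum.cong) (auto simp: same)
  have w: "(\<Sum>k\<in>{1..?N} - {i, j}. (?N - k) * part \<nu> k) = (\<Sum>k\<in>{1..?N} - {i, j}. (?N - k) * part \<eta> k)"
    by (rule sum.cong) (auto simp: same)
  from cases show ?thesis
  proof
    assume "max (part \<nu> i) (part \<nu> j) < max (part \<eta> i) (part \<eta> j)"
    from square_sum_less[OF sum this] show ?thesis
      unfolding square_sum_def len sum_two_terms[OF ij] s by simp
  next
    assume sw: "part \<nu> i = part \<eta> j \<and> part \<nu> j = part \<eta> i \<and> part \<eta> j < part \<eta> i"
    define k where "k = part \<eta> i - part \<eta> j"
    have k: "part \<eta> i = part \<eta> j + k" "k > 0" using sw by (auto simp: k_def)
    have "(?N - j) * k < (?N - i) * k" using ij k by simp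
    then have "(?N - i) * part \<eta> j + (?N - j) * part \<eta> i < (?N - i) * part \<eta> i + (?N - j) * part \<eta> j"
      unfolding k by (simp add: algebra_simps)
    then show ?thesis using sw
      unfolding square_sum_def weight_sum_def len sum_two_terms[OF ij] s w by simp
  qed
qed

lemma wfp_below: "wfp below"
proof -
  have "wf (inv_image (less_than <*lex*> less_than) (\<lambda>\<eta>. (square_sum \<eta>, weight_sum \<eta>)))" by auto
  then have "wfp step_below"
    unfolding wfp_def by (rule wf_subset) (auto dest: step_below_cases)
  then show ?thesis by (rule wfp_tranclp)
qed

text \<open>The polynomials in the variables 1 to \<open>N\<close>, inside a ring with infinitely
  many variables.\<close>

definition comps_span :: "nat \<Rightarrow> qt_mpoly set" where
  "comps_span N = mpoly.span (monomial ` {\<nu>. length \<nu> = N})"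

lemma comps_span_add: "f \<in> comps_span N \<Longrightarrow> g \<in> comps_span N \<Longrightarrow> f + g \<in> comps_span N"
  and comps_span_scale: "f \<in> comps_span N \<Longrightarrow> Const c * f \<in> comps_span N"
  and comps_span_monomial: "length \<nu> = N \<Longrightarrow> monomial \<nu> \<in> comps_span N"
  and comps_span_zero: "0 \<in> comps_span N"
  and comps_span_diff: "f \<in> comps_span N \<Longrightarrow> g \<in> comps_span N \<Longrightarrow> f - g \<in> comps_span N"
  unfolding comps_span_def
  by (auto intro: mpoly.span_add mpoly.span_scale mpoly.span_base mpoly.span_zero mpoly.span_diff)

lemma below_span_subset_comps: "length \<eta> = N \<Longrightarrow> below_span \<eta> \<subseteq> comps_span N"
  unfolding below_span_def comps_span_def by (rule mpoly.span_mono) (auto dest: length_below_eq)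

lemma E_poly_comps_span:
  assumes "\<eta> \<noteq> []"
  shows "E_poly \<eta> \<in> comps_span (length \<eta>)"
proof -
  have "E_poly \<eta> - monomial \<eta> \<in> comps_span (length \<eta>)"
    using E_poly_triangular[OF assms] strict_span_subset below_span_subset_comps[OF refl] by blast
  from comps_span_add[OF this comps_span_monomial[OF refl]] show ?thesis by simp
qed

lemma T_op_comps_span:
  assumes "f \<in> comps_span N" "1 \<le> i" "i < N"
  shows "T_op i f \<in> comps_span N"
  unfolding comps_span_def
proof (rule linear_op_span[OF linear_op_T _ assms(1)[unfolded comps_span_def]])
  fix b assume "b \<in> monomial ` {\<nu>. length \<nu> = N}"
  then obtain \<nu> where b: "b = monomial \<nu>" and \<nu>: "length \<nu> = N" by blast
  have i: "i < length \<nu>" using \<nu> assms by simp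
  let ?a = "if part \<nu> i < part \<nu> (Suc i) then Const tt * monomial (swap_parts i \<nu>) else 0"
  have "Const tt * monomial (swap_parts i \<nu>) \<in> comps_span N"
    by (intro comps_span_scale comps_span_monomial) (simp add: \<nu>)
  then have a: "?a \<in> comps_span N" by (simp add: comps_span_zero)
  have "T_op i b - ?a \<in> comps_span N"
    unfolding b by (rule subsetD[OF below_span_subset_comps T_op_monomial[OF assms(2) i]]) (use \<nu> in auto)
  from comps_span_add[OF this a] show "T_op i b \<in> mpoly.span (monomial ` {\<nu>. length \<nu> = N})"
    unfolding comps_span_def diff_add_cancel .
qed

lemma T_inv_comps_span: "f \<in> comps_span N \<Longrightarrow> 1 \<le> i \<Longrightarrow> i < N \<Longrightarrow> T_inv i f \<in> comps_span N"
  unfolding T_inv_def Const_one_minus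
  by (intro comps_span_scale comps_span_add T_op_comps_span)

lemma foldr_T_inv_comps_span:
  "(\<And>i. i \<in> set is \<Longrightarrow> 1 \<le> i \<and> i < N) \<Longrightarrow> f \<in> comps_span N \<Longrightarrow> foldr T_inv is f \<in> comps_span N"
  by (induction "is") (auto intro: T_inv_comps_span)

lemma evaluate_cong_comps:
  assumes "f \<in> comps_span N" "\<And>i. 1 \<le> i \<Longrightarrow> i \<le> N \<Longrightarrow> x i = y i"
  shows "evaluate x f = evaluate y f"
  using assms(1) unfolding comps_span_def
proof (induction f rule: mpoly.span_induct_alt)
  case base
  show ?case by simp
next
  case (step c b f)
  then obtain \<nu> where b: "b = monomial \<nu>" "length \<nu> = N" by blast
  have "evaluate x b = evaluate y b"
    unfolding b monomial_def evaluate_prod evaluate_power evaluate_Var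
    by (rule prod.cong) (use b assms in auto)
  then show ?case using step by (simp add: evaluate_add evaluate_mult)
qed

text \<open>Well-founded induction inverts the triangular expansion of \<open>E_poly \<eta>\<close>:
  the monomials below \<eta> are already in the span.\<close>

lemma monomial_in_E_span:
  assumes "\<eta> \<noteq> []" "length \<eta> = N"
  shows "monomial \<eta> \<in> mpoly.span (E_poly ` {\<nu>. length \<nu> = N})"
  using wfp_below assms
proof (induction \<eta> rule: wfp_induct_rule)
  case (less \<eta>)
  have "strict_span \<eta> \<subseteq> mpoly.span (E_poly ` {\<nu>. length \<nu> = N})"
    unfolding strict_span_def
  proof (rule mpoly.span_minimal)
    show "monomial ` {\<nu>. below \<nu> \<eta>} \<subseteq> mpoly.span (E_poly ` {\<nu>. length \<nu> = N})"
    proof clarify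
      fix \<nu> assume \<nu>: "below \<nu> \<eta>"
      then have "length \<nu> = length \<eta>" by (rule length_below)
      then show "monomial \<nu> \<in> mpoly.span (E_poly ` {\<nu>. length \<nu> = N})"
        using less \<nu> by (metis length_0_conv)
    qed
  qed simp
  then have "E_poly \<eta> - monomial \<eta> \<in> mpoly.span (E_poly ` {\<nu>. length \<nu> = N})"
    using E_poly_triangular less by blast
  moreover have "E_poly \<eta> \<in> mpoly.span (E_poly ` {\<nu>. length \<nu> = N})"
    using less by (auto intro: mpoly.span_base)
  ultimately have "E_poly \<eta> - (E_poly \<eta> - monomial \<eta>) \<in> mpoly.span (E_poly ` {\<nu>. length \<nu> = N})"
    by (rule mpoly.span_diff[rotated])
  then show ?case by simp
qed

lemma span_image_expansion:
  assumes "f \<in> mpoly.span (e ` A)"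
  shows "\<exists>S c. finite S \<and> S \<subseteq> A \<and> f = (\<Sum>\<nu>\<in>S. Const (c \<nu>) * e \<nu>)"
  using assms
proof (induction f rule: mpoly.span_induct_alt)
  case base
  show ?case by (rule exI[of _ "{}"]) simp
next
  case (step a b f)
  then obtain \<eta> S c where \<eta>: "b = e \<eta>" "\<eta> \<in> A" and S: "finite S" "S \<subseteq> A"
    and f: "f = (\<Sum>\<nu>\<in>S. Const (c \<nu>) * e \<nu>)" by auto
  define d where "d = (\<lambda>\<nu>. (if \<nu> \<in> S then c \<nu> else 0) + (if \<nu> = \<eta> then a else 0))"
  have "f = (\<Sum>\<nu>\<in>insert \<eta> S. Const (if \<nu> \<in> S then c \<nu> else 0) * e \<nu>)"
    unfolding f using S(1) by (intro sum.mono_neutral_cong_left) auto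
  moreover have "Const a * b = (\<Sum>\<nu>\<in>insert \<eta> S. Const (if \<nu> = \<eta> then a else 0) * e \<nu>)"
  proof -
    have "(\<Sum>\<nu>\<in>insert \<eta> S. Const (if \<nu> = \<eta> then a else 0) * e \<nu>) =
      (\<Sum>\<nu>\<in>{\<eta>}. Const (if \<nu> = \<eta> then a else 0) * e \<nu>)"
      using S(1) by (intro sum.mono_neutral_right) auto
    then show ?thesis by (simp add: \<eta>)
  qed
  ultimately have "Const a * b + f = (\<Sum>\<nu>\<in>insert \<eta> S. Const (d \<nu>) * e \<nu>)"
    by (simp add: d_def Const_add distrib_right sum.distrib)
  then show ?case using S \<eta> by (intro exI[of _ "insert \<eta> S"] exI[of _ d]) auto
qed

lemma comps_span_expansion:
  assumes "f \<in> comps_span N" "N \<ge> 1"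
  shows "\<exists>S c. finite S \<and> S \<subseteq> {\<nu>. length \<nu> = N} \<and> f = (\<Sum>\<nu>\<in>S. Const (c \<nu>) * E_poly \<nu>)"
proof (rule span_image_expansion)
  have "comps_span N \<subseteq> mpoly.span (E_poly ` {\<nu>. length \<nu> = N})"
    unfolding comps_span_def
  proof (rule mpoly.span_minimal)
    show "monomial ` {\<nu>. length \<nu> = N} \<subseteq> mpoly.span (E_poly ` {\<nu>. length \<nu> = N})"
    proof clarify
      fix \<nu> :: "nat list" assume "N = length \<nu>"
      then show "monomial \<nu> \<in> mpoly.span (E_poly ` {\<mu>. length \<mu> = length \<nu>})"
        using assms(2) by (intro monomial_in_E_span) auto
    qed
  qed simp
  then show "f \<in> mpoly.span (E_poly ` {\<nu>. length \<nu> = N})" using assms by blast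
qed

lemma eigenvectors_independent:
  assumes "finite S" "N \<ge> 1" "\<And>\<nu>. \<nu> \<in> S \<Longrightarrow> length \<nu> = N \<and> Y_eigen \<nu> (v \<nu>)"
    and "(\<Sum>\<nu>\<in>S. v \<nu>) = 0" "\<nu> \<in> S"
  shows "v \<nu> = 0"
  using assms(1,3,4,5)
proof (induction S arbitrary: v \<nu> rule: finite_induct)
  case (insert \<kappa> S)
  note lY = linear_op_Y[OF assms(2)]
  have eig: "Y_op N i (v \<nu>) = Const (spectral \<nu> i) * v \<nu>" if "\<nu> \<in> insert \<kappa> S" "1 \<le> i" "i \<le> N" for i \<nu>
    using insert.prems(1)[OF that(1)] that by (intro Y_eigenD) auto
  have S0: "v \<mu> = 0" if \<mu>: "\<mu> \<in> S" for \<mu>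
  proof -
    have "\<mu> \<noteq> \<kappa>" using \<mu> insert by auto
    then obtain i where i: "1 \<le> i" "i \<le> N" "spectral \<mu> i \<noteq> spectral \<kappa> i"
      using spectral_inj[of \<mu> \<kappa>] insert.prems(1)[of \<mu>] insert.prems(1)[of \<kappa>] \<mu> by auto
    \<comment> \<open>Applying \<open>Y_op N i\<close> minus the eigenvalue of \<kappa> removes the
      term of \<kappa> and rescales the others; the index \<open>i\<close> separates \<mu> from
      \<kappa>.\<close>
    define w where "w = (\<lambda>\<nu>. Const (spectral \<nu> i - spectral \<kappa> i) * v \<nu>)"
    have "(\<Sum>\<nu>\<in>S. w \<nu>) = (\<Sum>\<nu>\<in>insert \<kappa> S. w \<nu>)"
      using insert by (simp add: w_def)
    also have "\<dots> = (\<Sum>\<nu>\<in>insert \<kappa> S. Y_op N i (v \<nu>)) - Const (spectral \<kappa> i) * (\<Sum>\<nu>\<in>insert \<kappa> S. v \<nu>)"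
      unfolding sum_distrib_left sum_subtractf[symmetric]
      by (rule sum.cong) (use i in \<open>auto simp: w_def eig Const_diff left_diff_distrib\<close>)
    also have "\<dots> = 0"
      using insert.prems(2) unfolding linear_op_sum[OF lY, symmetric] by (simp add: linear_op_zero[OF lY])
    finally have "(\<Sum>\<nu>\<in>S. w \<nu>) = 0" .
    moreover have "length \<nu> = N \<and> Y_eigen \<nu> (w \<nu>)" if "\<nu> \<in> S" for \<nu>
      using insert.prems(1)[of \<nu>] that assms(2) by (auto simp: w_def intro!: Y_eigen_scale)
    ultimately have "w \<mu> = 0" using insert.IH[of w \<mu>] \<mu> by blast
    moreover have "Const (spectral \<mu> i - spectral \<kappa> i) \<noteq> 0"
      using i Const_eq_iff[of _ 0] by simp
    ultimately show ?thesis by (simp add: w_def)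
  qed
  then have "(\<Sum>\<nu>\<in>S. v \<nu>) = 0" by simp
  then have "v \<kappa> = 0" using insert by simp
  then show ?case using S0 insert.prems by blast
qed simp

text \<open>Expanded in the \<open>E_poly\<close>, the vector can involve only compositions with
  spectral vector \<kappa>. Besides uniqueness this shows that no other systems of eigenvalues
  occur, which is what \<open>T_op_equal_parts\<close> relies on.\<close>

lemma joint_eigenvector:
  assumes f: "f \<in> comps_span N" "f \<noteq> 0" and N: "N \<ge> 1"
    and eig: "\<And>i. 1 \<le> i \<Longrightarrow> i \<le> N \<Longrightarrow> Y_op N i f = Const (\<kappa> i) * f"
  shows "\<exists>\<nu> c. length \<nu> = N \<and> (\<forall>i. 1 \<le> i \<longrightarrow> i \<le> N \<longrightarrow> \<kappa> i = spectral \<nu> i) \<and> f = Const c * E_poly \<nu>"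
proof -
  obtain S c where S: "finite S" "S \<subseteq> {\<nu>. length \<nu> = N}" and fs: "f = (\<Sum>\<nu>\<in>S. Const (c \<nu>) * E_poly \<nu>)"
    using comps_span_expansion[OF f(1) N] by blast
  define v where "v = (\<lambda>\<nu>. Const (c \<nu>) * E_poly \<nu>)"
  have ne: "\<nu> \<noteq> []" if "\<nu> \<in> S" for \<nu> using that S N by auto
  have v: "length \<nu> = N \<and> Y_eigen \<nu> (v \<nu>)" if "\<nu> \<in> S" for \<nu>
    using that S ne by (auto simp: v_def intro!: Y_eigen_scale Y_eigen_E_poly)
  note lY = linear_op_Y[OF N]
  have 1: "Const (spectral \<nu> i - \<kappa> i) * v \<nu> = 0" if "\<nu> \<in> S" "1 \<le> i" "i \<le> N" for \<nu> i
  proof (rule eigenvectors_independent[OF S(1) N _ _ that(1), where v = "\<lambda>\<nu>. Const (spectral \<nu> i - \<kappa> i) * v \<nu>"])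
    show "length \<nu> = N \<and> Y_eigen \<nu> (Const (spectral \<nu> i - \<kappa> i) * v \<nu>)" if "\<nu> \<in> S" for \<nu>
      using v[OF that] ne[OF that] by (auto intro: Y_eigen_scale)
    have "(\<Sum>\<nu>\<in>S. Const (spectral \<nu> i - \<kappa> i) * v \<nu>) = (\<Sum>\<nu>\<in>S. Y_op N i (v \<nu>)) - Const (\<kappa> i) * (\<Sum>\<nu>\<in>S. v \<nu>)"
      unfolding sum_distrib_left sum_subtractf[symmetric]
    proof (rule sum.cong[OF refl])
      fix \<nu> assume "\<nu> \<in> S"
      then have "Y_op N i (v \<nu>) = Const (spectral \<nu> i) * v \<nu>" using v that by (intro Y_eigenD) auto
      then show "Const (spectral \<nu> i - \<kappa> i) * v \<nu> = Y_op N i (v \<nu>) - Const (\<kappa> i) * v \<nu>"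
        by (simp add: Const_diff left_diff_distrib)
    qed
    also have "\<dots> = 0"
      unfolding linear_op_sum[OF lY, symmetric] using eig[OF that(2,3)] by (simp add: fs v_def)
    finally show "(\<Sum>\<nu>\<in>S. Const (spectral \<nu> i - \<kappa> i) * v \<nu>) = 0" .
  qed
  have "\<exists>\<nu>\<in>S. v \<nu> \<noteq> 0" using f(2) unfolding fs v_def by (meson sum.neutral)
  then obtain \<nu> where \<nu>: "\<nu> \<in> S" "v \<nu> \<noteq> 0" by blast
  have spec: "\<kappa> i = spectral \<mu> i" if "\<mu> \<in> S" "v \<mu> \<noteq> 0" "1 \<le> i" "i \<le> N" for \<mu> i
    using 1[OF that(1,3,4)] that(2) Const_eq_iff[of _ 0] by simp
  have "v \<mu> = 0" if "\<mu> \<in> S - {\<nu>}" for \<mu>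
  proof (rule ccontr)
    assume "v \<mu> \<noteq> 0"
    then have "\<mu> = \<nu>" using spec[of \<mu>] spec[of \<nu>] \<nu> that v by (intro spectral_inj) auto
    then show False using that by simp
  qed
  then have "(\<Sum>\<mu>\<in>S. v \<mu>) = v \<nu>" using S(1) \<nu>(1) by (simp add: sum.remove)
  then have "f = Const (c \<nu>) * E_poly \<nu>" by (simp add: fs v_def)
  then show ?thesis using spec[OF \<nu>] v[OF \<nu>(1)] by blast
qed

lemma Y_eigen_unique:
  assumes "f \<in> comps_span (length \<eta>)" "\<eta> \<noteq> []" "Y_eigen \<eta> f"
  shows "\<exists>c. f = Const c * E_poly \<eta>"
proof (cases "f = 0")
  case True
  then show ?thesis by (intro exI[of _ 0]) simp
next
  case False
  have "length \<eta> \<ge> 1" using assms(2) by (simp add: Suc_le_eq)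
  from joint_eigenvector[OF assms(1) False this Y_eigenD[OF assms(3) refl]]
  obtain \<nu> c where \<nu>: "length \<nu> = length \<eta>" "\<And>i. 1 \<le> i \<Longrightarrow> i \<le> length \<eta> \<Longrightarrow> spectral \<eta> i = spectral \<nu> i"
    "f = Const c * E_poly \<nu>" by blast
  then have "\<eta> = \<nu>" by (intro spectral_inj) auto
  then show ?thesis using \<nu> by blast
qed

text \<open>Otherwise the difference of the two sides is a joint eigenvector whose eigenvalues at
  \<open>i\<close> and \<open>Suc i\<close> are exchanged. A ratio \<open>tt\<close> of adjacent
  spectral values forces equal parts, and equal parts force the opposite ratio, so that
  \<open>tt * tt = 1\<close>.\<close>

lemma T_op_equal_parts:
  assumes f: "f \<in> comps_span N" "Y_eigen \<eta> f" and i: "length \<eta> = N" "1 \<le> i" "i < N" "part \<eta> i = part \<eta> (Suc i)"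
  shows "T_op i f = Const tt * f"
proof (rule ccontr)
  assume "T_op i f \<noteq> Const tt * f"
  define g where "g = T_op i f - Const tt * f"
  define z where "z = spectral \<eta> (Suc i)"
  have N: "N \<ge> 1" using i by simp
  have y: "spectral \<eta> i = tt * z" using spectral_Suc_equal[of i \<eta>] i by (simp add: z_def)
  have g0: "g \<noteq> 0" using \<open>T_op i f \<noteq> Const tt * f\<close> by (simp add: g_def)
  have gV: "g \<in> comps_span N" unfolding g_def using f i by (intro comps_span_diff comps_span_scale T_op_comps_span)
  note lY = linear_op_diff[OF linear_op_Y[OF N]] linear_op_scale[OF linear_op_Y[OF N]]
  note Y = Y_T_eigen[OF f(2) i(1-3)]
  note E = Y_eigenD[OF f(2) i(1)]
  have "Y_op N k g = Const (spectral \<eta> (transpose i (Suc i) k)) * g" if k: "1 \<le> k" "k \<le> N" for k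
  proof -
    consider "k = i" | "k = Suc i" | "k \<noteq> i" "k \<noteq> Suc i" by blast
    then show ?thesis
    proof cases
      case 1
      have "Const z * T_op i f + Const ((tt - 1) * (tt * z)) * f - Const tt * (Const (tt * z) * f) = Const z * g"
        unfolding g_def Const_mult Const_diff Const_one by algebra
      then show ?thesis using 1 E[of i] i unfolding g_def lY by (simp add: Y(2) y z_def)
    next
      case 2
      have "Const (tt * z) * (T_op i f + (1 - Const tt) * f) - Const tt * (Const z * f) = Const (tt * z) * g"
        unfolding g_def Const_mult by algebra
      then show ?thesis using 2 E[of "Suc i"] i unfolding g_def lY by (simp add: Y(1) y z_def)
    next
      case 3
      then show ?thesis using k E[of k] unfolding g_def lY by (simp add: Y(3) right_diff_distrib mult.left_commute)
    qed
  qed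
  from joint_eigenvector[OF gV g0 N this]
  obtain \<nu> where \<nu>: "length \<nu> = N"
    and s: "\<And>k. 1 \<le> k \<Longrightarrow> k \<le> N \<Longrightarrow> spectral \<eta> (transpose i (Suc i) k) = spectral \<nu> k" by blast
  have 1: "spectral \<nu> i = z" "spectral \<nu> (Suc i) = tt * z"
    using s[of i] s[of "Suc i"] i y by (auto simp: z_def)
  then have "part \<nu> (Suc i) = part \<nu> i" using spectral_eq_tt_mult[of \<nu> "Suc i" i] by simp
  then have "spectral \<nu> i = tt * spectral \<nu> (Suc i)" using spectral_Suc_equal[of i \<nu>] i \<nu> by simp
  then have "z = (tt * tt) * z" using 1 by simp
  moreover have "z \<noteq> 0" by (simp add: z_def)
  ultimately have "tt * tt = 1" by simp
  then show False using tt_power_eq_iff[of 2 0] by (simp add: power_int_numeral power2_eq_square)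
qed

section \<open>Duality of the non-symmetric polynomials\<close>

definition norm_E :: "nat list \<Rightarrow> qt_mpoly" where
  "norm_E \<eta> = Const (inverse (u_empty (E_poly \<eta>))) * E_poly \<eta>"

lemma norm_E_comps_span: "\<eta> \<noteq> [] \<Longrightarrow> norm_E \<eta> \<in> comps_span (length \<eta>)"
  and Y_eigen_norm_E: "\<eta> \<noteq> [] \<Longrightarrow> Y_eigen \<eta> (norm_E \<eta>)"
  and u_empty_norm_E: "\<eta> \<noteq> [] \<Longrightarrow> u_empty (norm_E \<eta>) = 1"
  unfolding norm_E_def
  by (auto intro: comps_span_scale E_poly_comps_span Y_eigen_scale Y_eigen_E_poly
      simp: u_empty_scale u_empty_E_poly)

lemma eigen_eq_norm_E:
  assumes "f \<in> comps_span (length \<eta>)" "\<eta> \<noteq> []" "Y_eigen \<eta> f"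
  shows "f = Const (u_empty f) * norm_E \<eta>"
proof -
  obtain c where c: "f = Const c * E_poly \<eta>" using Y_eigen_unique[OF assms] by blast
  then have "c = u_empty f * inverse (u_empty (E_poly \<eta>))"
    using u_empty_E_poly[OF assms(2)] by (simp add: u_empty_scale)
  then show ?thesis using c by (simp add: norm_E_def Const_mult mult.assoc)
qed

definition dual_eval :: "nat list \<Rightarrow> qt_mpoly \<Rightarrow> qt_field" where
  "dual_eval \<gamma> = evaluate (\<lambda>i. inverse (spectral \<gamma> i))"

lemma dual_eval_add: "dual_eval \<gamma> (f + g) = dual_eval \<gamma> f + dual_eval \<gamma> g"
  and dual_eval_scale: "dual_eval \<gamma> (Const c * f) = c * dual_eval \<gamma> f"
  by (simp_all add: dual_eval_def evaluate_add evaluate_mult)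

text \<open>If parts \<open>i\<close> and \<open>i + 1\<close> agree then \<open>coeff_swap\<close> vanishes, so the two expansions below hold
  without a case distinction.\<close>

definition coeff_swap :: "nat \<Rightarrow> nat list \<Rightarrow> qt_field" where
  "coeff_swap i \<eta> = (spectral \<eta> i - tt * spectral \<eta> (Suc i)) / (spectral \<eta> i - spectral \<eta> (Suc i))"

definition coeff_stay :: "nat \<Rightarrow> nat list \<Rightarrow> qt_field" where
  "coeff_stay i \<eta> = - (spectral \<eta> i * (1 - tt)) / (spectral \<eta> i - spectral \<eta> (Suc i))"

text \<open>The intertwined polynomial is a multiple of the swapped \<open>norm_E\<close>, and
  \<open>u_empty\<close> gives the multiple without any explicit norms. At equal parts
  \<open>T_op_equal_parts\<close> takes over.\<close>

lemma T_op_norm_E: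
  assumes "1 \<le> i" "i < length \<eta>"
  shows "T_op i (norm_E \<eta>) = Const (coeff_swap i \<eta>) * norm_E (swap_parts i \<eta>) + Const (coeff_stay i \<eta>) * norm_E \<eta>"
proof -
  have ne: "\<eta> \<noteq> []" "swap_parts i \<eta> \<noteq> []"
    using assms by (metis list.size(3) not_less_zero, metis assms(2) length_swap_parts list.size(3) not_less_zero)
  have stay: "coeff_stay i \<eta> = - swap_coeff \<eta> i" by (simp add: coeff_stay_def swap_coeff_def)
  have d: "spectral \<eta> i - spectral \<eta> (Suc i) \<noteq> 0" using spectral_neq[OF assms] by simp
  show ?thesis
  proof (cases "part \<eta> i = part \<eta> (Suc i)")
    case True
    have y: "spectral \<eta> i = tt * spectral \<eta> (Suc i)" by (rule spectral_Suc_equal[OF assms True])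
    have "tt * spectral \<eta> (Suc i) - spectral \<eta> (Suc i) \<noteq> 0" using d y by simp
    moreover have "- (tt * spectral \<eta> (Suc i) * (1 - tt)) = tt * (tt * spectral \<eta> (Suc i) - spectral \<eta> (Suc i))"
      by (simp add: algebra_simps)
    ultimately have "coeff_stay i \<eta> = tt"
      unfolding coeff_stay_def y by (metis nonzero_mult_div_cancel_right)
    moreover have "coeff_swap i \<eta> = 0" by (simp add: coeff_swap_def y)
    moreover have "T_op i (norm_E \<eta>) = Const tt * norm_E \<eta>"
      by (rule T_op_equal_parts[OF norm_E_comps_span[OF ne(1)] Y_eigen_norm_E[OF ne(1)] refl assms True])
    ultimately show ?thesis by simp
  next
    case False
    define g where "g = T_op i (norm_E \<eta>) + Const (swap_coeff \<eta> i) * norm_E \<eta>"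
    have "g \<in> comps_span (length (swap_parts i \<eta>))"
      unfolding g_def length_swap_parts
      using norm_E_comps_span[OF ne(1)] assms by (intro comps_span_add comps_span_scale T_op_comps_span)
    moreover have "Y_eigen (swap_parts i \<eta>) g"
      unfolding g_def by (rule Y_eigen_swap[OF Y_eigen_norm_E[OF ne(1)] assms False])
    ultimately have "g = Const (u_empty g) * norm_E (swap_parts i \<eta>)"
      using ne by (intro eigen_eq_norm_E)
    moreover have "u_empty g = coeff_swap i \<eta>"
      using u_empty_swap[OF assms, of "norm_E \<eta>"] u_empty_norm_E[OF ne(1)] d
      by (simp add: g_def coeff_swap_def nonzero_eq_divide_eq)
    ultimately show ?thesis unfolding g_def stay by (simp add: Const_minus algebra_simps)
  qed
qed

text \<open>At the inverses of the spectral values \<open>y\<close>, \<open>z\<close> the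
  coefficients of \<open>T_op_eq\<close>, multiplied by \<open>- y z\<close>, become those of
  \<open>T_op_norm_E\<close>. At equal parts the exchanged point does not belong to
  \<open>swap_parts i \<gamma>\<close>, but its coefficient \<open>y - tt z\<close> is zero.\<close>

lemma dual_eval_T_op:
  assumes "f \<in> comps_span (length \<gamma>)" "1 \<le> i" "i < length \<gamma>"
  shows "dual_eval \<gamma> (T_op i f) = coeff_swap i \<gamma> * dual_eval (swap_parts i \<gamma>) f + coeff_stay i \<gamma> * dual_eval \<gamma> f"
proof -
  define y where "y = spectral \<gamma> i"
  define z where "z = spectral \<gamma> (Suc i)"
  define e' where "e' = evaluate (\<lambda>k. inverse (spectral \<gamma> (transpose i (Suc i) k))) f"
  have nz: "y \<noteq> 0" "z \<noteq> 0" "y - z \<noteq> 0" using spectral_neq[OF assms(2,3)] by (auto simp: y_def z_def)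
  have yz: "y * inverse y = 1" "z * inverse z = 1" using nz by auto
  have "(inverse y - inverse z) * dual_eval \<gamma> (T_op i f) =
      (tt * inverse y - inverse z) * e' + (1 - tt) * inverse z * dual_eval \<gamma> f"
    using evaluate_T_op[of "\<lambda>i. inverse (spectral \<gamma> i)" i f] by (simp add: dual_eval_def y_def z_def e'_def)
  then have eq: "(y - z) * dual_eval \<gamma> (T_op i f) = (y - tt * z) * e' - y * (1 - tt) * dual_eval \<gamma> f"
    using yz by algebra
  have sw: "(y - tt * z) * e' = (y - tt * z) * dual_eval (swap_parts i \<gamma>) f"
  proof (cases "part \<gamma> i = part \<gamma> (Suc i)")
    case True
    then show ?thesis using spectral_Suc_equal[OF assms(2,3)] by (simp add: y_def z_def)
  next
    case False
    have "e' = dual_eval (swap_parts i \<gamma>) f"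
      unfolding e'_def dual_eval_def
      by (rule evaluate_cong_comps[OF assms(1)]) (use spectral_swap[OF assms(2,3) False] in auto)
    then show ?thesis by simp
  qed
  have "coeff_swap i \<gamma> * (y - z) = y - tt * z" "coeff_stay i \<gamma> * (y - z) = - (y * (1 - tt))"
    using nz(3) unfolding coeff_swap_def coeff_stay_def y_def[symmetric] z_def[symmetric] by simp_all
  then have "dual_eval \<gamma> (T_op i f) * (y - z) =
    (coeff_swap i \<gamma> * dual_eval (swap_parts i \<gamma>) f + coeff_stay i \<gamma> * dual_eval \<gamma> f) * (y - z)"
    using eq unfolding sw by algebra
  then show ?thesis using nz(3) by simp
qed

definition inv_swap :: "nat \<Rightarrow> nat list \<Rightarrow> qt_field" where
  "inv_swap i \<eta> = inverse tt * coeff_swap i \<eta>"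

definition inv_stay :: "nat \<Rightarrow> nat list \<Rightarrow> qt_field" where
  "inv_stay i \<eta> = inverse tt * (coeff_stay i \<eta> + (1 - tt))"

lemma T_inv_norm_E:
  assumes "1 \<le> i" "i < length \<eta>"
  shows "T_inv i (norm_E \<eta>) = Const (inv_swap i \<eta>) * norm_E (swap_parts i \<eta>) + Const (inv_stay i \<eta>) * norm_E \<eta>"
  unfolding T_inv_def T_op_norm_E[OF assms] inv_swap_def inv_stay_def Const_mult Const_add Const_diff Const_one
  by algebra

lemma dual_eval_T_inv:
  assumes "f \<in> comps_span (length \<gamma>)" "1 \<le> i" "i < length \<gamma>"
  shows "dual_eval \<gamma> (T_inv i f) = inv_swap i \<gamma> * dual_eval (swap_parts i \<gamma>) f + inv_stay i \<gamma> * dual_eval \<gamma> f"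
  unfolding T_inv_def Const_one_minus dual_eval_scale dual_eval_add dual_eval_T_op[OF assms] inv_swap_def inv_stay_def
  by algebra

definition symmetric_dual :: "nat list \<Rightarrow> bool" where
  "symmetric_dual \<eta> \<longleftrightarrow> (\<forall>\<gamma>. length \<gamma> = length \<eta> \<longrightarrow> dual_eval \<gamma> (norm_E \<eta>) = dual_eval \<eta> (norm_E \<gamma>))"

text \<open>The hypothesis holds for \<gamma> and for its swap, so the values of
  \<open>T_op i (norm_E \<eta>)\<close> at \<gamma> and of \<open>T_op i (norm_E \<gamma>)\<close>
  at \<eta> agree. Expanding both with the coefficients of \<eta> and cancelling the known terms
  leaves the claim.\<close>

lemma symmetric_dual_swap:
  assumes "symmetric_dual \<eta>" "1 \<le> i" "i < length \<eta>"
  shows "symmetric_dual (swap_parts i \<eta>)"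
proof (cases "part \<eta> i = part \<eta> (Suc i)")
  case True
  then show ?thesis using assms swap_parts_equal by simp
next
  case False
  show ?thesis unfolding symmetric_dual_def
  proof (intro allI impI)
    fix \<gamma> :: "nat list" assume "length \<gamma> = length (swap_parts i \<eta>)"
    then have len: "length \<gamma> = length \<eta>" by simp
    have ne: "\<eta> \<noteq> []" "\<gamma> \<noteq> []" using assms len by auto
    have "norm_E \<eta> \<in> comps_span (length \<gamma>)" "norm_E \<gamma> \<in> comps_span (length \<eta>)"
      using norm_E_comps_span ne len by metis+
    note ev = dual_eval_T_op[OF this(1) assms(2)] dual_eval_T_op[OF this(2) assms(2,3)]
    have "dual_eval \<gamma> (T_op i (norm_E \<eta>)) = dual_eval \<eta> (T_op i (norm_E \<gamma>))"
      using assms len unfolding symmetric_dual_def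
      by (simp add: ev(1) T_op_norm_E[of i \<gamma>] dual_eval_add dual_eval_scale)
    then have "coeff_swap i \<eta> * dual_eval \<gamma> (norm_E (swap_parts i \<eta>)) + coeff_stay i \<eta> * dual_eval \<gamma> (norm_E \<eta>) =
        coeff_swap i \<eta> * dual_eval (swap_parts i \<eta>) (norm_E \<gamma>) + coeff_stay i \<eta> * dual_eval \<eta> (norm_E \<gamma>)"
      unfolding ev(2) T_op_norm_E[OF assms(2,3)] by (simp add: dual_eval_add dual_eval_scale)
    moreover have "dual_eval \<gamma> (norm_E \<eta>) = dual_eval \<eta> (norm_E \<gamma>)"
      using assms len by (simp add: symmetric_dual_def)
    moreover have "coeff_swap i \<eta> \<noteq> 0"
      using spectral_neq[OF assms(2,3)] spectral_eq_tt_mult[of \<eta> i "Suc i"] False by (auto simp: coeff_swap_def)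
    ultimately show "dual_eval \<gamma> (norm_E (swap_parts i \<eta>)) = dual_eval (swap_parts i \<eta>) (norm_E \<gamma>)" by simp
  qed
qed

lemma swap_parts_append: "swap_parts (Suc (length p)) (p @ c # d # v) = p @ d # c # v"
  using swap_parts_eq_update[of "Suc (length p)" "p @ c # d # v"]
  by (simp add: list_update_append nth_append)

text \<open>The head of \<open>ys\<close> is bubbled to the front of \<open>xs\<close> and then
  joins the prefix, which only grows, so the swaps stay beyond position \<open>m\<close>.\<close>

lemma adjacent_swap_closed:
  assumes swap: "\<And>\<eta> i. m < i \<Longrightarrow> i < length \<eta> \<Longrightarrow> Q \<eta> \<Longrightarrow> Q (swap_parts i \<eta>)"
    and "length a \<ge> m" "Q (a @ xs)" "mset xs = mset ys"
  shows "Q (a @ ys)"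
  using assms(2-)
proof (induction ys arbitrary: a xs)
  case (Cons c ys)
  have "c \<in> set xs" using Cons.prems(3) by (metis list.set_intros(1) set_mset_mset)
  then obtain u v where xs: "xs = u @ c # v" by (meson split_list)
  have "Q (a @ u @ c # v) \<Longrightarrow> Q (a @ c # u @ v)" for v
  proof (induction u arbitrary: v rule: rev_induct)
    case (snoc d u)
    have "Q (swap_parts (Suc (length (a @ u))) ((a @ u) @ d # c # v))"
      by (rule swap) (use Cons.prems snoc in auto)
    then have "Q (a @ u @ c # d # v)" unfolding swap_parts_append by simp
    from snoc.IH[OF this] show ?case by simp
  qed simp
  then have "Q ((a @ [c]) @ (u @ v))" using Cons.prems xs by simp
  moreover have "mset (u @ v) = mset ys" using Cons.prems xs by simp
  moreover have "m \<le> length (a @ [c])" using Cons.prems by simp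
  ultimately have "Q ((a @ [c]) @ ys)" using Cons.IH by blast
  then show ?case by simp
qed simp

text \<open>On the left the innermost letter is expanded in the basis \<open>norm_E\<close>, on the
  right the outermost letter acts on the evaluation point. Both give the same coefficients, which is
  why the word is reversed.\<close>

lemma dual_eval_foldr_T_inv:
  assumes "symmetric_dual \<eta>" "length \<gamma> = length \<eta>" "\<And>i. i \<in> set is \<Longrightarrow> 1 \<le> i \<and> i < length \<eta>"
  shows "dual_eval \<gamma> (foldr T_inv is (norm_E \<eta>)) = dual_eval \<eta> (foldr T_inv (rev is) (norm_E \<gamma>))"
  using assms
proof (induction "is" arbitrary: \<eta> rule: rev_induct)
  case Nil
  then show ?case by (simp add: symmetric_dual_def)
next
  case (snoc i "is")
  have i: "1 \<le> i" "i < length \<eta>" using snoc.prems by auto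
  then have "\<gamma> \<noteq> []" using snoc.prems(2) by fastforce
  define g where "g = foldr T_inv (rev is) (norm_E \<gamma>)"
  have g: "g \<in> comps_span (length \<eta>)"
    unfolding g_def using snoc.prems norm_E_comps_span[OF \<open>\<gamma> \<noteq> []\<close>]
    by (intro foldr_T_inv_comps_span) auto
  have lin: "linear_op (foldr T_inv is)" by (rule linear_op_foldr) (rule linear_op_T_inv)
  have 1: "dual_eval \<gamma> (foldr T_inv is (norm_E (swap_parts i \<eta>))) = dual_eval (swap_parts i \<eta>) g"
    unfolding g_def using snoc.prems symmetric_dual_swap[OF snoc.prems(1) i] by (intro snoc.IH) auto
  have 2: "dual_eval \<gamma> (foldr T_inv is (norm_E \<eta>)) = dual_eval \<eta> g"
    unfolding g_def using snoc.prems by (intro snoc.IH) auto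
  show ?case
    using 1 2 dual_eval_T_inv[OF g i]
    by (simp add: T_inv_norm_E[OF i] linear_op_add[OF lin] linear_op_scale[OF lin] dual_eval_add
        dual_eval_scale g_def)
qed

lemma foldr_T_inv_foldr_T_op: "foldr T_inv (rev is) (foldr T_op is f) = f"
  by (induction "is") simp_all

text \<open>The eigenvalue equation of \<open>Y_op N 1\<close> is solved for the shifted polynomial.
  The factor \<open>k\<close> that appears is also \<open>u_empty (Phi ?N ?f)\<close>, so the
  normalization removes it.\<close>

lemma norm_E_shift:
  assumes "\<eta> \<noteq> []"
  shows "norm_E (shift_parts \<eta>) = Var (length \<eta>) * foldr T_inv (rev [1..<length \<eta>]) (norm_E \<eta>)"
proof -
  let ?N = "length \<eta>" and ?f = "norm_E \<eta>"
  have N: "?N \<ge> 1" using assms by (simp add: Suc_le_eq)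
  have ne: "shift_parts \<eta> \<noteq> []" by (simp add: shift_parts_def)
  have lin: "linear_op (foldr T_inv is)" for "is" by (rule linear_op_foldr) (rule linear_op_T_inv)
  define k where "k = tt powi (int ?N - 1) * spectral \<eta> 1"
  have k: "k \<noteq> 0" by (simp add: k_def)
  have Yf: "Y_eigen \<eta> ?f" by (rule Y_eigen_norm_E[OF assms])
  have "Const (tt powi (1 - int ?N)) * T_up 1 ?N (omega_op ?N ?f) = Const (spectral \<eta> 1) * ?f"
    using Y_eigenD[OF Yf refl _ N] by (simp add: Y_op_eq)
  from arg_cong[OF this, of "(*) (Const (tt powi (int ?N - 1)))"]
  have "Const (tt powi (int ?N - 1)) * Const (tt powi (1 - int ?N)) * T_up 1 ?N (omega_op ?N ?f) =
      Const k * ?f"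
    unfolding k_def Const_mult mult.assoc .
  moreover have "Const (tt powi (int ?N - 1)) * Const (tt powi (1 - int ?N)) = 1"
    by (simp flip: Const_mult power_int_add)
  ultimately have "T_up 1 ?N (omega_op ?N ?f) = Const k * ?f" by (simp only: mult_1_left)
  from arg_cong[OF this, of "foldr T_inv (rev [1..<?N])"]
  have om: "omega_op ?N ?f = Const k * foldr T_inv (rev [1..<?N]) ?f"
    unfolding foldr_T_inv_foldr_T_op linear_op_scale[OF lin] .
  have u: "u_empty (Phi ?N ?f) = k"
    using u_empty_Phi[OF Yf assms] u_empty_norm_E[OF assms] by (simp add: k_def)
  have "Phi ?N ?f \<in> comps_span (length (shift_parts \<eta>))"
    unfolding comps_span_def length_shift_parts[OF assms]
  proof (rule linear_op_span[OF linear_op_Phi[OF N] _ norm_E_comps_span[OF assms, unfolded comps_span_def]])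
    fix b assume "b \<in> monomial ` {\<nu>. length \<nu> = ?N}"
    then obtain \<nu> where \<nu>: "b = monomial \<nu>" "length \<nu> = ?N" by blast
    then have "\<nu> \<noteq> []" using assms by auto
    then have "Phi ?N b = Const (qq ^ part \<nu> 1) * monomial (shift_parts \<nu>)" "length (shift_parts \<nu>) = ?N"
      using Phi_monomial[of \<nu>] \<nu> by simp_all
    then show "Phi ?N b \<in> mpoly.span (monomial ` {\<nu>. length \<nu> = ?N})"
      by (metis comps_span_def comps_span_monomial comps_span_scale)
  qed
  from eigen_eq_norm_E[OF this ne Y_eigen_shift[OF Yf assms]]
  have "Phi ?N ?f = Const k * norm_E (shift_parts \<eta>)" unfolding u .
  then have "Const k * norm_E (shift_parts \<eta>) = Const k * (Var ?N * foldr T_inv (rev [1..<?N]) ?f)"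
    unfolding Phi_def om by (simp only: mult.left_commute)
  then show ?thesis using k Const_eq_iff[of k 0] by simp
qed

text \<open>In the eigenvalue equation of \<open>Y_op N N\<close> for \<open>norm_E \<gamma>\<close>
  the shift carries the point of \<open>shift_parts \<eta>\<close> to that of \<eta>. Its eigenvalue
  \<open>spectral \<gamma> ?N\<close> matches the factor \<open>Var ?N\<close> of
  \<open>norm_E_shift\<close>, whose value at the point of \<gamma> is the inverse.\<close>

lemma symmetric_dual_shift:
  assumes "symmetric_dual \<eta>" "\<eta> \<noteq> []"
  shows "symmetric_dual (shift_parts \<eta>)"
  unfolding symmetric_dual_def length_shift_parts[OF assms(2)]
proof (intro allI impI)
  let ?N = "length \<eta>"
  fix \<gamma> :: "nat list" assume len: "length \<gamma> = ?N"
  have N: "?N \<ge> 1" using assms by (simp add: Suc_le_eq)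
  have ne: "\<gamma> \<noteq> []" using len assms by auto
  define h where "h = T_down ?N (norm_E \<gamma>)"
  have h: "h \<in> comps_span ?N"
    unfolding h_def using norm_E_comps_span[OF ne] len by (intro foldr_T_inv_comps_span) auto
  have "omega_op ?N h = Const (spectral \<gamma> ?N) * norm_E \<gamma>"
    using Y_eigenD[OF Y_eigen_norm_E[OF ne] len N] by (simp add: Y_op_eq h_def)
  from arg_cong[OF this, of "dual_eval (shift_parts \<eta>)"]
  have "spectral \<gamma> ?N * dual_eval (shift_parts \<eta>) (norm_E \<gamma>) =
      evaluate (\<lambda>k. evaluate (\<lambda>i. inverse (spectral (shift_parts \<eta>) i)) (cyclic_var ?N k)) h"
    unfolding dual_eval_scale unfolding dual_eval_def omega_op_eq[OF N] evaluate_substitute by simp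
  also have "\<dots> = dual_eval \<eta> h"
    unfolding dual_eval_def
  proof (rule evaluate_cong_comps[OF h])
    fix k assume k: "1 \<le> k" "k \<le> ?N"
    show "evaluate (\<lambda>i. inverse (spectral (shift_parts \<eta>) i)) (cyclic_var ?N k) = inverse (spectral \<eta> k)"
    proof (cases "k = 1")
      case True
      then show ?thesis using spectral_shift_last[OF assms(2)]
        by (simp add: cyclic_var_def evaluate_mult)
    next
      case False
      then show ?thesis using k spectral_shift[of "k - 1" \<eta>] by (simp add: cyclic_var_def)
    qed
  qed
  also have "\<dots> = dual_eval \<gamma> (foldr T_inv (rev [1..<?N]) (norm_E \<eta>))"
    using dual_eval_foldr_T_inv[OF assms(1) len, of "rev [1..<?N]"] by (simp add: h_def)
  also have "\<dots> = spectral \<gamma> ?N * dual_eval \<gamma> (norm_E (shift_parts \<eta>))"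
    unfolding norm_E_shift[OF assms(2)] by (simp add: dual_eval_def evaluate_mult)
  finally show "dual_eval \<gamma> (norm_E (shift_parts \<eta>)) = dual_eval (shift_parts \<eta>) (norm_E \<gamma>)" by simp
qed

lemma rank_replicate: "1 \<le> i \<Longrightarrow> i \<le> N \<Longrightarrow> rank (replicate N 0) i = i"
proof -
  assume i: "1 \<le> i" "i \<le> N"
  have "rank_set (replicate N 0) i = {1..i}" using i by (auto simp: rank_set_def part_def)
  then show ?thesis using i by (simp add: rank_eq_card)
qed

lemma dual_eval_zero:
  assumes "f \<in> comps_span N"
  shows "dual_eval (replicate N 0) f = u_empty f"
  unfolding dual_eval_def u_empty_def
proof (rule evaluate_cong_comps[OF assms])
  fix i assume i: "1 \<le> i" "i \<le> N"
  show "inverse (spectral (replicate N 0) i) = tt powi (int i - 1)"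
    using i power_int_minus[of tt "1 - int i"] by (simp add: spectral_def rank_replicate part_def)
qed

theorem symmetric_dual:
  assumes "\<eta> \<noteq> []"
  shows "symmetric_dual \<eta>"
proof -
  have N: "length \<eta> \<ge> 1" using assms by (simp add: Suc_le_eq)
  show ?thesis using N refl
  proof (induction \<eta> rule: composition_induct)
    case zero
    \<comment> \<open>Both sides are 1: \<open>norm_E ?z\<close> is constant, and the point of
      \<open>?z\<close> is the point of normalization.\<close>
    let ?z = "replicate (length \<eta>) 0 :: nat list"
    have ne: "?z \<noteq> []" using assms by simp
    have "1 \<in> comps_span (length ?z)"
      using comps_span_monomial[of ?z "length \<eta>"] by (simp add: monomial_zero)
    from eigen_eq_norm_E[OF this ne Y_eigen_one]
    have "norm_E ?z = 1" by (simp add: u_empty_one)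
    moreover have "dual_eval ?z (norm_E \<gamma>) = 1" if "length \<gamma> = length \<eta>" for \<gamma>
    proof -
      have "\<gamma> \<noteq> []" using that assms by auto
      then show ?thesis using norm_E_comps_span[of \<gamma>] that by (simp add: dual_eval_zero u_empty_norm_E)
    qed
    ultimately show ?case by (simp add: symmetric_dual_def dual_eval_def)
  next
    case (shift \<eta>')
    then have "\<eta>' \<noteq> []" using assms by auto
    then show ?case using shift symmetric_dual_shift by blast
  next
    case (swap \<eta>' i)
    then show ?case using symmetric_dual_swap by simp
  qed
qed

section \<open>Length and minimal coset representatives\<close>

definition inversions :: "nat \<Rightarrow> (nat \<Rightarrow> nat) \<Rightarrow> (nat \<times> nat) set" where
  "inversions N u = {(a, b). 1 \<le> a \<and> a < b \<and> b \<le> N \<and> u b < u a}"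

lemma finite_inversions [simp]: "finite (inversions N u)"
  by (rule finite_subset[of _ "{1..N} \<times> {1..N}"]) (auto simp: inversions_def)

lemma inversions_id [simp]: "inversions N id = {}" "inversions N (\<lambda>a. a) = {}"
  by (auto simp: inversions_def)

text \<open>\<open>h\<close> carries an inversion of the new permutation along with the
  transposition if the pair stays ordered, and keeps it otherwise. It is injective into the
  inversions of \<open>u\<close> and misses \<open>(a, b)\<close>.\<close>

lemma inversions_transpose_less:
  assumes "1 \<le> a" "a < b" "b \<le> N" "u b < u a"
  shows "card (inversions N (u \<circ> transpose a b)) < card (inversions N u)"
proof -
  let ?t = "transpose a b"
  define h where "h = (\<lambda>(p, q). if ?t p < ?t q then (?t p, ?t q) else (p, q))"
  have t: "?t (?t p) = p" for p by simp
  have "inj_on h (inversions N (u \<circ> ?t))"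
  proof (rule inj_onI, clarify)
    fix p q r s assume "(p, q) \<in> inversions N (u \<circ> ?t)" "(r, s) \<in> inversions N (u \<circ> ?t)"
      and eq: "h (p, q) = h (r, s)"
    then have "p < q" "r < s" by (auto simp: inversions_def)
    then show "p = r \<and> q = s" using eq t unfolding h_def
      by (auto split: if_splits dest: arg_cong[of _ _ ?t])
  qed
  moreover have "h ` inversions N (u \<circ> ?t) \<subseteq> inversions N u - {(a, b)}"
  proof (rule image_subsetI)
    fix x assume "x \<in> inversions N (u \<circ> ?t)"
    then obtain p q where x: "x = (p, q)" and pq: "1 \<le> p" "p < q" "q \<le> N" "u (?t q) < u (?t p)"
      by (auto simp: inversions_def)
    have bounds: "1 \<le> ?t p" "?t q \<le> N" using pq assms by (auto simp: transpose_def)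
    have "h (p, q) \<in> inversions N u - {(a, b)}"
    proof (cases "?t p < ?t q")
      case True
      have "(?t p, ?t q) \<noteq> (a, b)"
      proof
        assume "(?t p, ?t q) = (a, b)"
        then have "?t p = a" "?t q = b" by auto
        then have "p = b" "q = a" by (auto simp: transpose_def split: if_splits)
        then show False using pq assms by simp
      qed
      then show ?thesis using True pq bounds by (simp add: h_def inversions_def)
    next
      case False
      moreover have "(p, q) \<noteq> (a, b)" using pq assms by auto
      moreover have "u q < u p"
        using False pq assms by (auto simp: transpose_def split: if_splits)
      ultimately show ?thesis using pq by (simp add: h_def inversions_def)
    qed
    then show "h x \<in> inversions N u - {(a, b)}" unfolding x .
  qed
  ultimately have "card (inversions N (u \<circ> ?t)) \<le> card (inversions N u - {(a, b)})"
    by (intro card_inj_on_le) auto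
  also have "\<dots> < card (inversions N u)"
    by (rule card_Diff1_less[OF finite_inversions]) (use assms in \<open>simp add: inversions_def\<close>)
  finally show ?thesis .
qed

lemma inversions_adjacent:
  assumes "1 \<le> i" "i < N" "u (Suc i) < u i"
  shows "card (inversions N u) = Suc (card (inversions N (u \<circ> transpose i (Suc i))))"
proof -
  let ?t = "transpose i (Suc i)"
  have less: "?t a < ?t b" if "a < b" "(a, b) \<noteq> (i, Suc i)" for a b
    using that by (auto simp: transpose_def)
  have t: "?t (?t p) = p" for p by simp
  have "bij_betw (\<lambda>(a, b). (?t a, ?t b)) (inversions N u - {(i, Suc i)}) (inversions N (u \<circ> ?t))"
  proof (rule bij_betw_byWitness[where f' = "\<lambda>(a, b). (?t a, ?t b)"])
    show "(\<lambda>(a, b). (?t a, ?t b)) ` (inversions N u - {(i, Suc i)}) \<subseteq> inversions N (u \<circ> ?t)"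
      using less transpose_bounds[OF assms(1,2)] by (auto simp: inversions_def)
    show "(\<lambda>(a, b). (?t a, ?t b)) ` inversions N (u \<circ> ?t) \<subseteq> inversions N u - {(i, Suc i)}"
    proof (rule image_subsetI)
      fix x assume "x \<in> inversions N (u \<circ> ?t)"
      then obtain a b where x: "x = (a, b)" and ab: "1 \<le> a" "a < b" "b \<le> N" "u (?t b) < u (?t a)"
        by (auto simp: inversions_def)
      have 1: "(a, b) \<noteq> (i, Suc i)" using ab(4) assms(3) by auto
      have "(?t a, ?t b) \<noteq> (i, Suc i)"
      proof
        assume "(?t a, ?t b) = (i, Suc i)"
        then have "?t a = i" "?t b = Suc i" by auto
        then have "a = Suc i" "b = i" by (auto simp: transpose_def split: if_splits)
        then show False using ab by simp
      qed
      then show "(case x of (a, b) \<Rightarrow> (?t a, ?t b)) \<in> inversions N u - {(i, Suc i)}"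
        unfolding x
        using ab less[OF ab(2) 1] transpose_bounds[OF assms(1,2), of a] transpose_bounds[OF assms(1,2), of b]
        by (auto simp: inversions_def)
    qed
  qed auto
  then have "card (inversions N u - {(i, Suc i)}) = card (inversions N (u \<circ> ?t))"
    by (rule bij_betw_same_card)
  moreover have "(i, Suc i) \<in> inversions N u" using assms by (simp add: inversions_def)
  ultimately show ?thesis by (metis card_Suc_Diff1 finite_inversions)
qed

lemma permutes_adjacent: "1 \<le> i \<Longrightarrow> i < N \<Longrightarrow> transpose i (Suc i) permutes {1..N}"
  by (rule permutes_swap_id) auto

lemma word_perm_Cons: "word_perm (i # is) = transpose i (Suc i) \<circ> word_perm is"
  and word_perm_Nil: "word_perm [] = id"
  by (simp_all add: word_perm_def)

lemma word_perm_permutes: "set is \<subseteq> {1..<N} \<Longrightarrow> word_perm is permutes {1..N}"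
proof (induction "is")
  case (Cons i "is")
  then show ?case unfolding word_perm_Cons by (intro permutes_compose permutes_adjacent) auto
qed (simp add: word_perm_Nil permutes_id)

text \<open>The inverse appears because \<open>word_perm\<close> adds letters on the left, while
  \<open>inversions_adjacent\<close> multiplies on the right.\<close>

abbreviation coxeter_length :: "nat \<Rightarrow> (nat \<Rightarrow> nat) \<Rightarrow> nat" where
  "coxeter_length N w \<equiv> card (inversions N (inv w))"

lemma inv_adjacent_comp:
  assumes "w permutes {1..N}"
  shows "inv (transpose i (Suc i) \<circ> w) = inv w \<circ> transpose i (Suc i)"
  using permutes_bij[OF assms] by (simp add: o_inv_distrib)

lemma coxeter_length_descent:
  assumes "w permutes {1..N}" "1 \<le> i" "i < N" "inv w (Suc i) < inv w i"
  shows "coxeter_length N w = Suc (coxeter_length N (transpose i (Suc i) \<circ> w))"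
  unfolding inv_adjacent_comp[OF assms(1)] by (rule inversions_adjacent[OF assms(2-4)])

lemma coxeter_length_ascent:
  assumes "w permutes {1..N}" "1 \<le> i" "i < N" "inv w i < inv w (Suc i)"
  shows "coxeter_length N (transpose i (Suc i) \<circ> w) = Suc (coxeter_length N w)"
proof -
  have "card (inversions N (inv w \<circ> transpose i (Suc i))) =
      Suc (card (inversions N (inv w \<circ> transpose i (Suc i) \<circ> transpose i (Suc i))))"
    using assms by (intro inversions_adjacent) auto
  then show ?thesis unfolding inv_adjacent_comp[OF assms(1)] by (simp add: comp_assoc)
qed

lemma inv_adjacent_neq:
  assumes "w permutes {1..N}"
  shows "inv w i \<noteq> inv w (Suc i)"
  using permutes_inj[OF permutes_inv[OF assms]] by (metis injD n_not_Suc_n)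

lemma coxeter_length_word: "set is \<subseteq> {1..<N} \<Longrightarrow> coxeter_length N (word_perm is) \<le> length is"
proof (induction "is")
  case Nil
  then show ?case by (simp add: word_perm_Nil)
next
  case (Cons i "is")
  have p: "word_perm is permutes {1..N}" using Cons by (intro word_perm_permutes) auto
  have i: "1 \<le> i" "i < N" using Cons by auto
  have IH: "coxeter_length N (word_perm is) \<le> length is" using Cons by simp
  consider "inv (word_perm is) i < inv (word_perm is) (Suc i)" | "inv (word_perm is) (Suc i) < inv (word_perm is) i"
    using inv_adjacent_neq[OF p, of i] by linarith
  then show ?case unfolding word_perm_Cons
  proof cases
    case 1
    from coxeter_length_ascent[OF p i this] IH
    show "coxeter_length N (transpose i (Suc i) \<circ> word_perm is) \<le> length (i # is)" by simp
  next
    case 2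
    from coxeter_length_descent[OF p i this] IH
    show "coxeter_length N (transpose i (Suc i) \<circ> word_perm is) \<le> length (i # is)" by simp
  qed
qed

text \<open>Without a descent the inverse is increasing on \<open>{1..N}\<close>, hence both at
  least and at most the identity there.\<close>

lemma exists_descent:
  assumes "w permutes {1..N}" "w \<noteq> id"
  shows "\<exists>i. 1 \<le> i \<and> i < N \<and> inv w (Suc i) < inv w i"
proof (rule ccontr)
  assume "\<not> ?thesis"
  then have le: "inv w i \<le> inv w (Suc i)" if "1 \<le> i" "i < N" for i using that by (meson not_less)
  let ?u = "inv w"
  have p: "?u permutes {1..N}" by (rule permutes_inv[OF assms(1)])
  have lt: "?u i < ?u (Suc i)" if "1 \<le> i" "i < N" for i
    using le[OF that] inv_adjacent_neq[OF assms(1), of i] by simp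
  have ge: "i \<le> ?u i" if "1 \<le> i" "i \<le> N" for i
    using that
  proof (induction i rule: dec_induct)
    case base
    then show ?case using permutes_in_image[OF p, of 1] by auto
  next
    case (step n)
    then show ?case using lt[of n] by simp
  qed
  have le': "?u (N - d) \<le> N - d" if "d < N" for d
    using that
  proof (induction d)
    case 0
    then show ?case using permutes_in_image[OF p, of N] by auto
  next
    case (Suc d)
    then have "?u (N - Suc d) < ?u (N - d)" using lt[of "N - Suc d"] by (simp add: Suc_diff_Suc)
    moreover have "?u (N - d) \<le> N - d" using Suc by simp
    ultimately show ?case by linarith
  qed
  have "?u i = i" for i
  proof (cases "i \<in> {1..N}")
    case True
    then show ?thesis using ge[of i] le'[of "N - i"] by simp
  next
    case False
    then show ?thesis using p by (simp add: permutes_def)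
  qed
  then have "?u = id" by auto
  then show False using assms permutes_inv_eq[OF assms(1)] by (metis eq_id_iff)
qed

lemma exists_word:
  assumes "w permutes {1..N}"
  shows "\<exists>is. set is \<subseteq> {1..<N} \<and> word_perm is = w \<and> length is = coxeter_length N w"
  using assms
proof (induction "coxeter_length N w" arbitrary: w)
  case 0
  have "w = id"
  proof (rule ccontr)
    assume "w \<noteq> id"
    then obtain i where "1 \<le> i" "i < N" "inv w (Suc i) < inv w i" using exists_descent 0 by blast
    then have "(i, Suc i) \<in> inversions N (inv w)" by (simp add: inversions_def)
    then show False using 0 by (metis card_0_eq empty_iff finite_inversions)
  qed
  then show ?case using 0 by (intro exI[of _ "[]"]) (simp add: word_perm_Nil)
next
  case (Suc k)
  have "w \<noteq> id"
  proof
    assume "w = id"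
    then show False using Suc by simp
  qed
  then obtain i where i: "1 \<le> i" "i < N" "inv w (Suc i) < inv w i" using exists_descent Suc.prems by blast
  let ?w = "transpose i (Suc i) \<circ> w"
  have p: "?w permutes {1..N}" using Suc.prems i by (intro permutes_compose permutes_adjacent)
  have len: "coxeter_length N w = Suc (coxeter_length N ?w)"
    by (rule coxeter_length_descent[OF Suc.prems i])
  then have "k = coxeter_length N ?w" using Suc by simp
  from Suc.hyps(1)[OF this p] obtain js where js: "set js \<subseteq> {1..<N}" "word_perm js = ?w" "length js = coxeter_length N ?w"
    by blast
  have "word_perm (i # js) = w" unfolding word_perm_Cons js by (simp flip: comp_assoc)
  then show ?case using js len i by (intro exI[of _ "i # js"]) simp
qed

lemma perm_length_eq:
  assumes "w permutes {1..N}"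
  shows "perm_length N w = coxeter_length N w"
  unfolding perm_length_def
proof (rule Least_equality)
  show "\<exists>is. set is \<subseteq> {1..<N} \<and> word_perm is = w \<and> length is = coxeter_length N w"
    by (rule exists_word[OF assms])
qed (use coxeter_length_word in auto)

lemma coxeter_length_inv:
  assumes "w permutes {1..N}"
  shows "coxeter_length N (inv w) = coxeter_length N w"
proof -
  have i: "inv w (w p) = p" "w (inv w p) = p" for p
    using permutes_inverses[OF assms] by auto
  have r: "1 \<le> p \<Longrightarrow> p \<le> N \<Longrightarrow> 1 \<le> w p \<and> w p \<le> N" "1 \<le> p \<Longrightarrow> p \<le> N \<Longrightarrow> 1 \<le> inv w p \<and> inv w p \<le> N" for p
    using permutes_in_image[OF assms, of p] permutes_in_image[OF permutes_inv[OF assms], of p] by auto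
  have "bij_betw (\<lambda>(a, b). (w b, w a)) (inversions N w) (inversions N (inv w))"
    by (rule bij_betw_byWitness[where f' = "\<lambda>(a, b). (inv w b, inv w a)"])
      (use r in \<open>auto simp: inversions_def i\<close>)
  then show ?thesis by (simp add: bij_betw_same_card permutes_inv_inv[OF assms])
qed

section \<open>Sorting permutations of minimal length\<close>

definition rank_perm :: "nat list \<Rightarrow> nat \<Rightarrow> nat" where
  "rank_perm \<eta> i = (if 1 \<le> i \<and> i \<le> length \<eta> then rank \<eta> i else i)"

lemma rank_perm_permutes: "rank_perm \<eta> permutes {1..length \<eta>}"
proof (rule bij_imp_permutes)
  have inj: "inj_on (rank_perm \<eta>) {1..length \<eta>}"
  proof (rule inj_onI)
    fix i j assume "i \<in> {1..length \<eta>}" "j \<in> {1..length \<eta>}" "rank_perm \<eta> i = rank_perm \<eta> j"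
    then show "i = j"
      using rank_less[of i \<eta> j] rank_less[of j \<eta> i] by (auto simp: rank_perm_def) (metis nat_neq_iff)
  qed
  have "rank_perm \<eta> ` {1..length \<eta>} \<subseteq> {1..length \<eta>}"
    using rank_bounds[of _ \<eta>] by (auto simp: rank_perm_def)
  then have "rank_perm \<eta> ` {1..length \<eta>} = {1..length \<eta>}"
    using inj by (simp add: endo_inj_surj)
  then show "bij_betw (rank_perm \<eta>) {1..length \<eta>} {1..length \<eta>}" using inj by (simp add: bij_betw_def)
qed (auto simp: rank_perm_def)

lemma length_decreasing [simp]: "length (decreasing \<eta>) = length \<eta>"
  by (simp add: decreasing_def)

lemma mset_decreasing [simp]: "mset (decreasing \<eta>) = mset \<eta>"
  by (simp add: decreasing_def)

lemma decreasing_cong: "mset \<nu> = mset \<eta> \<Longrightarrow> decreasing \<nu> = decreasing \<eta>"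
  unfolding decreasing_def by (metis properties_for_sort sorted_sort mset_sort)

lemma decreasing_antimono:
  assumes "1 \<le> i" "i \<le> j" "j \<le> length \<eta>"
  shows "part (decreasing \<eta>) j \<le> part (decreasing \<eta>) i"
  using sorted_nth_mono[of "sort \<eta>" "length \<eta> - j" "length \<eta> - i"] assms
  by (simp add: decreasing_def part_def rev_nth)

definition sorts :: "nat list \<Rightarrow> (nat \<Rightarrow> nat) \<Rightarrow> bool" where
  "sorts \<eta> u \<longleftrightarrow> u permutes {1..length \<eta>} \<and> (\<forall>i\<in>{1..length \<eta>}. part \<eta> i = part (decreasing \<eta>) (u i))"

lemma sorts_exists: "\<exists>u. sorts \<eta> u"
proof -
  obtain f where f: "f permutes {..<length (decreasing \<eta>)}" "permute_list f (decreasing \<eta>) = \<eta>"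
    using mset_eq_permutation[of \<eta> "decreasing \<eta>"] by auto
  \<comment> \<open>\<open>f\<close> acts on positions counted from 0; \<open>u\<close> is its
    conjugate on positions counted from 1.\<close>
  define u where "u = (\<lambda>i. if i = 0 then 0 else Suc (f (i - 1)))"
  have fb: "f i < length \<eta> \<longleftrightarrow> i < length \<eta>" for i
    using permutes_in_image[OF f(1), of i] by simp
  have "u permutes {1..length \<eta>}"
  proof (rule bij_imp_permutes)
    have "inj_on u {1..length \<eta>}"
    proof (rule inj_onI)
      fix x y assume "x \<in> {1..length \<eta>}" "y \<in> {1..length \<eta>}" "u x = u y"
      then have "x \<ge> 1" "y \<ge> 1" "f (x - 1) = f (y - 1)" by (auto simp: u_def split: if_splits)
      moreover from this have "x - 1 = y - 1" using permutes_inj[OF f(1)] by (meson injD)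
      ultimately show "x = y" by linarith
    qed
    moreover have "u ` {1..length \<eta>} \<subseteq> {1..length \<eta>}"
    proof (rule image_subsetI)
      fix i assume "i \<in> {1..length \<eta>}"
      then have "i - 1 < length \<eta>" "i \<noteq> 0" by auto
      then show "u i \<in> {1..length \<eta>}" using fb[of "i - 1"] by (simp add: u_def)
    qed
    ultimately show "bij_betw u {1..length \<eta>} {1..length \<eta>}" by (simp add: bij_betw_def endo_inj_surj)
    fix i assume "i \<notin> {1..length \<eta>}"
    then show "u i = i" using f(1) by (cases i) (auto simp: u_def permutes_def)
  qed
  moreover have "part \<eta> i = part (decreasing \<eta>) (u i)" if "i \<in> {1..length \<eta>}" for i
    using that permute_list_nth[OF f(1), of "i - 1"] f(2) by (auto simp: part_def u_def)
  ultimately show ?thesis by (auto simp: sorts_def)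
qed

text \<open>Such a \<open>u\<close> maps \<open>rank_set \<eta> i\<close> bijectively onto
  \<open>{1..u i}\<close>, so \<open>u i\<close> is the rank.\<close>

lemma sorts_no_inversion_eq_rank:
  assumes "sorts \<eta> u" and "\<And>a b. 1 \<le> a \<Longrightarrow> a < b \<Longrightarrow> b \<le> length \<eta> \<Longrightarrow> part \<eta> a = part \<eta> b \<Longrightarrow> u a < u b"
  shows "u = rank_perm \<eta>"
proof
  fix i
  have p: "u permutes {1..length \<eta>}" using assms by (simp add: sorts_def)
  have d: "part \<eta> a = part (decreasing \<eta>) (u a)" if "1 \<le> a" "a \<le> length \<eta>" for a
    using assms that by (simp add: sorts_def)
  have r: "1 \<le> u a" "u a \<le> length \<eta>" if "1 \<le> a" "a \<le> length \<eta>" for a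
    using permutes_in_image[OF p, of a] that by auto
  show "u i = rank_perm \<eta> i"
  proof (cases "1 \<le> i \<and> i \<le> length \<eta>")
    case False
    then show ?thesis using p by (auto simp: rank_perm_def permutes_def)
  next
    case True
    have gt: "u a < u b" if "part \<eta> b < part \<eta> a" "1 \<le> a" "a \<le> length \<eta>" "1 \<le> b" "b \<le> length \<eta>" for a b
    proof (rule ccontr)
      assume "\<not> u a < u b"
      then have "part (decreasing \<eta>) (u a) \<le> part (decreasing \<eta>) (u b)"
        using r that by (intro decreasing_antimono) auto
      then show False using d that by simp
    qed
    have "b \<in> rank_set \<eta> i \<longleftrightarrow> u b \<in> {1..u i}" if "1 \<le> b" "b \<le> length \<eta>" for b
    proof -
      consider "part \<eta> i < part \<eta> b" | "part \<eta> b = part \<eta> i" "b < i" | "b = i"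
        | "part \<eta> b = part \<eta> i" "i < b" | "part \<eta> b < part \<eta> i" by linarith
      then show ?thesis
      proof cases
        case 1
        then show ?thesis using gt[of i b] that True r[OF that] by (simp add: rank_set_def)
      next
        case 2
        then show ?thesis using assms(2)[of b i] that True r[OF that] by (simp add: rank_set_def)
      next
        case 3
        then show ?thesis using that r[OF that] by (simp add: rank_set_def)
      next
        case 4
        then show ?thesis using assms(2)[of i b] that True by (simp add: rank_set_def)
      next
        case 5
        then show ?thesis using gt[of b i] that True by (simp add: rank_set_def)
      qed
    qed
    then have "u ` rank_set \<eta> i = {1..u i}"
    proof -
      assume *: "\<And>b. 1 \<le> b \<Longrightarrow> b \<le> length \<eta> \<Longrightarrow> b \<in> rank_set \<eta> i \<longleftrightarrow> u b \<in> {1..u i}"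
      show ?thesis
      proof
        show "u ` rank_set \<eta> i \<subseteq> {1..u i}"
        proof clarify
          fix b assume "b \<in> rank_set \<eta> i"
          moreover then have "1 \<le> b" "b \<le> length \<eta>" by (auto simp: rank_set_def)
          ultimately show "u b \<in> {1..u i}" using * by blast
        qed
        show "{1..u i} \<subseteq> u ` rank_set \<eta> i"
        proof
          fix c assume c: "c \<in> {1..u i}"
          then have "c \<in> {1..length \<eta>}" using r[of i] True by auto
          then have "c \<in> u ` {1..length \<eta>}" using permutes_image[OF p] by simp
          then obtain b where "b \<in> {1..length \<eta>}" "c = u b" by blast
          then show "c \<in> u ` rank_set \<eta> i" using * c by auto
        qed
      qed
    qed
    then have "card (rank_set \<eta> i) = u i"
      using card_image[OF inj_on_subset[OF permutes_inj[OF p] subset_UNIV], of "rank_set \<eta> i"] by simp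
    then show ?thesis using True by (simp add: rank_perm_def rank_eq_card)
  qed
qed

lemma sorts_shorter:
  assumes "sorts \<eta> u" "u \<noteq> rank_perm \<eta>"
  shows "\<exists>v. sorts \<eta> v \<and> card (inversions (length \<eta>) v) < card (inversions (length \<eta>) u)"
proof -
  obtain a b where ab: "1 \<le> a" "a < b" "b \<le> length \<eta>" "part \<eta> a = part \<eta> b" "\<not> u a < u b"
    using sorts_no_inversion_eq_rank assms by blast
  have p: "u permutes {1..length \<eta>}" using assms by (simp add: sorts_def)
  have "u a \<noteq> u b" using permutes_inj[OF p] ab by (metis injD less_irrefl)
  then have lt: "u b < u a" using ab by simp
  have "sorts \<eta> (u \<circ> transpose a b)"
    unfolding sorts_def
  proof (intro conjI ballI)
    show "u \<circ> transpose a b permutes {1..length \<eta>}"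
      using ab by (intro permutes_compose[OF permutes_swap_id p]) auto
    fix i assume "i \<in> {1..length \<eta>}"
    moreover have d: "part \<eta> j = part (decreasing \<eta>) (u j)" if "j \<in> {1..length \<eta>}" for j
      using assms that by (simp add: sorts_def)
    ultimately show "part \<eta> i = part (decreasing \<eta>) ((u \<circ> transpose a b) i)"
      using d[of a] d[of b] ab by (auto simp: transpose_def)
  qed
  then show ?thesis using inversions_transpose_less[OF ab(1-3) lt] by blast
qed

text \<open>Every sorting permutation other than \<open>rank_perm \<eta>\<close> can be shortened. A
  shortest one exists, so it must be \<open>rank_perm \<eta>\<close>.\<close>

lemma sorts_rank_perm: "sorts \<eta> (rank_perm \<eta>)"
  and rank_perm_minimal: "sorts \<eta> u \<Longrightarrow> u \<noteq> rank_perm \<eta> \<Longrightarrow>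
    card (inversions (length \<eta>) (rank_perm \<eta>)) < card (inversions (length \<eta>) u)"
proof -
  let ?c = "\<lambda>u. card (inversions (length \<eta>) u)"
  obtain u0 where u0: "sorts \<eta> u0" using sorts_exists by blast
  define v where "v = arg_min ?c (sorts \<eta>)"
  have v: "sorts \<eta> v" "\<And>u. sorts \<eta> u \<Longrightarrow> ?c v \<le> ?c u"
    using arg_min_nat_lemma[of "sorts \<eta>" u0 ?c] u0 by (auto simp: v_def)
  have veq: "v = rank_perm \<eta>"
    using sorts_shorter[OF v(1)] v(2) by (meson not_le)
  then show "sorts \<eta> (rank_perm \<eta>)" using v by simp
  assume u: "sorts \<eta> u" "u \<noteq> rank_perm \<eta>"
  obtain u' where "sorts \<eta> u'" "?c u' < ?c u" using sorts_shorter[OF u] by blast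
  then show "?c (rank_perm \<eta>) < ?c u" using v(2)[of u'] veq by simp
qed

lemma arg_min_unique:
  fixes f :: "'a \<Rightarrow> nat"
  assumes "P x" "\<And>y. P y \<Longrightarrow> y \<noteq> x \<Longrightarrow> f x < f y"
  shows "arg_min f P = x"
  using arg_min_nat_lemma[of P x f] assms by (metis leD)

lemma sort_perm_eq: "sort_perm \<eta> = rank_perm \<eta>"
proof -
  have "sort_perm \<eta> = arg_min (perm_length (length \<eta>)) (sorts \<eta>)"
    unfolding sort_perm_def sorts_def ..
  also have "\<dots> = rank_perm \<eta>"
  proof (rule arg_min_unique)
    fix u assume u: "sorts \<eta> u" "u \<noteq> rank_perm \<eta>"
    have "perm_length (length \<eta>) v = card (inversions (length \<eta>) v)" if "sorts \<eta> v" for v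
    proof -
      have p: "v permutes {1..length \<eta>}" using that by (simp add: sorts_def)
      show ?thesis
        using coxeter_length_inv[OF p] unfolding perm_length_eq[OF p] permutes_inv_inv[OF p] by simp
    qed
    then show "perm_length (length \<eta>) (rank_perm \<eta>) < perm_length (length \<eta>) u"
      using rank_perm_minimal[OF u] u sorts_rank_perm by simp
  qed (rule sorts_rank_perm)
  finally show ?thesis .
qed

lemma min_perm_eq: "min_perm \<eta> = inv (rank_perm \<eta>)"
  unfolding min_perm_def
proof (rule arg_min_unique)
  let ?N = "length \<eta>"
  have "part \<eta> (inv (rank_perm \<eta>) i) = part (decreasing \<eta>) i" if "i \<in> {1..?N}" for i
    using sorts_rank_perm[of \<eta>] permutes_in_image[OF permutes_inv[OF rank_perm_permutes[of \<eta>]], of i] that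
      permutes_inverses[OF rank_perm_permutes[of \<eta>], of i]
    by (auto simp: sorts_def)
  then show "inv (rank_perm \<eta>) permutes {1..?N} \<and>
    (\<forall>i\<in>{1..?N}. part \<eta> (inv (rank_perm \<eta>) i) = part (decreasing \<eta>) i)"
    using permutes_inv[OF rank_perm_permutes] by blast
  fix w assume w: "w permutes {1..?N} \<and> (\<forall>i\<in>{1..?N}. part \<eta> (w i) = part (decreasing \<eta>) i)"
    and ne: "w \<noteq> inv (rank_perm \<eta>)"
  then have p: "w permutes {1..?N}" by simp
  have "sorts \<eta> (inv w)"
    unfolding sorts_def
  proof (intro conjI ballI permutes_inv[OF p])
    fix i assume "i \<in> {1..?N}"
    then have "inv w i \<in> {1..?N}" using permutes_in_image[OF permutes_inv[OF p], of i] by simp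
    then have "part \<eta> (w (inv w i)) = part (decreasing \<eta>) (inv w i)" using w by blast
    then show "part \<eta> i = part (decreasing \<eta>) (inv w i)" using permutes_inverses[OF p] by simp
  qed
  moreover have "inv w \<noteq> rank_perm \<eta>" using ne permutes_inv_inv[OF p] by metis
  ultimately have "card (inversions ?N (rank_perm \<eta>)) < card (inversions ?N (inv w))"
    by (rule rank_perm_minimal)
  then show "perm_length ?N (inv (rank_perm \<eta>)) < perm_length ?N w"
    using perm_length_eq[OF p] perm_length_eq[OF permutes_inv[OF rank_perm_permutes[of \<eta>]]]
    by (simp add: permutes_inv_inv[OF rank_perm_permutes])
qed

section \<open>Comparison with dominance and Bruhat order\<close>

definition swap_at :: "nat \<Rightarrow> nat \<Rightarrow> nat list \<Rightarrow> nat list" where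
  "swap_at i j \<eta> = map (\<lambda>k. part \<eta> (transpose i j k)) [1..<Suc (length \<eta>)]"

lemma length_swap_at [simp]: "length (swap_at i j \<eta>) = length \<eta>"
  by (simp add: swap_at_def del: upt_Suc)

lemma part_swap_at: "1 \<le> k \<Longrightarrow> k \<le> length \<eta> \<Longrightarrow> part (swap_at i j \<eta>) k = part \<eta> (transpose i j k)"
  unfolding swap_at_def by (rule part_map)

lemma mset_swap_at:
  assumes "1 \<le> i" "i < j" "j \<le> length \<eta>"
  shows "mset (swap_at i j \<eta>) = mset \<eta>"
proof -
  have "swap_at i j \<eta> = \<eta>[i - 1 := \<eta> ! (j - 1), j - 1 := \<eta> ! (i - 1)]"
  proof (rule nth_equalityI)
    fix k assume k: "k < length (swap_at i j \<eta>)"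
    then have "swap_at i j \<eta> ! k = part (swap_at i j \<eta>) (Suc k)" by (simp add: part_def)
    also have "\<dots> = part \<eta> (transpose i j (Suc k))" using k by (intro part_swap_at) auto
    also have "\<dots> = \<eta>[i - 1 := \<eta> ! (j - 1), j - 1 := \<eta> ! (i - 1)] ! k"
    proof -
      consider "i = Suc k" | "j = Suc k" | "i \<noteq> Suc k" "j \<noteq> Suc k" by blast
      then show ?thesis using assms k by cases (auto simp: part_def nth_list_update)
    qed
    finally show "swap_at i j \<eta> ! k = \<eta>[i - 1 := \<eta> ! (j - 1), j - 1 := \<eta> ! (i - 1)] ! k" .
  qed simp
  then show ?thesis using assms mset_swap[of "j - 1" \<eta> "i - 1"] by simp
qed

lemma bruhat_less_trans: "bruhat_less N u v \<Longrightarrow> bruhat_less N v w \<Longrightarrow> bruhat_less N u w"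
  unfolding bruhat_less_def by (rule tranclp_trans)

lemma bruhat_less_length: "bruhat_less N u v \<Longrightarrow> perm_length N u < perm_length N v"
  unfolding bruhat_less_def by (induction rule: tranclp_induct) auto

text \<open>The transposition reverses positions relative to those strictly between \<open>i\<close>
  and \<open>j\<close>, which affects ranks only through ties; \<open>mid\<close> excludes
  these.\<close>

lemma rank_perm_swap_at:
  assumes "1 \<le> i" "i < j" "j \<le> length \<eta>" "part \<eta> j < part \<eta> i"
    and mid: "\<And>k. i < k \<Longrightarrow> k < j \<Longrightarrow> part \<eta> k \<noteq> part \<eta> i \<and> part \<eta> k \<noteq> part \<eta> j"
  shows "rank_perm (swap_at i j \<eta>) = rank_perm \<eta> \<circ> transpose i j"
proof
  fix k
  let ?t = "transpose i j"
  have tb: "1 \<le> ?t l \<and> ?t l \<le> length \<eta> \<longleftrightarrow> 1 \<le> l \<and> l \<le> length \<eta>" for l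
    using assms by (auto simp: transpose_def)
  show "rank_perm (swap_at i j \<eta>) k = (rank_perm \<eta> \<circ> ?t) k"
  proof (cases "1 \<le> k \<and> k \<le> length \<eta>")
    case False
    then show ?thesis using assms tb[of k] by (auto simp: rank_perm_def transpose_def)
  next
    case True
    have "rank (swap_at i j \<eta>) k = rank \<eta> (?t k)"
    proof (rule rank_transfer[where h = ?t])
      show "bij_betw ?t {1..length (swap_at i j \<eta>)} {1..length \<eta>}"
        using permutes_imp_bij[OF permutes_swap_id[of i "{1..length \<eta>}" j]] assms by simp
      show "l \<in> rank_set (swap_at i j \<eta>) k \<longleftrightarrow> ?t l \<in> rank_set \<eta> (?t k)"
        if l: "l \<in> {1..length (swap_at i j \<eta>)}" for l
      proof -
        have "l \<le> k \<longleftrightarrow> ?t l \<le> ?t k" if eq: "part \<eta> (?t l) = part \<eta> (?t k)"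
        proof -
          consider "l = k" | "l = i" "k = j" | "l = j" "k = i" | "l = i" "k \<noteq> i" "k \<noteq> j" | "l = j" "k \<noteq> i" "k \<noteq> j"
            | "k = i" "l \<noteq> i" "l \<noteq> j" | "k = j" "l \<noteq> i" "l \<noteq> j" | "k \<noteq> i" "k \<noteq> j" "l \<noteq> i" "l \<noteq> j"
            by blast
          then show ?thesis
          proof cases
            case 4 then show ?thesis using eq mid[of k] assms(2) by (cases "k < i"; cases "j < k") auto
          next
            case 5 then show ?thesis using eq mid[of k] assms(2) by (cases "k < i"; cases "j < k") auto
          next
            case 6 then show ?thesis using eq mid[of l] assms(2) by (cases "l < i"; cases "j < l") auto
          next
            case 7 then show ?thesis using eq mid[of l] assms(2) by (cases "l < i"; cases "j < l") auto
          qed (use eq assms(4) in auto)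
        qed
        then show ?thesis using l True tb[of l] by (auto simp: rank_set_def part_swap_at)
      qed
    qed (use True tb[of k] in auto)
    then show ?thesis using True tb[of k] by (simp add: rank_perm_def)
  qed
qed

lemma bruhat_swap_at_adjacent:
  assumes "1 \<le> i" "i < j" "j \<le> length \<eta>" "part \<eta> j < part \<eta> i"
    and mid: "\<And>k. i < k \<Longrightarrow> k < j \<Longrightarrow> part \<eta> k \<noteq> part \<eta> i \<and> part \<eta> k \<noteq> part \<eta> j"
  shows "bruhat_less (length \<eta>) (min_perm \<eta>) (min_perm (swap_at i j \<eta>))"
proof -
  let ?N = "length \<eta>" and ?R = "rank_perm \<eta>" and ?R' = "rank_perm (swap_at i j \<eta>)"
  have p: "?R permutes {1..?N}" by (rule rank_perm_permutes)
  have p': "?R' permutes {1..?N}" using rank_perm_permutes[of "swap_at i j \<eta>"] by simp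
  have R': "?R' = ?R \<circ> transpose i j" by (rule rank_perm_swap_at[OF assms])
  \<comment> \<open>For the inverses the transposition of positions becomes one of values, applied
    on the right as in \<open>bruhat_less\<close>.\<close>
  have inv': "inv ?R' = inv ?R \<circ> transpose (?R i) (?R j)"
  proof -
    have "inv ?R' = transpose i j \<circ> inv ?R"
      unfolding R' using permutes_bij[OF p] by (simp add: o_inv_distrib)
    moreover have "inv ?R (transpose (?R i) (?R j) k) = transpose i j (inv ?R k)" for k
      using permutes_inverses[OF p] by (auto simp: transpose_def)
    ultimately show ?thesis by (simp add: fun_eq_iff)
  qed
  have Rij: "?R i < ?R j" "?R i \<in> {1..?N}" "?R j \<in> {1..?N}"
    using rank_less[of i \<eta> j] rank_bounds[of i \<eta>] rank_bounds[of j \<eta>] assms by (auto simp: rank_perm_def)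
  have "card (inversions ?N (?R' \<circ> transpose i j)) < card (inversions ?N ?R')"
    using assms Rij by (intro inversions_transpose_less) (auto simp: R')
  moreover have "?R' \<circ> transpose i j = ?R" unfolding R' by (simp add: comp_assoc)
  ultimately have "perm_length ?N (inv ?R) < perm_length ?N (inv ?R')"
    unfolding perm_length_eq[OF permutes_inv[OF p]] perm_length_eq[OF permutes_inv[OF p']]
    by (simp add: permutes_inv_inv[OF p] permutes_inv_inv[OF p'])
  then show ?thesis
    unfolding bruhat_less_def min_perm_eq using permutes_inv[OF p] inv' Rij
    by (intro tranclp.r_into_trancl conjI bexI[of _ "?R i"] bexI[of _ "?R j"]) auto
qed

text \<open>An intermediate part equal to one of the two exchanged ones splits the exchange into two
  over shorter distances, each again of a larger part with a later smaller one.\<close>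

lemma bruhat_swap_at:
  assumes "1 \<le> i" "i < j" "j \<le> length \<eta>" "part \<eta> j < part \<eta> i"
  shows "bruhat_less (length \<eta>) (min_perm \<eta>) (min_perm (swap_at i j \<eta>))"
  using assms
proof (induction "j - i" arbitrary: i j \<eta> rule: less_induct)
  case less
  show ?case
  proof (cases "\<exists>k. i < k \<and> k < j \<and> (part \<eta> k = part \<eta> i \<or> part \<eta> k = part \<eta> j)")
    case False
    then show ?thesis using less.prems by (intro bruhat_swap_at_adjacent) auto
  next
    case True
    then obtain k where k: "i < k" "k < j" and c: "part \<eta> k = part \<eta> i \<or> part \<eta> k = part \<eta> j" by blast
    from c show ?thesis
    proof
      assume e: "part \<eta> k = part \<eta> i"
      have 1: "bruhat_less (length \<eta>) (min_perm \<eta>) (min_perm (swap_at k j \<eta>))"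
        using less.prems k e by (intro less.hyps) auto
      have "bruhat_less (length (swap_at k j \<eta>)) (min_perm (swap_at k j \<eta>)) (min_perm (swap_at i k (swap_at k j \<eta>)))"
        using less.prems k e by (intro less.hyps) (auto simp: part_swap_at)
      moreover have "swap_at i k (swap_at k j \<eta>) = swap_at i j \<eta>"
        using less.prems k e by (intro composition_eqI) (auto simp: part_swap_at transpose_def)
      ultimately show ?thesis using bruhat_less_trans[OF 1] by simp
    next
      assume e: "part \<eta> k = part \<eta> j"
      have 1: "bruhat_less (length \<eta>) (min_perm \<eta>) (min_perm (swap_at i k \<eta>))"
        using less.prems k e by (intro less.hyps) auto
      have "bruhat_less (length (swap_at i k \<eta>)) (min_perm (swap_at i k \<eta>)) (min_perm (swap_at k j (swap_at i k \<eta>)))"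
        using less.prems k e by (intro less.hyps) (auto simp: part_swap_at)
      moreover have "swap_at k j (swap_at i k \<eta>) = swap_at i j \<eta>"
        using less.prems k e by (intro composition_eqI) (auto simp: part_swap_at transpose_def)
      ultimately show ?thesis using bruhat_less_trans[OF 1] by simp
    qed
  qed
qed

section \<open>Dominance through sums over subsets\<close>

definition top_sum :: "nat \<Rightarrow> nat list \<Rightarrow> nat" where
  "top_sum k \<eta> = sum_list (take k (decreasing \<eta>))"

lemma sum_list_eq_sum_part: "sum_list xs = (\<Sum>r\<in>{1..length xs}. part xs r)"
  unfolding One_nat_def sum.atLeast1_atMost_eq by (simp add: sum_list_sum_nth part_def atLeast0LessThan)

lemma top_sum_eq: "k \<le> length \<eta> \<Longrightarrow> top_sum k \<eta> = (\<Sum>r\<in>{1..k}. part (decreasing \<eta>) r)"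
  unfolding top_sum_def sum_list_eq_sum_part by (rule sum.cong) (auto simp: part_def)

lemma top_sum_beyond:
  assumes "length \<eta> \<le> k"
  shows "top_sum k \<eta> = sum_list \<eta>"
proof -
  have "take k (decreasing \<eta>) = decreasing \<eta>" using assms by simp
  then show ?thesis unfolding top_sum_def by (metis mset_decreasing sum_mset_sum_list)
qed

lemma sum_le_initial_sum:
  fixes f :: "nat \<Rightarrow> nat"
  assumes "A \<subseteq> {1..N}" "\<And>i j. 1 \<le> i \<Longrightarrow> i \<le> j \<Longrightarrow> j \<le> N \<Longrightarrow> f j \<le> f i"
  shows "sum f A \<le> sum f {1..card A}"
  using assms(1)
proof (induction "card A" arbitrary: A)
  case 0
  then have "A = {}" using finite_subset by fastforce
  then show ?case by simp
next
  case (Suc k)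
  have fin: "finite A" using Suc(3) finite_subset by blast
  have ne: "A \<noteq> {}" using Suc(2) by auto
  define M where "M = Max A"
  have M: "M \<in> A" "A \<subseteq> {1..M}" using fin ne Suc(3) by (auto simp: M_def)
  have "Suc k \<le> M" using card_mono[OF _ M(2)] Suc(2) by simp
  then have "f M \<le> f (Suc k)" using M(1) Suc(3) by (intro assms(2)) auto
  moreover have k: "k = card (A - {M})" using Suc(2) M(1) fin by simp
  have "sum f (A - {M}) \<le> sum f {1..card (A - {M})}" using Suc.hyps(1)[OF k] Suc.prems by blast
  ultimately have "f M + sum f (A - {M}) \<le> f (Suc k) + sum f {1..k}" unfolding k[symmetric] by (rule add_mono)
  then show ?case using sum.remove[OF fin M(1), of f] Suc(2)[symmetric] by (simp add: add.commute)
qed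

text \<open>Together with \<open>top_sum_attained\<close> this makes \<open>top_sum k \<eta>\<close>
  the maximum of the sums over \<open>k\<close> positions, so dominance can be compared without
  sorting.\<close>

lemma top_sum_ge:
  assumes "S \<subseteq> {1..length \<eta>}"
  shows "(\<Sum>a\<in>S. part \<eta> a) \<le> top_sum (card S) \<eta>"
proof -
  let ?R = "rank_perm \<eta>"
  have p: "?R permutes {1..length \<eta>}" by (rule rank_perm_permutes)
  have inj: "inj_on ?R S" using permutes_inj[OF p] by (rule inj_on_subset) simp
  have "(\<Sum>a\<in>S. part \<eta> a) = (\<Sum>a\<in>S. part (decreasing \<eta>) (?R a))"
    using sorts_rank_perm[of \<eta>] assms by (intro sum.cong) (auto simp: sorts_def)
  also have "\<dots> = sum (part (decreasing \<eta>)) (?R ` S)"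
    by (simp add: sum.reindex[OF inj])
  also have "\<dots> \<le> sum (part (decreasing \<eta>)) {1..card (?R ` S)}"
  proof (rule sum_le_initial_sum[where N = "length \<eta>"])
    show "?R ` S \<subseteq> {1..length \<eta>}" using permutes_image[OF p] assms by blast
  qed (rule decreasing_antimono)
  also have "\<dots> = top_sum (card S) \<eta>"
    using card_mono[OF _ assms] by (simp add: top_sum_eq card_image[OF inj])
  finally show ?thesis .
qed

lemma top_sum_attained:
  assumes "k \<le> length \<eta>"
  shows "\<exists>S. S \<subseteq> {1..length \<eta>} \<and> card S = k \<and> (\<Sum>a\<in>S. part \<eta> a) = top_sum k \<eta>"
proof -
  let ?R = "rank_perm \<eta>"
  have p: "inv ?R permutes {1..length \<eta>}" by (rule permutes_inv[OF rank_perm_permutes])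
  have inj: "inj_on (inv ?R) {1..k}" using permutes_inj[OF p] by (rule inj_on_subset) simp
  define S where "S = inv ?R ` {1..k}"
  have S: "S \<subseteq> {1..length \<eta>}"
    unfolding S_def using permutes_image[OF p] assms by (metis image_mono atLeastatMost_subset_iff order_refl)
  have "(\<Sum>a\<in>S. part \<eta> a) = (\<Sum>a\<in>S. part (decreasing \<eta>) (?R a))"
    using sorts_rank_perm[of \<eta>] S by (intro sum.cong) (auto simp: sorts_def)
  also have "\<dots> = (\<Sum>r\<in>{1..k}. part (decreasing \<eta>) r)"
    unfolding S_def sum.reindex[OF inj] using permutes_inverses[OF rank_perm_permutes[of \<eta>]] by simp
  finally have "(\<Sum>a\<in>S. part \<eta> a) = top_sum k \<eta>" using assms by (simp add: top_sum_eq)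
  moreover have "card S = k" unfolding S_def card_image[OF inj] by simp
  ultimately show ?thesis using S by blast
qed

text \<open>Take \<open>k\<close> positions optimal for \<nu>. If they contain both or neither of
  \<open>i\<close> and \<open>j\<close>, their sum is the same for \<eta>; otherwise replace the one
  they contain by the position \<open>m\<close> of the larger of the two parts of \<eta>.\<close>

lemma top_sum_mono:
  assumes len: "length \<nu> = length \<eta>" and ij: "1 \<le> i" "i < j" "j \<le> length \<eta>"
    and same: "\<And>k. 1 \<le> k \<Longrightarrow> k \<le> length \<eta> \<Longrightarrow> k \<noteq> i \<Longrightarrow> k \<noteq> j \<Longrightarrow> part \<nu> k = part \<eta> k"
    and sum: "part \<nu> i + part \<nu> j = part \<eta> i + part \<eta> j"
    and max: "max (part \<nu> i) (part \<nu> j) < max (part \<eta> i) (part \<eta> j)"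
  shows "sum_list \<nu> = sum_list \<eta>" "top_sum k \<nu> \<le> top_sum k \<eta>"
proof -
  have rest: "(\<Sum>k\<in>A - {i, j}. part \<nu> k) = (\<Sum>k\<in>A - {i, j}. part \<eta> k)" if "A \<subseteq> {1..length \<eta>}" for A
    by (rule sum.cong) (use that in \<open>auto simp: same\<close>)
  have two: "(\<Sum>k\<in>A. part \<kappa> k) = (if i \<in> A then part \<kappa> i else 0) + (if j \<in> A then part \<kappa> j else 0) +
      (\<Sum>k\<in>A - {i, j}. part \<kappa> k)" if "A \<subseteq> {1..length \<eta>}" for A \<kappa>
  proof -
    have fin: "finite A" using that finite_subset by blast
    have "(\<Sum>k\<in>A. part \<kappa> k) = (\<Sum>k\<in>A \<inter> {i, j}. part \<kappa> k) + (\<Sum>k\<in>A - {i, j}. part \<kappa> k)"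
      using sum.Int_Diff[OF fin] .
    moreover have "A \<inter> {i, j} = (if i \<in> A then {i} else {}) \<union> (if j \<in> A then {j} else {})" by auto
    ultimately show ?thesis using ij by auto
  qed
  show eq: "sum_list \<nu> = sum_list \<eta>"
    unfolding sum_list_eq_sum_part len two[OF order_refl] rest[OF order_refl] using ij sum by simp
  show "top_sum k \<nu> \<le> top_sum k \<eta>"
  proof (cases "k \<le> length \<eta>")
    case False
    then show ?thesis using eq len by (simp add: top_sum_beyond)
  next
    case True
    then obtain S where S: "S \<subseteq> {1..length \<eta>}" "card S = k" "(\<Sum>a\<in>S. part \<nu> a) = top_sum k \<nu>"
      using top_sum_attained[of k \<nu>] len by auto
    have fin: "finite S" using S finite_subset by blast
    show ?thesis
    proof (cases "i \<in> S \<longleftrightarrow> j \<in> S")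
      case True
      then have "(\<Sum>a\<in>S. part \<nu> a) = (\<Sum>a\<in>S. part \<eta> a)"
        unfolding two[OF S(1)] rest[OF S(1)] using sum by auto
      then show ?thesis using top_sum_ge[OF S(1)] S by simp
    next
      case False
      define m where "m = (if part \<eta> i < part \<eta> j then j else i)"
      define S' where "S' = insert m (S - {i, j})"
      have m: "m \<in> {1..length \<eta>}" "m \<in> {i, j}" "part \<eta> m = max (part \<eta> i) (part \<eta> j)"
        using ij by (auto simp: m_def)
      have S': "S' \<subseteq> {1..length \<eta>}" using S m by (auto simp: S'_def)
      have card: "card S' = k"
      proof -
        define n where "n = (if i \<in> S then i else j)"
        have n: "n \<in> S" "S - {i, j} = S - {n}" using False by (auto simp: n_def)
        have "m \<notin> S - {i, j}" using m by blast
        then have "card S' = Suc (card (S - {n}))" unfolding S'_def n(2)[symmetric] using fin by simp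
        also have "\<dots> = k" using card_Suc_Diff1[OF fin n(1)] S by simp
        finally show ?thesis .
      qed
      have "(\<Sum>a\<in>S. part \<nu> a) \<le> part \<eta> m + (\<Sum>a\<in>S - {i, j}. part \<eta> a)"
        unfolding two[OF S(1)] rest[OF S(1)] using False max m(3) by auto
      also have "\<dots> = (\<Sum>a\<in>S'. part \<eta> a)"
      proof -
        have "m \<notin> S - {i, j}" using m by blast
        then show ?thesis using fin by (simp add: S'_def)
      qed
      also have "\<dots> \<le> top_sum k \<eta>" using top_sum_ge[OF S'] card by simp
      finally show ?thesis using S by simp
    qed
  qed
qed

lemma square_sum_eq: "square_sum \<eta> = sum_mset (image_mset (\<lambda>x. x ^ 2) (mset \<eta>))"
proof -
  have "square_sum \<eta> = sum_list (map (\<lambda>x. x ^ 2) \<eta>)"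
    unfolding square_sum_def sum_list_eq_sum_part by (simp, rule sum.cong) (auto simp: part_def)
  then show ?thesis by (simp flip: sum_mset_sum_list)
qed

text \<open>A transitive invariant of \<open>below\<close> that implies \<open>comp_less\<close>.
  Since \<open>square_sum\<close> depends only on the decreasing rearrangement, its drop certifies
  strict dominance and survives composition with steps of either kind.\<close>

definition below_dominance :: "nat list \<Rightarrow> nat list \<Rightarrow> bool" where
  "below_dominance \<nu> \<eta> \<longleftrightarrow> length \<nu> = length \<eta> \<and> sum_list \<nu> = sum_list \<eta> \<and>
    (\<forall>k. top_sum k \<nu> \<le> top_sum k \<eta>) \<and>
    (square_sum \<nu> < square_sum \<eta> \<or>
     decreasing \<nu> = decreasing \<eta> \<and> bruhat_less (length \<eta>) (min_perm \<eta>) (min_perm \<nu>))"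

lemma step_below_dominance:
  assumes "step_below \<nu> \<eta>"
  shows "below_dominance \<nu> \<eta>"
proof -
  let ?N = "length \<eta>"
  from assms(1) obtain i j where len: "length \<nu> = ?N" and ij: "1 \<le> i" "i < j" "j \<le> ?N"
    and same: "\<And>k. 1 \<le> k \<Longrightarrow> k \<le> ?N \<Longrightarrow> k \<noteq> i \<Longrightarrow> k \<noteq> j \<Longrightarrow> part \<nu> k = part \<eta> k"
    and sum: "part \<nu> i + part \<nu> j = part \<eta> i + part \<eta> j"
    and cases: "max (part \<nu> i) (part \<nu> j) < max (part \<eta> i) (part \<eta> j) \<or>
      part \<nu> i = part \<eta> j \<and> part \<nu> j = part \<eta> i \<and> part \<eta> j < part \<eta> i"
    by (auto simp: step_below_def)
  from cases show ?thesis
  proof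
    assume max: "max (part \<nu> i) (part \<nu> j) < max (part \<eta> i) (part \<eta> j)"
    have s: "(\<Sum>k\<in>{1..?N} - {i, j}. part \<nu> k ^ 2) = (\<Sum>k\<in>{1..?N} - {i, j}. part \<eta> k ^ 2)"
      by (rule sum.cong) (auto simp: same)
    have "square_sum \<nu> < square_sum \<eta>"
      using square_sum_less[OF sum max]
      unfolding square_sum_def len sum_two_terms[OF ij] s by simp
    then show ?thesis
      using top_sum_mono[OF len ij same sum max] len by (simp add: below_dominance_def)
  next
    assume sw: "part \<nu> i = part \<eta> j \<and> part \<nu> j = part \<eta> i \<and> part \<eta> j < part \<eta> i"
    then have \<nu>: "\<nu> = swap_at i j \<eta>"
      using len same by (intro composition_eqI) (auto simp: part_swap_at transpose_def)
    have m: "mset \<nu> = mset \<eta>" unfolding \<nu> by (rule mset_swap_at[OF ij])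
    then have "decreasing \<nu> = decreasing \<eta>" by (rule decreasing_cong)
    moreover have "sum_list \<nu> = sum_list \<eta>" using m by (metis sum_mset_sum_list)
    moreover have "bruhat_less ?N (min_perm \<eta>) (min_perm \<nu>)"
      unfolding \<nu> using bruhat_swap_at[OF ij] sw by blast
    ultimately show ?thesis using len by (simp add: below_dominance_def top_sum_def)
  qed
qed

lemma decreasing_eq_imp_mset_eq: "decreasing \<nu> = decreasing \<eta> \<Longrightarrow> mset \<nu> = mset \<eta>"
  using mset_decreasing by metis

lemma below_dominance_trans:
  assumes "below_dominance \<nu> \<eta>" "below_dominance \<eta> \<kappa>"
  shows "below_dominance \<nu> \<kappa>"
proof -
  have 1: "length \<nu> = length \<kappa>" "sum_list \<nu> = sum_list \<kappa>" "top_sum k \<nu> \<le> top_sum k \<kappa>" for k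
    using assms by (auto simp: below_dominance_def intro: order.trans)
  have sq: "square_sum \<mu> = square_sum \<mu>'" if "decreasing \<mu> = decreasing \<mu>'" for \<mu> \<mu>'
    unfolding square_sum_eq decreasing_eq_imp_mset_eq[OF that] ..
  show ?thesis
  proof (cases "decreasing \<nu> = decreasing \<eta> \<and> decreasing \<eta> = decreasing \<kappa>")
    case True
    then have "bruhat_less (length \<kappa>) (min_perm \<kappa>) (min_perm \<eta>)" "bruhat_less (length \<kappa>) (min_perm \<eta>) (min_perm \<nu>)"
      using assms sq[of \<nu> \<eta>] sq[of \<eta> \<kappa>] by (auto simp: below_dominance_def)
    then show ?thesis using 1 True bruhat_less_trans by (auto simp: below_dominance_def)
  next
    case False
    then have "square_sum \<nu> < square_sum \<kappa>"
      using assms sq[of \<nu> \<eta>] sq[of \<eta> \<kappa>] by (auto simp: below_dominance_def)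
    then show ?thesis using 1 by (auto simp: below_dominance_def)
  qed
qed

lemma below_imp_comp_less:
  assumes "below \<nu> \<eta>"
  shows "comp_less \<nu> \<eta>"
proof -
  have "below_dominance \<nu> \<eta>"
    using assms by (induction rule: tranclp_induct) (auto intro: step_below_dominance below_dominance_trans)
  moreover have "sum_list (decreasing \<kappa>) = sum_list \<kappa>" for \<kappa>
    by (metis mset_decreasing sum_mset_sum_list)
  moreover have "decreasing \<nu> \<noteq> decreasing \<eta>" if "square_sum \<nu> < square_sum \<eta>"
    using that decreasing_eq_imp_mset_eq[of \<nu> \<eta>] by (auto simp: square_sum_eq)
  ultimately show ?thesis
    by (auto simp: below_dominance_def comp_less_def dominance_less_def top_sum_def)
qed

lemma comp_less_irrefl: "\<not> comp_less \<eta> \<eta>"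
  unfolding comp_less_def dominance_less_def using bruhat_less_length by blast

lemma comp_less_sum:
  assumes "comp_less \<nu> \<eta>"
  shows "length \<nu> = length \<eta>" "sum_list \<nu> = sum_list \<eta>"
proof -
  have "sum_list (decreasing \<kappa>) = sum_list \<kappa>" for \<kappa>
    by (metis mset_decreasing sum_mset_sum_list)
  then show "length \<nu> = length \<eta>" "sum_list \<nu> = sum_list \<eta>"
    using assms by (auto simp: comp_less_def dominance_less_def) metis
qed

text \<open>The sum in \<open>is_nonsym_macdonald\<close> runs over this set; over an infinite set
  its value would be 0 by convention.\<close>

lemma finite_comp_less: "finite {\<nu>. comp_less \<nu> \<eta>}"
proof (rule finite_subset)
  show "{\<nu>. comp_less \<nu> \<eta>} \<subseteq> {\<nu>. set \<nu> \<subseteq> {..sum_list \<eta>} \<and> length \<nu> = length \<eta>}"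
    using comp_less_sum member_le_sum_list by fastforce
qed (rule finite_lists_length_eq, simp)

section \<open>Coefficients of monomials and identification with the defined polynomials\<close>

definition exponent :: "nat list \<Rightarrow> nat \<Rightarrow>\<^sub>0 nat" where
  "exponent \<nu> = (\<Sum>i\<in>{1..length \<nu>}. Poly_Mapping.single i (part \<nu> i))"

lemma lookup_exponent: "1 \<le> i \<Longrightarrow> i \<le> length \<nu> \<Longrightarrow> Poly_Mapping.lookup (exponent \<nu>) i = part \<nu> i"
  unfolding exponent_def by (simp add: lookup_sum lookup_single when_def)

lemma exponent_eq_iff: "length \<nu> = length \<eta> \<Longrightarrow> exponent \<nu> = exponent \<eta> \<longleftrightarrow> \<nu> = \<eta>"
  using lookup_exponent[of _ \<nu>] lookup_exponent[of _ \<eta>] composition_eqI[of \<nu> \<eta>] by metis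

lemma monomial_eq_single: "monomial \<nu> = Poly_Mapping.single (exponent \<nu>) 1"
proof -
  have p: "Poly_Mapping.single (Poly_Mapping.single i n) 1 = Var i ^ n" for i n
    using single_eq_power_product[of "Poly_Mapping.single i n" 1] by simp
  have "Poly_Mapping.single (\<Sum>i\<in>A. Poly_Mapping.single i (part \<nu> i)) 1 = (\<Prod>i\<in>A. Var i ^ part \<nu> i)"
    if "finite A" for A
    using that
  proof (induction A rule: finite_induct)
    case (insert x A)
    then show ?case using mult_single[of "Poly_Mapping.single x (part \<nu> x)" "1 :: qt_field" _ 1]
      by (simp add: p[symmetric]) (metis mult_1 mult_single)
  qed simp
  then show ?thesis unfolding monomial_def exponent_def by simp
qed

definition coefficient :: "nat list \<Rightarrow> qt_mpoly \<Rightarrow> qt_field" where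
  "coefficient \<eta> f = Poly_Mapping.lookup f (exponent \<eta>)"

lemma coefficient_add: "coefficient \<eta> (f + g) = coefficient \<eta> f + coefficient \<eta> g"
  by (simp add: coefficient_def lookup_add)

lemma coefficient_scale: "coefficient \<eta> (Const c * f) = c * coefficient \<eta> f"
  unfolding Const_def mult_map_scale_conv_mult[symmetric] coefficient_def
  by (simp add: map.rep_eq when_def)

lemma coefficient_monomial: "length \<nu> = length \<eta> \<Longrightarrow> coefficient \<eta> (monomial \<nu>) = (if \<nu> = \<eta> then 1 else 0)"
  by (simp add: coefficient_def monomial_eq_single lookup_single when_def exponent_eq_iff)

lemma coefficient_comp_less_span:
  assumes "f \<in> mpoly.span (monomial ` {\<nu>. comp_less \<nu> \<eta>})"
  shows "coefficient \<eta> f = 0"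
  using assms
proof (induction f rule: mpoly.span_induct_alt)
  case base
  show ?case by (simp add: coefficient_def)
next
  case (step c b f)
  then obtain \<nu> where \<nu>: "b = monomial \<nu>" "comp_less \<nu> \<eta>" by blast
  then have "\<nu> \<noteq> \<eta>" using comp_less_irrefl by auto
  then show ?case using step \<nu> comp_less_sum(1)[OF \<nu>(2)]
    by (simp add: coefficient_add coefficient_scale coefficient_monomial)
qed

lemma strict_span_subset_comp_less: "strict_span \<eta> \<subseteq> mpoly.span (monomial ` {\<nu>. comp_less \<nu> \<eta>})"
  unfolding strict_span_def by (rule mpoly.span_mono) (auto dest: below_imp_comp_less)

lemma is_nonsym_macdonald_iff:
  "is_nonsym_macdonald \<eta> f \<longleftrightarrow>
    f - monomial \<eta> \<in> mpoly.span (monomial ` {\<nu>. comp_less \<nu> \<eta>}) \<and> Y_eigen \<eta> f"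
proof -
  let ?A = "{\<nu>. comp_less \<nu> \<eta>}"
  \<comment> \<open>The definition sums over compositions, the span over their monomials;
    injectivity translates between the two.\<close>
  have inj: "inj_on monomial ?A"
  proof (rule inj_onI)
    fix \<nu> \<nu>' assume "\<nu> \<in> ?A" "\<nu>' \<in> ?A" "monomial \<nu> = monomial \<nu>'"
    then have "length \<nu> = length \<nu>'" using comp_less_sum(1) by simp
    moreover have "exponent \<nu> = exponent \<nu>'"
      using \<open>monomial \<nu> = monomial \<nu>'\<close> unfolding monomial_eq_single
      by (metis lookup_single_eq lookup_single_not_eq one_neq_zero)
    ultimately show "\<nu> = \<nu>'" using exponent_eq_iff by blast
  qed
  have "(\<exists>b. f = monomial \<eta> + (\<Sum>\<nu> | comp_less \<nu> \<eta>. Const (b \<nu>) * monomial \<nu>)) \<longleftrightarrow>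
    f - monomial \<eta> \<in> mpoly.span (monomial ` ?A)"
  proof
    assume "\<exists>b. f = monomial \<eta> + (\<Sum>\<nu> | comp_less \<nu> \<eta>. Const (b \<nu>) * monomial \<nu>)"
    then show "f - monomial \<eta> \<in> mpoly.span (monomial ` ?A)"
      by (auto intro!: mpoly.span_sum mpoly.span_scale[OF mpoly.span_base])
  next
    assume "f - monomial \<eta> \<in> mpoly.span (monomial ` ?A)"
    then obtain u where "f - monomial \<eta> = (\<Sum>v\<in>monomial ` ?A. Const (u v) * v)"
      using mpoly.span_finite[OF finite_imageI[OF finite_comp_less, of monomial \<eta>]] by auto
    then have "f = monomial \<eta> + (\<Sum>\<nu> | comp_less \<nu> \<eta>. Const (u (monomial \<nu>)) * monomial \<nu>)"
      unfolding sum.reindex[OF inj] by (simp add: algebra_simps)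
    then show "\<exists>b. f = monomial \<eta> + (\<Sum>\<nu> | comp_less \<nu> \<eta>. Const (b \<nu>) * monomial \<nu>)"
      by (rule exI[of _ "\<lambda>\<nu>. u (monomial \<nu>)"])
  qed
  then show ?thesis unfolding is_nonsym_macdonald_def Y_eigen_def spectral_def by auto
qed

text \<open>Any competitor is an eigenvector with the same spectral vector, hence a multiple of
  \<open>E_poly \<eta>\<close>, and the coefficient of the leading monomial makes the multiple
  1.\<close>

theorem nonsym_macdonald_eq:
  assumes "\<eta> \<noteq> []"
  shows "nonsym_macdonald \<eta> = E_poly \<eta>"
  unfolding nonsym_macdonald_def
proof (rule the_equality)
  have E: "is_nonsym_macdonald \<eta> (E_poly \<eta>)"
    unfolding is_nonsym_macdonald_iff
    using E_poly_triangular[OF assms] strict_span_subset_comp_less Y_eigen_E_poly[OF assms] by blast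
  then show "is_nonsym_macdonald \<eta> (E_poly \<eta>)" .
  have one: "coefficient \<eta> g = 1" if "is_nonsym_macdonald \<eta> g" for g
  proof -
    have "coefficient \<eta> (g - monomial \<eta>) = 0"
      using that coefficient_comp_less_span by (simp add: is_nonsym_macdonald_iff)
    moreover have "coefficient \<eta> g = coefficient \<eta> (g - monomial \<eta>) + coefficient \<eta> (monomial \<eta>)"
      by (simp flip: coefficient_add)
    ultimately show ?thesis by (simp add: coefficient_monomial)
  qed
  fix f assume f: "is_nonsym_macdonald \<eta> f"
  have sub: "mpoly.span (monomial ` {\<nu>. comp_less \<nu> \<eta>}) \<subseteq> comps_span (length \<eta>)"
    unfolding comps_span_def by (rule mpoly.span_mono) (auto dest: comp_less_sum)
  then have "f - monomial \<eta> \<in> comps_span (length \<eta>)" using f by (auto simp: is_nonsym_macdonald_iff)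
  from comps_span_add[OF this comps_span_monomial[OF refl]]
  have "f \<in> comps_span (length \<eta>)" by simp
  moreover have "Y_eigen \<eta> f" using f by (simp add: is_nonsym_macdonald_iff)
  ultimately obtain c where c: "f = Const c * E_poly \<eta>" using Y_eigen_unique assms by blast
  then have "c = 1" using one[OF f] one[OF E] by (simp add: coefficient_scale)
  then show "f = E_poly \<eta>" using c by simp
qed

section \<open>Reduced words and symmetrization\<close>

lemma is_reduced_word_iff:
  "w permutes {1..N} \<Longrightarrow> is_reduced_word N is w \<longleftrightarrow>
    set is \<subseteq> {1..<N} \<and> word_perm is = w \<and> length is = coxeter_length N w"
  by (simp add: is_reduced_word_def perm_length_eq)

lemma adjacent_comp_cancel [simp]: "transpose i j \<circ> (transpose i j \<circ> w) = w"
  by (simp flip: comp_assoc)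

lemma is_reduced_word_ConsD:
  assumes "w permutes {1..N}" "is_reduced_word N (i # is) w"
  shows "1 \<le> i" "i < N" "inv w (Suc i) < inv w i"
    "(transpose i (Suc i) \<circ> w) permutes {1..N}" "is_reduced_word N is (transpose i (Suc i) \<circ> w)"
proof -
  let ?w = "transpose i (Suc i) \<circ> w"
  have r: "set (i # is) \<subseteq> {1..<N}" "word_perm (i # is) = w" "length (i # is) = coxeter_length N w"
    using assms by (auto simp: is_reduced_word_iff)
  then show i: "1 \<le> i" "i < N" by auto
  show p: "?w permutes {1..N}" using assms(1) i by (intro permutes_compose permutes_adjacent)
  have wp: "word_perm is = ?w" unfolding r(2)[symmetric] word_perm_Cons by simp
  have le: "coxeter_length N ?w \<le> length is"
    using coxeter_length_word[of "is" N] r(1) unfolding wp by simp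
  show lt: "inv w (Suc i) < inv w i"
  proof (rule ccontr)
    assume "\<not> ?thesis"
    then have "inv w i < inv w (Suc i)" using inv_adjacent_neq[OF assms(1), of i] by linarith
    from coxeter_length_ascent[OF assms(1) i this] show False using le r(3) by simp
  qed
  from coxeter_length_descent[OF assms(1) i lt] have "length is = coxeter_length N ?w" using r(3) by simp
  then show "is_reduced_word N is ?w" using r(1) wp is_reduced_word_iff[OF p] by simp
qed

lemma is_reduced_word_Cons:
  assumes "w permutes {1..N}" "1 \<le> i" "i < N" "inv w (Suc i) < inv w i"
    "is_reduced_word N is (transpose i (Suc i) \<circ> w)"
  shows "is_reduced_word N (i # is) w"
proof -
  have p: "(transpose i (Suc i) \<circ> w) permutes {1..N}" using assms by (intro permutes_compose permutes_adjacent)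
  have "word_perm (i # is) = w"
    using assms(5) unfolding is_reduced_word_iff[OF p] word_perm_Cons by simp
  then show ?thesis
    using assms coxeter_length_descent[OF assms(1-4)] unfolding is_reduced_word_iff[OF p]
    by (simp add: is_reduced_word_iff)
qed

lemma reduced_word_exists: "w permutes {1..N} \<Longrightarrow> \<exists>is. is_reduced_word N is w"
  using exists_word[of w N] by (simp add: is_reduced_word_iff)

text \<open>The induction step of Matsumoto's theorem. Both \<open>i\<close> and \<open>j\<close>
  are descents of \<open>w\<close>, so \<open>w\<close> also has reduced words beginning with
  \<open>i j i\<close> and \<open>j i j\<close>, or with \<open>i j\<close> and \<open>j i\<close>
  if the letters are distant, with a common tail \<open>x\<close>. The hypothesis leads from the
  given words to these, and the braid or commutation relation exchanges them.\<close>

lemma T_word_eq_aux: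
  assumes IH: "\<And>w is js. w permutes {1..N} \<Longrightarrow> is_reduced_word N is w \<Longrightarrow> is_reduced_word N js w \<Longrightarrow>
      length is = n \<Longrightarrow> foldr T_op is = foldr T_op js"
    and p: "w permutes {1..N}"
    and red: "is_reduced_word N (i # u) w" "is_reduced_word N (j # v) w" "length u = n" "i < j"
  shows "foldr T_op (i # u) = foldr T_op (j # v)"
proof -
  let ?s = "\<lambda>i. transpose i (Suc i)"
  note ri = is_reduced_word_ConsD[OF p red(1)] and rj = is_reduced_word_ConsD[OF p red(2)]
  have len: "length v = n"
    using red by (simp add: is_reduced_word_def)
  have inv: "inv (?s k \<circ> x) l = inv x (?s k l)" if "x permutes {1..N}" for k l x
    unfolding inv_adjacent_comp[OF that] by simp
  have perm: "(?s k \<circ> x) permutes {1..N}" if "x permutes {1..N}" "1 \<le> k" "k < N" for k x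
    using that by (intro permutes_compose permutes_adjacent)
  show ?thesis
  proof (cases "j = Suc i")
    case True
    let ?wi = "?s i \<circ> w" and ?wj = "?s j \<circ> w"
    let ?wji = "?s j \<circ> ?wi" and ?wij = "?s i \<circ> ?wj"
    let ?w3 = "?s i \<circ> ?wji"
    note pi = ri(4) and pj = rj(4)
    have pji: "?wji permutes {1..N}" and pij: "?wij permutes {1..N}" using perm pi pj ri rj by auto
    have p3: "?w3 permutes {1..N}" using perm[OF pji ri(1,2)] .
    \<comment> \<open>The braid relation in the symmetric group: the tail \<open>x\<close> belongs
      to both words.\<close>
    have w3: "?w3 = ?s j \<circ> ?wij" unfolding True by (auto simp: fun_eq_iff transpose_def)
    obtain x where x: "is_reduced_word N x ?w3" using reduced_word_exists[OF p3] by blast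
    have 1: "is_reduced_word N (i # x) ?wji"
      by (rule is_reduced_word_Cons[OF pji ri(1,2) _ x])
        (use ri(3) rj(3) in \<open>unfold inv[OF pi] inv[OF p], simp add: True transpose_def\<close>)
    have 2: "is_reduced_word N (j # i # x) ?wi"
      by (rule is_reduced_word_Cons[OF pi rj(1,2) _ 1])
        (use ri(3) rj(3) in \<open>unfold inv[OF p], simp add: True transpose_def\<close>)
    have 3: "is_reduced_word N (j # x) ?wij"
      by (rule is_reduced_word_Cons[OF pij rj(1,2) _ x[unfolded w3]])
        (use ri(3) rj(3) in \<open>unfold inv[OF pj] inv[OF p], simp add: True transpose_def\<close>)
    have 4: "is_reduced_word N (i # j # x) ?wj"
      by (rule is_reduced_word_Cons[OF pj ri(1,2) _ 3])
        (use ri(3) rj(3) in \<open>unfold inv[OF p], simp add: True transpose_def\<close>)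
    have "foldr T_op u = foldr T_op (j # i # x)" by (rule IH[OF pi ri(5) 2 red(3)])
    moreover have "foldr T_op v = foldr T_op (i # j # x)" by (rule IH[OF pj rj(5) 4 len])
    ultimately show ?thesis using True by (simp add: fun_eq_iff T_op_braid)
  next
    case False
    then have ij: "i + 2 \<le> j" using red(4) by simp
    let ?wi = "?s i \<circ> w" and ?wj = "?s j \<circ> w"
    let ?wji = "?s j \<circ> ?wi"
    note pi = ri(4) and pj = rj(4)
    have pji: "?wji permutes {1..N}" using perm pi rj by auto
    have wji: "?wji = ?s i \<circ> ?wj" using ij by (auto simp: fun_eq_iff transpose_def)
    obtain x where x: "is_reduced_word N x ?wji" using reduced_word_exists[OF pji] by blast
    have 1: "is_reduced_word N (j # x) ?wi"
      by (rule is_reduced_word_Cons[OF pi rj(1,2) _ x])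
        (use rj(3) ij in \<open>unfold inv[OF p], simp add: transpose_def\<close>)
    have 2: "is_reduced_word N (i # x) ?wj"
      by (rule is_reduced_word_Cons[OF pj ri(1,2) _ x[unfolded wji]])
        (use ri(3) ij in \<open>unfold inv[OF p], simp add: transpose_def\<close>)
    have "foldr T_op u = foldr T_op (j # x)" by (rule IH[OF pi ri(5) 1 red(3)])
    moreover have "foldr T_op v = foldr T_op (i # x)" by (rule IH[OF pj rj(5) 2 len])
    ultimately show ?thesis using T_op_comm[of i j] ij by (simp add: fun_eq_iff)
  qed
qed

text \<open>By this the arbitrary choice of a reduced word in \<open>T_perm\<close> is
  immaterial.\<close>

lemma T_word_eq:
  assumes "w permutes {1..N}" "is_reduced_word N is w" "is_reduced_word N js w"
  shows "foldr T_op is = foldr T_op js"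
  using assms
proof (induction "length is" arbitrary: w "is" js)
  case 0
  then have "is = []" "js = []" by (auto simp: is_reduced_word_def)
  then show ?case by simp
next
  case (Suc n)
  obtain i u where u: "is = i # u" "length u = n" using Suc(2) by (cases "is") auto
  have "length js = length is" using Suc.prems by (simp add: is_reduced_word_def)
  then obtain j v where v: "js = j # v" "length v = n" using Suc(2) by (cases js) auto
  note IH = Suc.hyps(1)[OF sym]
  consider "i = j" | "i < j" | "j < i" by linarith
  then show ?case
  proof cases
    case 1
    have "foldr T_op u = foldr T_op v"
      using IH[OF u(2) is_reduced_word_ConsD(4,5)[OF Suc.prems(1,2)[unfolded u(1)]]]
        is_reduced_word_ConsD(5)[OF Suc.prems(1,3)[unfolded v(1)]] 1 by blast
    then show ?thesis using 1 u v by simp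
  next
    case 2
    show ?thesis unfolding u v
      by (rule T_word_eq_aux[of N n, OF IH Suc.prems(1)]) (use Suc.prems u v 2 in auto)
  next
    case 3
    show ?thesis unfolding u v
      by (rule sym, rule T_word_eq_aux[of N n, OF IH Suc.prems(1)]) (use Suc.prems u v 3 in auto)
  qed
qed

lemma T_perm_eq:
  assumes "w permutes {1..N}" "is_reduced_word N is w"
  shows "T_perm N w = foldr T_op is"
  unfolding T_perm_def
  by (rule T_word_eq[OF assms(1) _ assms(2)]) (rule someI[of "\<lambda>is. is_reduced_word N is w", OF assms(2)])

lemma T_perm_ascent:
  assumes "w permutes {1..N}" "1 \<le> i" "i < N" "inv w i < inv w (Suc i)"
  shows "T_perm N (transpose i (Suc i) \<circ> w) f = T_op i (T_perm N w f)"
proof -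
  let ?w = "transpose i (Suc i) \<circ> w"
  obtain "is" where r: "is_reduced_word N is w" using reduced_word_exists[OF assms(1)] by blast
  have p: "?w permutes {1..N}" using assms by (intro permutes_compose permutes_adjacent)
  have "is_reduced_word N (i # is) ?w"
    by (rule is_reduced_word_Cons[OF p assms(2,3)])
      (use assms(4) r in \<open>simp_all add: inv_adjacent_comp[OF assms(1)]\<close>)
  then show ?thesis by (simp add: T_perm_eq[OF p] T_perm_eq[OF assms(1) r])
qed

text \<open>A first letter \<open>i <= m\<close> would not be a descent: the inverse of
  \<open>w\<close> fixes \<open>i\<close> and cannot send \<open>Suc i\<close> below itself.\<close>

lemma reduced_word_letters:
  assumes "w permutes {Suc m..N}" "is_reduced_word N is w"
  shows "set is \<subseteq> {m<..<N}"
  using assms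
proof (induction "is" arbitrary: w)
  case (Cons i "is")
  have p: "w permutes {1..N}" by (rule permutes_subset[OF Cons.prems(1)]) auto
  note r = is_reduced_word_ConsD[OF p Cons.prems(2)]
  have q: "inv w permutes {Suc m..N}" by (rule permutes_inv[OF Cons.prems(1)])
  have "m < i"
  proof (rule ccontr)
    assume "\<not> m < i"
    then have "i \<le> m" by simp
    then have "inv w i = i" using q by (simp add: permutes_def)
    moreover have "inv w (Suc i) \<ge> Suc i"
    proof (cases "Suc i \<le> m")
      case True
      then show ?thesis using q by (simp add: permutes_def)
    next
      case False
      then show ?thesis using permutes_in_image[OF q, of "Suc i"] \<open>i \<le> m\<close> r(2) by auto
    qed
    ultimately show False using r(3) by simp
  qed
  moreover have "set is \<subseteq> {m<..<N}"
  proof (rule Cons.IH[OF _ r(5)])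
    show "transpose i (Suc i) \<circ> w permutes {Suc m..N}"
      using \<open>m < i\<close> r(2) by (intro permutes_compose[OF Cons.prems(1)] permutes_swap_id) auto
  qed
  ultimately show ?case using r(2) by simp
qed simp

section \<open>The symmetrizer and its orbits\<close>

definition T_sum :: "nat \<Rightarrow> nat \<Rightarrow> qt_mpoly \<Rightarrow> qt_mpoly" where
  "T_sum N m f = (\<Sum>\<sigma> | \<sigma> permutes {Suc m..N}. T_perm N \<sigma> f)"

text \<open>Pairing \<sigma> with its product by the transposition writes the sum as
  \<open>1 + T_op i\<close> applied to a partial sum over \<open>A\<close>, and
  \<open>T (1 + T) = t (1 + T)\<close> by the quadratic relation.\<close>

lemma T_op_T_sum:
  assumes "m < i" "i < N"
  shows "T_op i (T_sum N m f) = Const tt * T_sum N m f"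
proof -
  let ?P = "{\<sigma>. \<sigma> permutes {Suc m..N}}" and ?s = "transpose i (Suc i)"
  define A where "A = {\<sigma> \<in> ?P. inv \<sigma> i < inv \<sigma> (Suc i)}"
  define B where "B = {\<sigma> \<in> ?P. inv \<sigma> (Suc i) < inv \<sigma> i}"
  have i: "1 \<le> i" using assms by simp
  have perm: "\<sigma> permutes {1..N}" if "\<sigma> \<in> ?P" for \<sigma>
    using that by (auto intro: permutes_subset)
  have s: "?s \<circ> \<sigma> \<in> ?P" if "\<sigma> \<in> ?P" for \<sigma>
    using that assms by (auto intro!: permutes_compose permutes_swap_id)
  have inv: "inv (?s \<circ> \<sigma>) l = inv \<sigma> (?s l)" if "\<sigma> \<in> ?P" for \<sigma> l
    unfolding inv_adjacent_comp[OF perm[OF that]] by simp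
  have fin: "finite A" "finite B" by (simp_all add: A_def B_def finite_permutations)
  have "?P = A \<union> B" using inv_adjacent_neq[OF perm] by (auto simp: A_def B_def) (meson nat_neq_iff)
  moreover have "A \<inter> B = {}" by (auto simp: A_def B_def)
  ultimately have split: "T_sum N m f = (\<Sum>\<sigma>\<in>A. T_perm N \<sigma> f) + (\<Sum>\<sigma>\<in>B. T_perm N \<sigma> f)"
    unfolding T_sum_def using fin by (simp add: sum.union_disjoint)
  have "(\<Sum>\<sigma>\<in>B. T_perm N \<sigma> f) = (\<Sum>\<sigma>\<in>A. T_perm N (?s \<circ> \<sigma>) f)"
  proof (rule sum.reindex_bij_witness[where i = "\<lambda>\<sigma>. ?s \<circ> \<sigma>" and j = "\<lambda>\<sigma>. ?s \<circ> \<sigma>"])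
    show "?s \<circ> \<sigma> \<in> A" if "\<sigma> \<in> B" for \<sigma>
      using that s[of \<sigma>] inv[of \<sigma>] by (simp add: A_def B_def)
    show "?s \<circ> \<sigma> \<in> B" if "\<sigma> \<in> A" for \<sigma>
      using that s[of \<sigma>] inv[of \<sigma>] by (simp add: A_def B_def)
  qed auto
  also have "\<dots> = (\<Sum>\<sigma>\<in>A. T_op i (T_perm N \<sigma> f))"
    by (rule sum.cong[OF refl]) (use T_perm_ascent[OF perm i assms(2)] in \<open>auto simp: A_def\<close>)
  also have "\<dots> = T_op i (\<Sum>\<sigma>\<in>A. T_perm N \<sigma> f)"
    by (rule linear_op_sum[OF linear_op_T, symmetric])
  finally have eq: "T_sum N m f = (\<Sum>\<sigma>\<in>A. T_perm N \<sigma> f) + T_op i (\<Sum>\<sigma>\<in>A. T_perm N \<sigma> f)"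
    using split by simp
  show ?thesis unfolding eq linear_op_add[OF linear_op_T] T_op_quadratic by (simp add: algebra_simps)
qed

lemma sum_tt_powers_nonzero:
  assumes "finite A" "A \<noteq> {}"
  shows "(\<Sum>a\<in>A. tt ^ k a) \<noteq> 0"
proof -
  have tt: "tt ^ n = Fract (monom 1 n) 1" for n
    using qq_power_tt_power[of 0 n] by simp
  have "(\<Sum>a\<in>A. tt ^ k a) = Fract (\<Sum>a\<in>A. monom 1 (k a)) 1"
    using assms(1) by (induction A rule: finite_induct) (simp_all add: tt Zero_fract_def)
  \<comment> \<open>Setting the variable \<open>tt\<close> to 1 counts the terms.\<close>
  moreover have "poly (\<Sum>a\<in>A. monom 1 (k a)) (1 :: rat poly) = of_nat (card A)"
    by (simp add: poly_sum poly_monom)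
  then have "(\<Sum>a\<in>A. monom 1 (k a)) \<noteq> (0 :: rat poly poly)" using assms by auto
  ultimately show ?thesis by (simp add: Zero_fract_def eq_fract)
qed

text \<open>The factor is the Poincare polynomial of the subgroup, the sum of \<open>tt\<close> to
  the lengths, because \<open>u_empty\<close> turns every letter into \<open>tt\<close>.\<close>

lemma u_empty_T_sum:
  shows "\<exists>c. c \<noteq> 0 \<and> u_empty (T_sum N m f) = c * u_empty f"
proof -
  let ?P = "{\<sigma>. \<sigma> permutes {Suc m..N}}"
  have "u_empty (T_perm N \<sigma> f) = tt ^ coxeter_length N \<sigma> * u_empty f" if "\<sigma> \<in> ?P" for \<sigma>
  proof -
    have p: "\<sigma> permutes {1..N}" using that by (auto intro: permutes_subset)
    obtain "is" where r: "is_reduced_word N is \<sigma>" using reduced_word_exists[OF p] by blast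
    then have l: "set is \<subseteq> {1..<N}" "length is = coxeter_length N \<sigma>" using is_reduced_word_iff[OF p] by auto
    have "u_empty (foldr T_op is f) = tt ^ length is * u_empty f"
      by (rule u_empty_foldr_T_op) (use l(1) in auto)
    then show ?thesis unfolding T_perm_eq[OF p r] l(2) .
  qed
  then have "u_empty (T_sum N m f) = (\<Sum>\<sigma>\<in>?P. tt ^ coxeter_length N \<sigma>) * u_empty f"
    unfolding T_sum_def sum_distrib_right u_empty_def evaluate_sum by simp
  moreover have "(\<Sum>\<sigma>\<in>?P. tt ^ coxeter_length N \<sigma>) \<noteq> 0"
  proof (rule sum_tt_powers_nonzero)
    show "?P \<noteq> {}" using permutes_id[of "{Suc m..N}"] by blast
  qed (simp add: finite_permutations)
  ultimately show ?thesis by blast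
qed

definition orbit :: "nat \<Rightarrow> nat list \<Rightarrow> nat list set" where
  "orbit m \<eta> = {\<nu>. take m \<nu> = take m \<eta> \<and> mset \<nu> = mset \<eta>}"

lemma orbit_length: "\<nu> \<in> orbit m \<eta> \<Longrightarrow> length \<nu> = length \<eta>"
  unfolding orbit_def by (auto dest: mset_eq_length)

lemma orbit_swap:
  assumes "\<nu> \<in> orbit m \<eta>" "m < i" "i < length \<eta>"
  shows "swap_parts i \<nu> \<in> orbit m \<eta>"
proof -
  have i: "1 \<le> i" "i < length \<nu>" using assms orbit_length[OF assms(1)] by auto
  have "take m (swap_parts i \<nu>) = take m \<nu>"
    unfolding swap_parts_eq_update[OF i] using assms by simp
  then show ?thesis using assms(1) mset_swap_parts[OF i] by (simp add: orbit_def)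
qed

lemma orbit_invariant:
  assumes "\<And>\<nu> i. m < i \<Longrightarrow> i < length \<nu> \<Longrightarrow> Q \<nu> \<Longrightarrow> Q (swap_parts i \<nu>)"
    and "m \<le> length \<eta>" "Q \<eta>" "\<nu> \<in> orbit m \<eta>"
  shows "Q \<nu>"
proof -
  have e: "take m \<eta> @ drop m \<eta> = \<eta>" "take m \<eta> @ drop m \<nu> = \<nu>"
    using assms(4) append_take_drop_id[of m \<nu>] by (auto simp: orbit_def)
  have "mset (take m \<eta> @ drop m \<eta>) = mset (take m \<eta> @ drop m \<nu>)"
    unfolding e using assms(4) by (simp add: orbit_def)
  then have "mset (drop m \<eta>) = mset (drop m \<nu>)" unfolding mset_append by simp
  from adjacent_swap_closed[of m Q "take m \<eta>", OF assms(1) _ _ this] show ?thesis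
    using assms(2,3) e by simp
qed

definition orbit_span :: "nat \<Rightarrow> nat list \<Rightarrow> qt_mpoly set" where
  "orbit_span m \<eta> = mpoly.span (norm_E ` orbit m \<eta>)"

lemma orbit_span_subset:
  assumes "\<eta> \<noteq> []"
  shows "orbit_span m \<eta> \<subseteq> comps_span (length \<eta>)"
  unfolding orbit_span_def
proof (rule mpoly.span_minimal)
  show "norm_E ` orbit m \<eta> \<subseteq> comps_span (length \<eta>)"
  proof (rule image_subsetI)
    fix \<nu> assume "\<nu> \<in> orbit m \<eta>"
    then have len: "length \<nu> = length \<eta>" by (rule orbit_length)
    then have "\<nu> \<noteq> []" using assms by auto
    from norm_E_comps_span[OF this] show "norm_E \<nu> \<in> comps_span (length \<eta>)" unfolding len .
  qed
qed (simp add: comps_span_def)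

lemma T_op_orbit_span:
  assumes "f \<in> orbit_span m \<eta>" "m < i" "i < length \<eta>"
  shows "T_op i f \<in> orbit_span m \<eta>"
  unfolding orbit_span_def
proof (rule linear_op_span[OF linear_op_T _ assms(1)[unfolded orbit_span_def]])
  fix b assume "b \<in> norm_E ` orbit m \<eta>"
  then obtain \<nu> where \<nu>: "b = norm_E \<nu>" "\<nu> \<in> orbit m \<eta>" by blast
  have i: "1 \<le> i" "i < length \<nu>" using assms orbit_length[OF \<nu>(2)] by auto
  show "T_op i b \<in> mpoly.span (norm_E ` orbit m \<eta>)"
    unfolding \<nu>(1) T_op_norm_E[OF i]
    using \<nu>(2) orbit_swap[OF \<nu>(2) assms(2,3)]
    by (intro mpoly.span_add mpoly.span_scale mpoly.span_base) auto
qed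

lemma T_sum_orbit_span:
  assumes "f \<in> orbit_span m \<eta>" "length \<eta> = N"
  shows "T_sum N m f \<in> orbit_span m \<eta>"
  unfolding T_sum_def orbit_span_def
proof (rule mpoly.span_sum)
  fix \<sigma> assume "\<sigma> \<in> {\<sigma>. \<sigma> permutes {Suc m..N}}"
  then have q: "\<sigma> permutes {Suc m..N}" by simp
  have p: "\<sigma> permutes {1..N}" by (rule permutes_subset[OF q]) auto
  obtain "is" where r: "is_reduced_word N is \<sigma>" using reduced_word_exists[OF p] by blast
  have "set is \<subseteq> {m<..<N}" by (rule reduced_word_letters[OF q r])
  then have "foldr T_op is f \<in> orbit_span m \<eta>"
    using assms by (induction "is") (auto intro: T_op_orbit_span)
  then show "T_perm N \<sigma> f \<in> mpoly.span (norm_E ` orbit m \<eta>)"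
    unfolding T_perm_eq[OF p r] orbit_span_def .
qed

text \<open>\<open>coeff_swap\<close> and \<open>coeff_stay\<close> add up to \<open>tt\<close>, so
  \<open>dual_eval_T_op\<close> with \<open>T_op i f = tt f\<close> leaves a multiple of the
  difference of the two values, and at different parts the factor \<open>coeff_swap\<close> is
  nonzero.\<close>

lemma dual_eval_swap:
  assumes "f \<in> comps_span (length \<gamma>)" "T_op i f = Const tt * f" "1 \<le> i" "i < length \<gamma>"
  shows "dual_eval (swap_parts i \<gamma>) f = dual_eval \<gamma> f"
proof (cases "part \<gamma> i = part \<gamma> (Suc i)")
  case True
  then show ?thesis using swap_parts_equal[OF assms(3,4)] by simp
next
  case False
  let ?y = "spectral \<gamma> i" and ?z = "spectral \<gamma> (Suc i)"
  have ne: "?y - ?z \<noteq> 0" using spectral_neq[OF assms(3,4)] by simp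
  have A: "coeff_swap i \<gamma> \<noteq> 0"
    using ne spectral_eq_tt_mult[of \<gamma> i "Suc i"] False by (auto simp: coeff_swap_def)
  have "coeff_swap i \<gamma> + coeff_stay i \<gamma> = (tt * (?y - ?z)) / (?y - ?z)"
    unfolding coeff_swap_def coeff_stay_def add_divide_distrib[symmetric] by (simp add: algebra_simps)
  then have AB: "coeff_swap i \<gamma> + coeff_stay i \<gamma> = tt" using ne by simp
  have "tt * dual_eval \<gamma> f = coeff_swap i \<gamma> * dual_eval (swap_parts i \<gamma>) f + coeff_stay i \<gamma> * dual_eval \<gamma> f"
    using dual_eval_T_op[OF assms(1,3,4)] unfolding assms(2) dual_eval_scale .
  then have "coeff_swap i \<gamma> * dual_eval (swap_parts i \<gamma>) f = coeff_swap i \<gamma> * dual_eval \<gamma> f"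
    using AB by algebra
  then show ?thesis using A by simp
qed

lemma dual_eval_orbit:
  assumes "f \<in> comps_span N" "\<And>i. m < i \<Longrightarrow> i < N \<Longrightarrow> T_op i f = Const tt * f"
    and "length \<gamma> = N" "m \<le> N" "\<nu> \<in> orbit m \<gamma>"
  shows "dual_eval \<nu> f = dual_eval \<gamma> f"
proof -
  have "length \<nu> = N \<and> dual_eval \<nu> f = dual_eval \<gamma> f"
  proof (rule orbit_invariant[OF _ _ _ assms(5)])
    fix \<nu> i assume *: "m < i" "i < length \<nu>" "length \<nu> = N \<and> dual_eval \<nu> f = dual_eval \<gamma> f"
    then show "length (swap_parts i \<nu>) = N \<and> dual_eval (swap_parts i \<nu>) f = dual_eval \<gamma> f"
      using dual_eval_swap[of f \<nu> i] assms by simp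
  qed (use assms in auto)
  then show ?thesis by simp
qed

lemma orbit_span_duality:
  assumes F: "F \<in> orbit_span m \<eta>" "\<And>i. m < i \<Longrightarrow> i < N \<Longrightarrow> T_op i F = Const tt * F" "u_empty F = 1"
    and G: "G \<in> orbit_span m \<gamma>" "\<And>i. m < i \<Longrightarrow> i < N \<Longrightarrow> T_op i G = Const tt * G" "u_empty G = 1"
    and len: "length \<eta> = N" "length \<gamma> = N" "m \<le> N" "N \<ge> 1"
  shows "dual_eval \<gamma> F = dual_eval \<eta> G"
proof -
  have ne: "\<eta> \<noteq> []" "\<gamma> \<noteq> []" using len by auto
  obtain S c where S: "finite S" "S \<subseteq> orbit m \<eta>" and Fs: "F = (\<Sum>\<nu>\<in>S. Const (c \<nu>) * norm_E \<nu>)"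
    using span_image_expansion[OF F(1)[unfolded orbit_span_def]] by blast
  obtain R d where R: "finite R" "R \<subseteq> orbit m \<gamma>" and Gs: "G = (\<Sum>\<mu>\<in>R. Const (d \<mu>) * norm_E \<mu>)"
    using span_image_expansion[OF G(1)[unfolded orbit_span_def]] by blast
  have lS: "length \<nu> = N \<and> \<nu> \<noteq> []" if "\<nu> \<in> S" for \<nu>
    using that S(2) orbit_length[of \<nu> m \<eta>] len by auto
  have lR: "length \<mu> = N \<and> \<mu> \<noteq> []" if "\<mu> \<in> R" for \<mu>
    using that R(2) orbit_length[of \<mu> m \<gamma>] len by auto
  \<comment> \<open>Each \<open>norm_E\<close> has value 1 under \<open>u_empty\<close>, which
    therefore reads off the sum of the coefficients.\<close>
  have sum: "u_empty (\<Sum>\<nu>\<in>A. Const (e \<nu>) * norm_E \<nu>) = sum e A" if "\<And>\<nu>. \<nu> \<in> A \<Longrightarrow> \<nu> \<noteq> []" for A e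
  proof -
    have "u_empty (\<Sum>\<nu>\<in>A. Const (e \<nu>) * norm_E \<nu>) = (\<Sum>\<nu>\<in>A. u_empty (Const (e \<nu>) * norm_E \<nu>))"
      by (simp add: u_empty_def evaluate_sum)
    also have "\<dots> = sum e A" by (rule sum.cong) (use that in \<open>auto simp: u_empty_scale u_empty_norm_E\<close>)
    finally show ?thesis .
  qed
  have c1: "sum c S = 1" and d1: "sum d R = 1"
    using sum[of S c] sum[of R d] lS lR F(3) G(3) unfolding Fs Gs by auto
  have ev: "dual_eval \<kappa> (\<Sum>\<nu>\<in>A. Const (e \<nu>) * norm_E \<nu>) = (\<Sum>\<nu>\<in>A. e \<nu> * dual_eval \<kappa> (norm_E \<nu>))" for \<kappa> A e
    unfolding dual_eval_def evaluate_sum by (simp add: evaluate_mult)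
  have FV: "F \<in> comps_span N" and GV: "G \<in> comps_span N"
    using F(1) G(1) orbit_span_subset[OF ne(1)] orbit_span_subset[OF ne(2)] len by auto
  have constF: "dual_eval \<mu> F = dual_eval \<gamma> F" if "\<mu> \<in> R" for \<mu>
    using dual_eval_orbit[OF FV F(2) len(2,3)] R(2) that by blast
  have constG: "dual_eval \<nu> G = dual_eval \<eta> G" if "\<nu> \<in> S" for \<nu>
    using dual_eval_orbit[OF GV G(2) len(1,3)] S(2) that by blast
  have "dual_eval \<gamma> F = (\<Sum>\<mu>\<in>R. d \<mu> * dual_eval \<mu> F)"
    using constF d1 by (simp flip: sum_distrib_right)
  also have "\<dots> = (\<Sum>\<mu>\<in>R. \<Sum>\<nu>\<in>S. d \<mu> * (c \<nu> * dual_eval \<mu> (norm_E \<nu>)))"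
    unfolding Fs ev by (simp add: sum_distrib_left)
  also have "\<dots> = (\<Sum>\<mu>\<in>R. \<Sum>\<nu>\<in>S. c \<nu> * (d \<mu> * dual_eval \<nu> (norm_E \<mu>)))"
  proof (intro sum.cong refl)
    fix \<mu> \<nu> assume "\<mu> \<in> R" "\<nu> \<in> S"
    then have "dual_eval \<mu> (norm_E \<nu>) = dual_eval \<nu> (norm_E \<mu>)"
      using symmetric_dual[of \<nu>] lS lR by (simp add: symmetric_dual_def)
    then show "d \<mu> * (c \<nu> * dual_eval \<mu> (norm_E \<nu>)) = c \<nu> * (d \<mu> * dual_eval \<nu> (norm_E \<mu>))"
      by simp
  qed
  also have "\<dots> = (\<Sum>\<nu>\<in>S. c \<nu> * dual_eval \<nu> G)"
    unfolding Gs ev sum_distrib_left by (rule sum.swap)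
  also have "\<dots> = dual_eval \<eta> G"
    using constG c1 by (simp flip: sum_distrib_right)
  finally show ?thesis .
qed

text \<open>The sorting permutation takes \<open>i\<close> to its rank, so the prescribed point has
  entries inverse to \<open>qq ^ part * tt powi (1 - rank)\<close>, the spectral values.\<close>

lemma u_eval_eq_dual_eval:
  assumes "f \<in> comps_span N" "length (gamma N \<Lambda>) = N"
  shows "u_eval N \<Lambda> f = dual_eval (gamma N \<Lambda>) f"
  unfolding u_eval_def Let_def dual_eval_def sort_perm_eq
proof (rule evaluate_cong_comps[OF assms(1)])
  fix i assume i: "1 \<le> i" "i \<le> N"
  let ?g = "gamma N \<Lambda>"
  have "part (decreasing ?g) (rank_perm ?g i) = part ?g i"
    using sorts_rank_perm[of ?g] i assms(2) by (simp add: sorts_def)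
  moreover have "rank_perm ?g i = rank ?g i" using i assms(2) by (simp add: rank_perm_def)
  moreover have "inverse (tt powi (1 - int (rank ?g i))) = tt powi (int (rank ?g i) - 1)"
    using power_int_minus[of tt "1 - int (rank ?g i)"] by simp
  ultimately show "qq powi - int (part (decreasing ?g) (rank_perm ?g i)) * tt powi (int (rank_perm ?g i) - 1) =
      inverse (spectral ?g i)"
    by (simp add: spectral_def power_int_minus)
qed

lemma p_factorial_nonzero: "p_factorial (inverse tt) k \<noteq> 0"
proof -
  have "inverse tt ^ j \<noteq> 1" if "j \<ge> 1" for j
    using that tt_power_eq_iff[of "int j" 0] by (simp add: power_inverse)
  from this this[of 1] show ?thesis by (auto simp: p_factorial_def)
qed

lemma u_norm_nonzero: "u_norm N (a, lam) \<noteq> 0"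
  by (simp add: u_norm_def Let_def p_factorial_nonzero)

lemma normalized_m_macdonald_properties:
  fixes a lam
  assumes "N \<ge> length a + length lam" "N \<ge> 1"
  defines "g \<equiv> gamma N (a, lam)" and "P \<equiv> normalized_m_macdonald N (a, lam)"
  shows "length g = N" "P \<in> orbit_span (length a) g" "u_empty P = 1"
    "\<And>i. length a < i \<Longrightarrow> i < N \<Longrightarrow> T_op i P = Const tt * P"
proof -
  let ?m = "length a" and ?x = "pad (N - length a) lam"
  define \<eta> where "\<eta> = a @ rev ?x"
  have lx: "length ?x = N - ?m" using assms(1) by (simp add: pad_def)
  show lg: "length g = N" using assms(1) lx by (simp add: g_def gamma_def)
  have l\<eta>: "length \<eta> = N" using assms(1) lx by (simp add: \<eta>_def)
  have ne: "\<eta> \<noteq> []" using l\<eta> assms(2) by auto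
  \<comment> \<open>The index of the non-symmetric polynomial lists the tail in reverse, but
    \<open>orbit\<close> fixes only the first \<open>?m\<close> parts and the multiset.\<close>
  have orb: "\<eta> \<in> orbit ?m g" by (simp add: \<eta>_def g_def gamma_def orbit_def)
  define S where "S = T_sum N ?m (E_poly \<eta>)"
  define k where "k = 1 / u_norm N (a, lam)"
  have k: "k \<noteq> 0" by (simp add: k_def u_norm_nonzero)
  have M: "m_macdonald N (a, lam) = Const k * S"
    by (simp add: m_macdonald_def S_def T_sum_def k_def nonsym_macdonald_eq[OF ne, unfolded \<eta>_def] \<eta>_def)
  obtain c where "c \<noteq> 0" "u_empty S = c * u_empty (E_poly \<eta>)"
    using u_empty_T_sum unfolding S_def by blast
  then have uS: "u_empty S \<noteq> 0" using u_empty_E_poly[OF ne] by simp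
  have P: "P = Const (inverse (u_empty S)) * S"
  proof -
    \<comment> \<open>The normalization cancels the prefactor \<open>k\<close>, which only has to be
      nonzero.\<close>
    have "P = Const (1 / (k * u_empty S) * k) * S"
      by (simp add: P_def normalized_m_macdonald_def M u_empty_scale Const_mult mult.assoc)
    also have "1 / (k * u_empty S) * k = inverse (u_empty S)" using k by (simp add: divide_inverse)
    finally show ?thesis .
  qed
  show "u_empty P = 1" using uS by (simp add: P u_empty_scale)
  have "E_poly \<eta> = Const (u_empty (E_poly \<eta>)) * norm_E \<eta>"
    using u_empty_E_poly[OF ne] by (simp add: norm_E_def flip: mult.assoc Const_mult)
  then have "E_poly \<eta> \<in> orbit_span ?m g"
    unfolding orbit_span_def using orb by (metis mpoly.span_scale mpoly.span_base imageI)
  then have "S \<in> orbit_span ?m g" unfolding S_def by (rule T_sum_orbit_span[OF _ lg])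
  then show "P \<in> orbit_span ?m g" unfolding P orbit_span_def by (rule mpoly.span_scale)
  show "T_op i P = Const tt * P" if "?m < i" "i < N" for i
    unfolding P linear_op_scale[OF linear_op_T] S_def T_op_T_sum[OF that] by (rule mult.left_commute)
qed

theorem proposition10:
  fixes m N :: nat and a lam b mu :: "nat list"
  assumes "is_m_partition m (a, lam)" and "is_m_partition m (b, mu)"
    and "N \<ge> m + length lam" and "N \<ge> m + length mu"
  shows "u_eval N (b, mu) (normalized_m_macdonald N (a, lam)) =
         u_eval N (a, lam) (normalized_m_macdonald N (b, mu))"
proof (cases "N = 0")
  \<comment> \<open>Here both m-partitions are \<open>([], [])\<close>; the results above concern
    nonempty compositions.\<close>
  case True
  then show ?thesis using assms by (simp add: is_m_partition_def)
next
  case False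
  then have N: "N \<ge> 1" by simp
  have m: "length a = m" "length b = m" using assms by (auto simp: is_m_partition_def)
  have la: "N \<ge> length a + length lam" and lb: "N \<ge> length b + length mu" using assms m by auto
  note A = normalized_m_macdonald_properties[OF la N, unfolded m]
    and B = normalized_m_macdonald_properties[OF lb N, unfolded m]
  have "gamma N (a, lam) \<noteq> []" "gamma N (b, mu) \<noteq> []" using A(1) B(1) N by auto
  from subsetD[OF orbit_span_subset[OF this(1)] A(2)] subsetD[OF orbit_span_subset[OF this(2)] B(2)]
  have "normalized_m_macdonald N (a, lam) \<in> comps_span N" "normalized_m_macdonald N (b, mu) \<in> comps_span N"
    unfolding A(1) B(1) .
  moreover have "dual_eval (gamma N (b, mu)) (normalized_m_macdonald N (a, lam)) =
      dual_eval (gamma N (a, lam)) (normalized_m_macdonald N (b, mu))"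
    by (rule orbit_span_duality[OF A(2) A(4) A(3) B(2) B(4) B(3) A(1) B(1)]) (use N assms(3) in auto)
  ultimately show ?thesis using A(1) B(1) by (simp add: u_eval_eq_dual_eval)
qed

end
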